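(* Let $T>0$, $r>0$, $\theta\in(0,1]$, let $\eta:[-r,0]\to\mathbb R_+$ be $\theta$-Hölder continuous, let $b:[0,T]\times\mathcal C_r\to\mathbb R$ and $\sigma:[0,T]\times\mathbb R\to\mathbb R$ be such that $b$ and the functional $(t,\varphi)\mapsto\sigma(t,\varphi(-r))$ on $[0,T]\times\mathcal C_r$ satisfy the assumptions on the drift coefficient and on the diffusion coefficient, respectively, listed in the context, with $\beta\in(0,1)$ the time-Hölder exponent of the diffusion coefficient. Assume in addition that $b$ is $\beta$-Hölder in its first variable, i.e. there is a constant $L$ with $|b(t,x)-b(s,x)|\le L|t-s|^\beta$ for all $s,t\in[0,T]$, $x\in\mathcal C_r$. Let $0<\alpha<\frac12\wedge\theta\wedge\beta$ and $g\in W^{1-\alpha,\infty}_{[0,T]}$. For $n\in\mathbb N$ let $x^n$ be the Euler approximation defined by $$x^n(t)=z^n(t)+\sup_{0\le s\le t}\big(z^n(s)\big)^-,\quad t\in[0,T],\qquad x^n(t)=\eta(t),\quad t\in[-r,0],$$ $$z^n(t)=\eta(0)+\int_0^t b\big(k_n(s),x^n_{k_n(s)}\big)\,ds+\int_0^t\sigma\big(k_n(s),x^n(k_n(s)-r)\big)\,dg_s,\quad t\in[0,T].$$ Then $(x^n)$ is a Cauchy sequence in $C([-r,T],\mathbb R)$ with the uniform norm.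
   Context: Notation: $a^-=\max(-a,0)$, $a\wedge b=\min(a,b)$. $\mathcal C_r=C([-r,0],\mathbb R)$ with the sup norm $\|\cdot\|_{\mathcal C_r}$. For $x:[-r,T]\to\mathbb R$ continuous and $t\in[0,T]$, $x_t\in\mathcal C_r$ is $x_t(s)=x(t+s)$, $s\in[-r,0]$. With $\delta_n=T/2^n$, for $s\in[0,T]$ put $k_n(s)=i\delta_n$ where $i$ is the integer with $i\delta_n\le s<(i+1)\delta_n$. The scheme for $x^n$ is explicit: it is determined successively on the intervals $[i\delta_n,(i+1)\delta_n]$. Assumptions on the drift coefficient $b:[0,T]\times\mathcal C_r\to\mathbb R$: $b$ is measurable and there are constants with $|b(t,x)|\le L_b^2(1+\|x\|_{\mathcal C_r})$ and $|b(t,x)-b(t,y)|\le L_b^1\|x-y\|_{\mathcal C_r}$ for all $t\in[0,T]$, $x,y\in\mathcal C_r$. Assumptions on a diffusion coefficient $S:[0,T]\times\mathcal C_r\to\mathbb R$ (here $S(t,\varphi)=\sigma(t,\varphi(-r))$): there are constants and $\beta\in(0,1)$ with $|S(t,x)|\le L_\sigma^1(1+\|x\|_{\mathcal C_r})$, $|S(t,x)-S(s,x)|\le L_\sigma^3|t-s|^\beta(1+\|x\|_{\mathcal C_r})$, $|S(t,x)-S(t,y)|\le L_\sigma^2\|x-y\|_{\mathcal C_r}$ for all $s,t\in[0,T]$, $x,y\in\mathcal C_r$. $W^{1-\alpha,\infty}_{[0,T]}$ is the space of measurable $g:[0,T]\to\mathbb R$ with $$\sup_{0\le u<v\le T}\Big(\frac{|g(v)-g(u)|}{(v-u)^{1-\alpha}}+\int_u^v\frac{|g(y)-g(u)|}{(y-u)^{2-\alpha}}dy\Big)<\infty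 .$$ Integral with respect to $g$ (generalized Lebesgue–Stieltjes integral in the sense of Zähle): $$\int_a^b f\,dg:=(-1)^\alpha\int_a^b D^\alpha_{a+}f(x)\,D^{1-\alpha}_{b-}g_{b-}(x)\,dx,\qquad g_{b-}(x)=g(x)-g(b-),$$ whenever $D^\alpha_{a+}f\in L^1[a,b]$ and $D^{1-\alpha}_{b-}g_{b-}\in L^\infty[a,b]$, and $\int_c^d f\,dg:=\int_a^b \mathbf 1_{(c,d)}f\,dg$ for $a\le c<d\le b$. The Weyl–Marchaud derivatives are, for $x\in(a,b)$, $$D_{a+}^{\alpha}f(x)=\frac{1}{\Gamma(1-\alpha)}\Big(\frac{f(x)}{(x-a)^{\alpha}}+\alpha\int_a^x\frac{f(x)-f(y)}{(x-y)^{\alpha+1}}dy\Big),\quad D_{b-}^{\alpha}f(x)=\frac{(-1)^\alpha}{\Gamma(1-\alpha)}\Big(\frac{f(x)}{(b-x)^{\alpha}}+\alpha\int_x^b\frac{f(x)-f(y)}{(y-x)^{\alpha+1}}dy\Big).$$ For step functions $f$ this integral is the usual finite sum of increments of $g$. *)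

theory Defs
  imports "HOL-Analysis.Analysis"
begin

section \<open>Path spaces and segments\<close>

text \<open>The space of continuous real functions on [a,b] with the uniform metric. Its points are
  functions on the real line that are \<^const>\<open>extensional\<close> on [a,b], so that two points agreeing
  on [a,b] are equal. A path space with a delay \<open>r\<close> is \<open>C_space (- r) 0\<close>.\<close>

definition C_space :: "real \<Rightarrow> real \<Rightarrow> (real \<Rightarrow> real) metric" where
  "C_space a b = cfunspace (top_of_set {a..b}) euclidean_metric"

definition C_norm :: "real \<Rightarrow> (real \<Rightarrow> real) \<Rightarrow> real" where
  "C_norm r \<phi> = (SUP s\<in>{- r..0}. \<bar>\<phi> s\<bar>)"

definition C_borel :: "real \<Rightarrow> (real \<Rightarrow> real) measure" where
  "C_borel r = sigma (mspace (C_space (- r) 0)) {U. openin (mtopology_of (C_space (- r) 0)) U}"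

definition segment :: "real \<Rightarrow> (real \<Rightarrow> real) \<Rightarrow> real \<Rightarrow> real \<Rightarrow> real" where
  "segment r x t = (\<lambda>s\<in>{- r..0}. x (t + s))"


section \<open>Assumptions on the data\<close>

definition holder_on :: "real \<Rightarrow> real set \<Rightarrow> (real \<Rightarrow> real) \<Rightarrow> bool" where
  "holder_on \<theta> A f \<longleftrightarrow> (\<exists>C. \<forall>s\<in>A. \<forall>t\<in>A. \<bar>f t - f s\<bar> \<le> C * \<bar>t - s\<bar> powr \<theta>)"

definition drift_coefficient :: "real \<Rightarrow> real \<Rightarrow> (real \<Rightarrow> (real \<Rightarrow> real) \<Rightarrow> real) \<Rightarrow> bool" where
  "drift_coefficient r T b \<longleftrightarrow>
     (\<lambda>(t, x). b t x) \<in> borel_measurable (restrict_space borel {0..T} \<Otimes>\<^sub>M C_borel r) \<and>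
     (\<exists>L2. \<forall>t\<in>{0..T}. \<forall>x\<in>mspace (C_space (- r) 0). \<bar>b t x\<bar> \<le> L2 * (1 + C_norm r x)) \<and>
     (\<exists>L1. \<forall>t\<in>{0..T}. \<forall>x\<in>mspace (C_space (- r) 0). \<forall>y\<in>mspace (C_space (- r) 0).
        \<bar>b t x - b t y\<bar> \<le> L1 * C_norm r (\<lambda>s. x s - y s))"

definition diffusion_coefficient ::
    "real \<Rightarrow> real \<Rightarrow> real \<Rightarrow> (real \<Rightarrow> (real \<Rightarrow> real) \<Rightarrow> real) \<Rightarrow> bool" where
  "diffusion_coefficient r T \<beta> S \<longleftrightarrow>
     (\<exists>L1. \<forall>t\<in>{0..T}. \<forall>x\<in>mspace (C_space (- r) 0). \<bar>S t x\<bar> \<le> L1 * (1 + C_norm r x)) \<and>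
     (\<exists>L3. \<forall>t\<in>{0..T}. \<forall>s\<in>{0..T}. \<forall>x\<in>mspace (C_space (- r) 0).
        \<bar>S t x - S s x\<bar> \<le> L3 * \<bar>t - s\<bar> powr \<beta> * (1 + C_norm r x)) \<and>
     (\<exists>L2. \<forall>t\<in>{0..T}. \<forall>x\<in>mspace (C_space (- r) 0). \<forall>y\<in>mspace (C_space (- r) 0).
        \<bar>S t x - S t y\<bar> \<le> L2 * C_norm r (\<lambda>s. x s - y s))"

text \<open>The space W of exponent \<open>1 - \<alpha>\<close> on [0,T]. The supremum is taken in the extended
  nonnegative reals, so a divergent inner integral counts as infinite.\<close>

definition W_space :: "real \<Rightarrow> real \<Rightarrow> (real \<Rightarrow> real) set" where
  "W_space \<alpha> T = {g. g \<in> borel_measurable (restrict_space borel {0..T}) \<and>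
     (SUP (u, v)\<in>{(u, v). 0 \<le> u \<and> u < v \<and> v \<le> T}.
        ennreal (\<bar>g v - g u\<bar> / (v - u) powr (1 - \<alpha>)) +
        (\<integral>\<^sup>+y\<in>{u<..<v}. ennreal (\<bar>g y - g u\<bar> / (y - u) powr (2 - \<alpha>)) \<partial>lborel)) < \<infinity>}"


section \<open>The generalized Lebesgue-Stieltjes integral\<close>

definition weyl_left :: "real \<Rightarrow> real \<Rightarrow> (real \<Rightarrow> real) \<Rightarrow> real \<Rightarrow> real" where
  "weyl_left \<alpha> a f x = 1 / Gamma (1 - \<alpha>) *
     (f x / (x - a) powr \<alpha> +
      \<alpha> * (LINT y:{a<..<x}|lborel. (f x - f y) / (x - y) powr (\<alpha> + 1)))"

text \<open>Powers of -1 are principal complex powers, \<open>(- 1) powr \<alpha> = exp (\<i> * pi * \<alpha>)\<close>.\<close>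

definition weyl_right :: "real \<Rightarrow> real \<Rightarrow> (real \<Rightarrow> real) \<Rightarrow> real \<Rightarrow> complex" where
  "weyl_right \<alpha> b f x = (- 1) powr complex_of_real \<alpha> / complex_of_real (Gamma (1 - \<alpha>)) *
     complex_of_real (f x / (b - x) powr \<alpha> +
      \<alpha> * (LINT y:{x<..<b}|lborel. (f x - f y) / (y - x) powr (\<alpha> + 1)))"

definition left_shift :: "(real \<Rightarrow> real) \<Rightarrow> real \<Rightarrow> real \<Rightarrow> real" where
  "left_shift g b x = g x - Lim (at_left b) g"

definition gls_integrable ::
    "real \<Rightarrow> real \<Rightarrow> real \<Rightarrow> (real \<Rightarrow> real) \<Rightarrow> (real \<Rightarrow> real) \<Rightarrow> bool" where
  "gls_integrable \<alpha> a b f g \<longleftrightarrow>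
     set_integrable lborel {a<..<b} (weyl_left \<alpha> a f) \<and>
     set_borel_measurable lborel {a<..<b} (weyl_right (1 - \<alpha>) b (left_shift g b)) \<and>
     (\<exists>C. AE x\<in>{a<..<b} in lborel. norm (weyl_right (1 - \<alpha>) b (left_shift g b) x) \<le> C)"

text \<open>The value is real because the two complex factors multiply to
  \<open>(- 1) powr \<alpha> * (- 1) powr (1 - \<alpha>) = - 1\<close>, so nothing is lost by taking the real part.
  As for the Bochner integral, the value is 0 where the integral does not exist.\<close>

definition gls_integral ::
    "real \<Rightarrow> real \<Rightarrow> real \<Rightarrow> (real \<Rightarrow> real) \<Rightarrow> (real \<Rightarrow> real) \<Rightarrow> real" where
  "gls_integral \<alpha> a b f g =
     (if gls_integrable \<alpha> a b f g
      then Re ((- 1) powr complex_of_real \<alpha> *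
        (LINT x:{a<..<b}|lborel.
           complex_of_real (weyl_left \<alpha> a f x) * weyl_right (1 - \<alpha>) b (left_shift g b) x))
      else 0)"


section \<open>The Euler scheme\<close>

definition grid_point :: "real \<Rightarrow> nat \<Rightarrow> real \<Rightarrow> real" where
  "grid_point T n s = of_int \<lfloor>s / (T / 2 ^ n)\<rfloor> * (T / 2 ^ n)"

text \<open>The equations defining the approximation of level \<open>n\<close>. Continuity of \<open>x\<close> is not assumed:
  the right-hand side on the i-th grid interval uses \<open>x\<close> only up to the i-th grid point, so the
  equations determine \<open>x\<close> on [-r,T], interval by interval, and make it continuous there.\<close>

definition euler_scheme ::
    "real \<Rightarrow> real \<Rightarrow> real \<Rightarrow> (real \<Rightarrow> real) \<Rightarrow> (real \<Rightarrow> (real \<Rightarrow> real) \<Rightarrow> real) \<Rightarrow>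
     (real \<Rightarrow> real \<Rightarrow> real) \<Rightarrow> (real \<Rightarrow> real) \<Rightarrow> nat \<Rightarrow> (real \<Rightarrow> real) \<Rightarrow> (real \<Rightarrow> real) \<Rightarrow> bool" where
  "euler_scheme \<alpha> r T \<eta> b \<sigma> g n x z \<longleftrightarrow>
     (\<forall>t\<in>{0..T}. x t = z t + (SUP s\<in>{0..t}. max (- z s) 0)) \<and>
     (\<forall>t\<in>{- r..0}. x t = \<eta> t) \<and>
     (\<forall>t\<in>{0..T}. z t = \<eta> 0
        + (LINT s:{0..t}|lborel. b (grid_point T n s) (segment r x (grid_point T n s)))
        + gls_integral \<alpha> 0 t (\<lambda>s. \<sigma> (grid_point T n s) (x (grid_point T n s - r))) g)"

end

theory Submission
  imports Defs
begin

text \<open>The fractional integral of order \<open>1 - \<alpha>\<close> inverts the Marchaud derivative: truncating the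
  derivative at distance \<open>\<epsilon>\<close> turns the composition into the convolution with an approximate identity.
  Hence the generalized Lebesgue-Stieltjes integral of a step function is a fixed multiple of the
  finite sum of increments of \<open>g\<close>, and from then on \<open>g\<close> enters only as a \<open>(1 - \<alpha>)\<close>-Hoelder function.

  Let \<open>\<gamma> = min \<theta> (min \<beta> (1 - \<alpha>)) > \<alpha>\<close>. For a \<open>\<gamma>\<close>-Hoelder integrand, passing from one dyadic level
  \<open>k\<close> to the next changes the increment over \<open>[s, t]\<close> of the sums by at most
  \<open>const * 2 ^ (- k * (\<gamma> - \<alpha>)) * (t - s) powr (1 - \<alpha>)\<close>, because
  \<open>(\<Sum>i<N. a i powr (1 - \<alpha>)) \<le> N powr \<alpha> * (\<Sum>i<N. a i) powr (1 - \<alpha>)\<close>. This bounds the sums in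
  Hoelder norm uniformly in the level and makes their tails uniformly small.

  Because of the delay, the diffusion integrand on \<open>[0, \<tau> + r]\<close> only involves the solution up to \<open>\<tau>\<close>,
  so an induction over steps of length \<open>r\<close> gives uniform Hoelder bounds on the approximations, and a
  second one their uniform convergence. In each step the drift is absorbed by Gronwall's argument,
  as the reflection map is Lipschitz for the uniform norm.\<close>

section \<open>Power integrals\<close>

text \<open>Two obstacles shape the argument. First, a Hoelder bound on \<open>g\<close> of order
  \<open>1 - \<alpha>\<close> does not make the Marchaud derivative of the same order converge:
  after division only \<open>1 / (y - x)\<close> is left. Convergence comes from the integral part
  of \<open>W_space\<close>, and even then the local and the nonlocal term cannot be separated at
  the singularity. The truncation makes both terms integrable by themselves, so that Fubini applies.
  Second, convergence cannot be carried through the reflection in Hoelder norm, because the running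
  supremum is not Lipschitz there, while uniform convergence of the integrands alone does not
  control sums of growing level. Hence the combination of a Hoelder bound that is merely uniform in
  the level with convergence in the uniform norm. The Hoelder bound does survive the reflection: an
  increment of the running supremum over \<open>[s, t]\<close> is at most the largest deviation of
  the path from its value at \<open>s\<close>. No limit equation is solved; two levels are compared
  directly.\<close>

lemma set_integral_FTC_nonneg:
  fixes F f :: "real \<Rightarrow> real"
  assumes ab: "a \<le> b" and F: "continuous_on {a..b} F"
    and d: "\<And>x. x \<in> {a<..<b} \<Longrightarrow> (F has_real_derivative f x) (at x)"
    and nn: "\<And>x. x \<in> {a<..<b} \<Longrightarrow> 0 \<le> f x"
    and m: "f \<in> borel_measurable borel"
  shows "set_integrable lborel {a<..<b} f" and "(LINT x:{a<..<b}|lborel. f x) = F b - F a"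
proof -
  have "(f has_integral (F b - F a)) {a..b}"
    using d F ab by (intro fundamental_theorem_of_calculus_interior)
      (auto simp: has_real_derivative_iff_has_vector_derivative)
  then have hi: "(f has_integral (F b - F a)) {a<..<b}"
    by (simp add: has_integral_Icc_iff_Ioo)
  \<comment> \<open>Nonnegativity makes the gauge integral absolute. Only \<open>F\<close> is
    continuous at the ends, so \<open>f\<close> may be singular there.\<close>
  then have ai: "f absolutely_integrable_on {a<..<b}"
    using nn by (intro nonnegative_absolutely_integrable_1) (auto simp: has_integral_integrable)
  show si: "set_integrable lborel {a<..<b} f"
    using ai m unfolding set_integrable_def by (subst (asm) integrable_completion) auto
  show "(LINT x:{a<..<b}|lborel. f x) = F b - F a"
    using set_borel_integral_eq_integral(2)[OF si] hi by (simp add: integral_unique)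
qed

lemma set_integral_powr_left:
  fixes q c t :: real
  assumes "0 < q" "c \<le> t"
  shows "set_integrable lborel {c<..<t} (\<lambda>x. (x - c) powr (q - 1))"
    and "(LINT x:{c<..<t}|lborel. (x - c) powr (q - 1)) = (t - c) powr q / q"
proof -
  define F where "F = (\<lambda>x. (x - c) powr q / q)"
  have 1: "continuous_on {c..t} F" unfolding F_def using assms 
    by (auto intro!: continuous_intros continuous_on_powr')
  have 2: "(F has_real_derivative (x - c) powr (q - 1)) (at x)" if "x \<in> {c<..<t}" for x
    unfolding F_def using that assms by (auto intro!: derivative_eq_intros)
  have 3: "(\<lambda>x. (x - c) powr (q - 1)) \<in> borel_measurable borel" by measurable
  show "set_integrable lborel {c<..<t} (\<lambda>x. (x - c) powr (q - 1))"
    by (rule set_integral_FTC_nonneg(1)[OF _ 1 2 _ 3]) (use assms in auto)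
  show "(LINT x:{c<..<t}|lborel. (x - c) powr (q - 1)) = (t - c) powr q / q"
    by (subst set_integral_FTC_nonneg(2)[OF _ 1 2 _ 3]) (use assms in \<open>auto simp: F_def\<close>)
qed

lemma set_integral_powr_right:
  fixes q c d x :: real
  assumes "0 < q" "c \<le> d" "d < x"
  shows "set_integrable lborel {c<..<d} (\<lambda>y. 1 / (x - y) powr (q + 1))"
    and "(LINT y:{c<..<d}|lborel. 1 / (x - y) powr (q + 1)) = ((x - d) powr (-q) - (x - c) powr (-q)) / q"
proof -
  define F where "F = (\<lambda>y. (x - y) powr (-q) / q)"
  have 1: "continuous_on {c..d} F" unfolding F_def using assms 
    by (auto intro!: continuous_intros)
  have 2: "(F has_real_derivative 1 / (x - y) powr (q + 1)) (at y)" if "y \<in> {c<..<d}" for y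
    unfolding F_def using that assms 
    by (auto intro!: derivative_eq_intros simp: powr_minus powr_add powr_diff field_simps)
  have 3: "(\<lambda>y. 1 / (x - y) powr (q + 1)) \<in> borel_measurable borel" by measurable
  show "set_integrable lborel {c<..<d} (\<lambda>y. 1 / (x - y) powr (q + 1))"
    by (rule set_integral_FTC_nonneg(1)[OF _ 1 2 _ 3]) (use assms in auto)
  show "(LINT y:{c<..<d}|lborel. 1 / (x - y) powr (q + 1)) = ((x - d) powr (-q) - (x - c) powr (-q)) / q"
    by (subst set_integral_FTC_nonneg(2)[OF _ 1 2 _ 3]) (use assms in \<open>auto simp: F_def diff_divide_distrib\<close>)
qed

lemma set_integral_powr_right':
  fixes q c d x :: real
  assumes "0 < q" "x < c" "c \<le> d"
  shows "set_integrable lborel {c<..<d} (\<lambda>y. 1 / (y - x) powr (q + 1))"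
    and "(LINT y:{c<..<d}|lborel. 1 / (y - x) powr (q + 1)) = ((c - x) powr (-q) - (d - x) powr (-q)) / q"
proof -
  define F where "F = (\<lambda>y. - ((y - x) powr (-q)) / q)"
  have 1: "continuous_on {c..d} F" unfolding F_def using assms 
    by (auto intro!: continuous_intros)
  have 2: "(F has_real_derivative 1 / (y - x) powr (q + 1)) (at y)" if "y \<in> {c<..<d}" for y
    unfolding F_def using that assms 
    by (auto intro!: derivative_eq_intros simp: powr_minus powr_add powr_diff field_simps)
  have 3: "(\<lambda>y. 1 / (y - x) powr (q + 1)) \<in> borel_measurable borel" by measurable
  show "set_integrable lborel {c<..<d} (\<lambda>y. 1 / (y - x) powr (q + 1))"
    by (rule set_integral_FTC_nonneg(1)[OF _ 1 2 _ 3]) (use assms in auto)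
  show "(LINT y:{c<..<d}|lborel. 1 / (y - x) powr (q + 1)) = ((c - x) powr (-q) - (d - x) powr (-q)) / q"
    by (subst set_integral_FTC_nonneg(2)[OF _ 1 2 _ 3]) (use assms in \<open>auto simp: F_def diff_divide_distrib\<close>)
qed

text \<open>The substitution \<open>(x - c) / (y - x)\<close>, with derivative
  \<open>(y - c) / (y - x)^2\<close>, turns the integrand into a pure power, so this integral of
  beta type is elementary. That is why the truncated composition has an explicit kernel.\<close>

lemma set_integral_beta_quotient:
  fixes p c d y :: real
  assumes "0 < p" "c \<le> d" "d < y"
  shows "set_integrable lborel {c<..<d} (\<lambda>x. (x - c) powr (p - 1) / (y - x) powr (p + 1))"
    and "p * (LINT x:{c<..<d}|lborel. (x - c) powr (p - 1) / (y - x) powr (p + 1))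
      = ((d - c) / (y - d)) powr p / (y - c)"
proof -
  define F where "F = (\<lambda>x. ((x - c) / (y - x)) powr p / (p * (y - c)))"
  have 1: "continuous_on {c..d} F" unfolding F_def using assms 
    by (auto intro!: continuous_intros continuous_on_powr')
  have 2: "(F has_real_derivative (x - c) powr (p - 1) / (y - x) powr (p + 1)) (at x)" if "x \<in> {c<..<d}" for x
  proof -
    have pos: "x - c > 0" "y - x > 0" "y - c > 0" using that assms by auto
    have "((\<lambda>x. (x - c) / (y - x)) has_real_derivative (y - c) / (y - x)^2) (at x)"
      using pos by (auto intro!: derivative_eq_intros simp: power2_eq_square)
    then have "((\<lambda>x. ((x - c) / (y - x)) powr p) has_real_derivative
        p * ((x - c) / (y - x)) powr (p - of_nat 1) * ((y - c) / (y - x)^2)) (at x)"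
      by (rule DERIV_fun_powr) (use pos in simp)
    then have "(F has_real_derivative
        p * ((x - c) / (y - x)) powr (p - of_nat 1) * ((y - c) / (y - x)^2) / (p * (y - c))) (at x)"
      unfolding F_def by (rule DERIV_cdivide)
    moreover have "p * ((x - c) / (y - x)) powr (p - of_nat 1) * ((y - c) / (y - x)^2) / (p * (y - c))
        = (x - c) powr (p - 1) / (y - x) powr (p + 1)"
    proof -
      have "(y - x) powr (p + 1) = (y - x) powr (p - 1) * (y - x)^2"
        using pos powr_add[of "y - x" "p - 1" 2] by (simp add: add.commute)
      then show ?thesis using pos assms by (simp add: powr_divide)
    qed
    ultimately show ?thesis by simp
  qed
  have 3: "(\<lambda>x. (x - c) powr (p - 1) / (y - x) powr (p + 1)) \<in> borel_measurable borel" by measurable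
  show "set_integrable lborel {c<..<d} (\<lambda>x. (x - c) powr (p - 1) / (y - x) powr (p + 1))"
    by (rule set_integral_FTC_nonneg(1)[OF _ 1 2 _ 3]) (use assms in auto)
  show "p * (LINT x:{c<..<d}|lborel. (x - c) powr (p - 1) / (y - x) powr (p + 1))
      = ((d - c) / (y - d)) powr p / (y - c)"
    by (subst set_integral_FTC_nonneg(2)[OF _ 1 2 _ 3]) (use assms in \<open>auto simp: F_def\<close>)
qed

section \<open>The kernel of the truncated Marchaud derivative\<close>

text \<open>The variable is the distance from the lower end \<open>c\<close> in units of the
  truncation length. The power of \<open>u\<close> comes from the local term, the power of
  \<open>u - 1\<close> from the nonlocal one, which reaches only points farther than one unit from
  \<open>c\<close>; hence the clipping at 0.\<close>

definition frac_kernel :: "real \<Rightarrow> real \<Rightarrow> real" where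
  "frac_kernel p u = (u powr p - (max (u - 1) 0) powr p) / u"

definition frac_mass :: "real \<Rightarrow> real" where
  "frac_mass p = (LINT u:{0<..}|lborel. frac_kernel p u)"

lemma frac_kernel_measurable [measurable]: "frac_kernel p \<in> borel_measurable borel"
  unfolding frac_kernel_def by measurable

lemma frac_kernel_nonneg: "0 < p \<Longrightarrow> 0 < u \<Longrightarrow> 0 \<le> frac_kernel p u"
  unfolding frac_kernel_def by (auto intro!: divide_nonneg_pos powr_mono2)

lemma frac_kernel_le_near: "0 < u \<Longrightarrow> frac_kernel p u \<le> u powr (p - 1)"
  unfolding frac_kernel_def by (simp add: powr_diff divide_right_mono)

text \<open>For a base in [0, 1] and an exponent below 1 the power is at least the base. With base
  \<open>1 - 1 / u\<close> this gains a factor \<open>1 / u\<close> in the numerator, and the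
  resulting decay is integrable at infinity.\<close>

lemma frac_kernel_le_far:
  assumes p: "0 < p" "p < 1" and u: "1 \<le> u"
  shows "frac_kernel p u \<le> u powr (p - 2)"
proof -
  have "1 - 1 / u \<le> (1 - 1 / u) powr p"
  proof (cases "u = 1")
    case False
    then have "(1 - 1 / u) powr 1 \<le> (1 - 1 / u) powr p"
      using u p by (intro powr_mono') auto
    then show ?thesis using u by simp
  qed (use p in auto)
  moreover have "u * (1 - 1 / u) = u - 1"
    using u by (simp add: field_simps)
  then have "(u - 1) powr p = u powr p * (1 - 1 / u) powr p"
    using u by (subst powr_mult [symmetric]) auto
  ultimately have "u powr p * (1 - 1 / u) \<le> (u - 1) powr p"
    by (simp add: mult_left_mono)
  then have "u powr p - (u - 1) powr p \<le> u powr p / u"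
    by (simp add: algebra_simps)
  then have "frac_kernel p u \<le> u powr p / u / u"
    using u unfolding frac_kernel_def by (intro divide_right_mono) auto
  also have "\<dots> = u powr (p - 2)"
    using u by (simp add: powr_diff power2_eq_square)
  finally show ?thesis .
qed

lemma frac_kernel_integrable:
  assumes p: "0 < p" "p < 1"
  shows "set_integrable lborel {0<..} (frac_kernel p)"
proof -
  have "(\<lambda>u::real. u powr (p - 2)) absolutely_integrable_on {1..}"
    using has_integral_powr_to_inf[of "p - 2" 1] p
    by (intro nonnegative_absolutely_integrable_1) (auto simp: has_integral_integrable)
  then have far: "set_integrable lborel {1..} (\<lambda>u. u powr (p - 2))"
    unfolding set_integrable_def by (subst (asm) integrable_completion) auto
  have near: "set_integrable lborel {0<..<1} (\<lambda>u. u powr (p - 1))"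
    using set_integral_powr_left(1)[of p 0 1] p by simp
  have "set_integrable lborel {0<..<1} (frac_kernel p)"
    by (rule set_integrable_bound[OF near])
       (auto simp: set_borel_measurable_def frac_kernel_nonneg p intro!: frac_kernel_le_near)
  moreover have "set_integrable lborel {1..} (frac_kernel p)"
    by (rule set_integrable_bound[OF far])
       (auto simp: set_borel_measurable_def frac_kernel_nonneg p intro!: frac_kernel_le_far)
  ultimately have "set_integrable lborel ({0<..<1} \<union> {1..}) (frac_kernel p)"
    by (intro set_integrable_Un) auto
  then show ?thesis
    by (rule set_integrable_subset) auto
qed

lemma frac_kernel_scale:
  assumes "0 < p" "0 < e" "c < y"
  shows "e powr (-p) * (y - c) powr (p - 1) - ((max (y - c - e) 0) / e) powr p / (y - c)
    = frac_kernel p ((y - c) / e) / e"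
proof -
  have "max ((y - c) / e - 1) 0 = max (y - c - e) 0 / e"
    using assms by (auto simp: max_def field_simps)
  moreover have "((y - c) / e) powr p / (y - c) = e powr (-p) * (y - c) powr (p - 1)"
    using assms by (simp add: powr_divide powr_minus powr_diff field_simps)
  ultimately show ?thesis
    using assms unfolding frac_kernel_def by (simp add: diff_divide_distrib [of "_ powr p"])
qed

lemma integrable_pair_product:
  fixes a b :: "real \<Rightarrow> real"
  assumes a: "integrable lborel a" and b: "integrable lborel b"
  shows "integrable (lborel \<Otimes>\<^sub>M lborel) (\<lambda>(x, y). a x * b y)"
proof (rule lborel_pair.Fubini_integrable)
  have [measurable]: "a \<in> borel_measurable borel" "b \<in> borel_measurable borel"
    using borel_measurable_integrable[OF a] borel_measurable_integrable[OF b] by simp_all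
  show "(\<lambda>(x, y). a x * b y) \<in> borel_measurable (lborel \<Otimes>\<^sub>M lborel)" by measurable
  show "integrable lborel (\<lambda>x. LINT y|lborel. norm (case (x, y) of (x, y) \<Rightarrow> a x * b y))"
    using a by (simp add: abs_mult)
  show "AE x in lborel. integrable lborel (\<lambda>y. case (x, y) of (x, y) \<Rightarrow> a x * b y)"
    using b by simp
qed

text \<open>Away from the diagonal the nonlocal term may be integrated in \<open>x\<close> before
  \<open>y\<close>, and the integral in \<open>x\<close> is the elementary one of
  \<open>set_integral_beta_quotient\<close>. Local and nonlocal term then combine into one kernel in
  \<open>(y - c) / e\<close>.\<close>

lemma frac_integral_truncated:
  fixes h :: "real \<Rightarrow> real"
  assumes p: "0 < p" "p < 1" and ct: "c < t" and e: "0 < e"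
    and h: "continuous_on UNIV h"
  defines "\<phi> \<equiv> \<lambda>x. e powr (-p) * h x - p * (LINT y:{x+e<..<t}|lborel. h y / (y - x) powr (p + 1))"
  shows "(LINT x:{c<..<t}|lborel. (x - c) powr (p - 1) * \<phi> x)
    = (LINT u:{0<..}|lborel. indicat_real {0<..<(t-c)/e} u * h (c + e * u) * frac_kernel p u)"
proof -
  have hm [measurable]: "h \<in> borel_measurable borel"
    using h by (simp add: borel_measurable_continuous_onI)
  obtain M where M: "\<And>y. y \<in> {c..t} \<Longrightarrow> \<bar>h y\<bar> \<le> M"
  proof -
    have "compact (h ` {c..t})"
      using h by (intro compact_continuous_image) (auto intro: continuous_on_subset)
    then show ?thesis using that unfolding compact_eq_bounded_closed bounded_iff by (metis imageI real_norm_def)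
  qed
  have M0: "0 \<le> M" using M[of c] ct by auto
  define w where "w = (\<lambda>x. (x - c) powr (p - 1))"
  have wm [measurable]: "w \<in> borel_measurable borel" unfolding w_def by measurable
  have wi: "set_integrable lborel {c<..<t} w"
    unfolding w_def using set_integral_powr_left(1)[of p c t] p ct by simp
  define f where "f = (\<lambda>x y. if c < x \<and> x + e < y \<and> y < t then w x * (h y / (y - x) powr (p + 1)) else 0)"
  have fm [measurable]: "(\<lambda>(x, y). f x y) \<in> borel_measurable (borel \<Otimes>\<^sub>M borel)"
    unfolding f_def by measurable
  \<comment> \<open>On the support \<open>y - x > e\<close>, so the singular factor is at most
    \<open>1 / e powr (p + 1)\<close>. The remaining singularity is that of the integrable weight
    \<open>w\<close>.\<close>
  have fi: "integrable (lborel \<Otimes>\<^sub>M lborel) (\<lambda>(x, y). f x y)"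
  proof (rule Bochner_Integration.integrable_bound)
    show "integrable (lborel \<Otimes>\<^sub>M lborel)
       (\<lambda>(x, y). (indicat_real {c<..<t} x * w x) * (indicat_real {c<..<t} y * (M / e powr (p+1))))"
      using wi ct by (intro integrable_pair_product integrable_mult_left integrable_real_indicator)
        (auto simp: set_integrable_def)
    show "AE z in lborel \<Otimes>\<^sub>M lborel. norm (case z of (x, y) \<Rightarrow> f x y)
        \<le> norm (case z of (x, y) \<Rightarrow>
              (indicat_real {c<..<t} x * w x) * (indicat_real {c<..<t} y * (M / e powr (p+1))))"
    proof (intro AE_I2, clarsimp simp: f_def)
      fix x y assume *: "c < x" "x + e < y" "y < t"
      have "\<bar>h y\<bar> / (y - x) powr (p + 1) \<le> M / e powr (p + 1)"
        using * M[of y] e p by (intro frac_le) (auto intro!: powr_mono2)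
      then have "\<bar>w x\<bar> * (\<bar>h y\<bar> / (y - x) powr (p + 1)) \<le> \<bar>w x\<bar> * (M / e powr (p + 1))"
        by (rule mult_left_mono) simp
      then show "\<bar>w x * h y\<bar> / (y - x) powr (p + 1)
         \<le> \<bar>indicat_real {c<..<t} x * w x * (indicat_real {c<..<t} y * M)\<bar> / e powr (p + 1)"
        using * e M0 by (simp add: abs_mult)
    qed
  qed auto
  \<comment> \<open>For fixed \<open>y\<close> the variable \<open>x\<close> runs from
    \<open>c\<close> to \<open>y - e\<close>. The \<open>max\<close> covers the points within
    \<open>e\<close> of \<open>c\<close>, for which this range is empty.\<close>
  have inner_x: "p * (LINT x|lborel. f x y)
      = indicator {c<..<t} y * h y * ((max (y - c - e) 0 / e) powr p / (y - c))" for y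
  proof (cases "c < y - e \<and> y < t")
    case True
    have "(LINT x|lborel. f x y)
        = (LINT x|lborel. h y * (indicat_real {c<..<y-e} x *\<^sub>R (w x / (y - x) powr (p + 1))))"
      using True by (intro Bochner_Integration.integral_cong) (auto simp: f_def indicator_def)
    also have "\<dots> = h y * (LINT x:{c<..<y-e}|lborel. w x / (y - x) powr (p + 1))"
      by (simp only: set_lebesgue_integral_def integral_mult_right_zero)
    finally have "p * (LINT x|lborel. f x y)
        = h y * (p * (LINT x:{c<..<y-e}|lborel. w x / (y - x) powr (p + 1)))" by simp
    also have "p * (LINT x:{c<..<y-e}|lborel. w x / (y - x) powr (p + 1))
        = (max (y - c - e) 0 / e) powr p / (y - c)"
    proof -
      have eq: "max (y - c - e) 0 = y - e - c" using True by simp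
      show ?thesis
        unfolding eq w_def
        using set_integral_beta_quotient(2)[of p c "y - e" y] True e p by simp
    qed
    finally show ?thesis using True e by simp
  next
    case False
    then have "f x y = 0" for x by (auto simp: f_def)
    then show ?thesis using False p by (auto simp: max_def indicator_def)
  qed
  have wh: "integrable lborel (\<lambda>x. indicat_real {c<..<t} x * (e powr (-p) * w x * h x))"
  proof (rule Bochner_Integration.integrable_bound)
    show "integrable lborel (\<lambda>x. e powr (-p) * M * (indicat_real {c<..<t} x * w x))"
      using wi by (auto simp: set_integrable_def)
    show "AE x in lborel. norm (indicat_real {c<..<t} x * (e powr (-p) * w x * h x))
       \<le> norm (e powr (-p) * M * (indicat_real {c<..<t} x * w x))"
      using M M0 by (intro AE_I2) (auto simp: indicator_def abs_mult mult_ac intro!: mult_right_mono)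
  qed auto
  have "(LINT x:{c<..<t}|lborel. (x - c) powr (p - 1) * \<phi> x)
      = (LINT x|lborel. indicat_real {c<..<t} x * (e powr (-p) * w x * h x) - p * (LINT y|lborel. f x y))"
    unfolding set_lebesgue_integral_def
  proof (rule Bochner_Integration.integral_cong[OF refl])
    fix x :: real
    have "(LINT y|lborel. f x y) = (LINT y|lborel. (indicat_real {c<..<t} x * w x) *
        (indicat_real {x+e<..<t} y *\<^sub>R (h y / (y - x) powr (p + 1))))"
      using e by (intro Bochner_Integration.integral_cong) (auto simp: f_def indicator_def)
    then have "(LINT y|lborel. f x y) = indicat_real {c<..<t} x * w x *
        (LINT y:{x+e<..<t}|lborel. h y / (y - x) powr (p + 1))"
      by (simp only: integral_mult_right_zero set_lebesgue_integral_def)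
    then show "indicat_real {c<..<t} x *\<^sub>R ((x - c) powr (p - 1) * \<phi> x)
        = indicat_real {c<..<t} x * (e powr (-p) * w x * h x) - p * (LINT y|lborel. f x y)"
      unfolding \<phi>_def w_def by (simp add: algebra_simps)
  qed
  also have "\<dots> = (LINT x|lborel. indicat_real {c<..<t} x * (e powr (-p) * w x * h x))
      - p * (LINT x|lborel. LINT y|lborel. f x y)"
    using wh lborel_pair.integrable_fst[OF fi] by simp
  also have "(LINT x|lborel. LINT y|lborel. f x y) = (LINT y|lborel. LINT x|lborel. f x y)"
    using lborel_pair.Fubini_integral[OF fi] by simp
  also have "(LINT x|lborel. indicat_real {c<..<t} x * (e powr (-p) * w x * h x))
      - p * (LINT y|lborel. LINT x|lborel. f x y)
      = (LINT y|lborel. indicat_real {c<..<t} y * (e powr (-p) * w y * h y) - p * (LINT x|lborel. f x y))"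
    using wh lborel_pair.integrable_snd[OF fi] by simp
  also have "\<dots> = (LINT y|lborel. indicat_real {c<..<t} y * (h y * (frac_kernel p ((y - c) / e) / e)))"
  proof (rule Bochner_Integration.integral_cong[OF refl])
    fix y :: real
    have "h y * (e powr (-p) * w y - (max (y - c - e) 0 / e) powr p / (y - c))
        = h y * (frac_kernel p ((y - c) / e) / e)" if "c < y"
      unfolding w_def using frac_kernel_scale[OF p(1) e that] by simp
    then show "indicat_real {c<..<t} y * (e powr (-p) * w y * h y) - p * (LINT x|lborel. f x y)
        = indicat_real {c<..<t} y * (h y * (frac_kernel p ((y - c) / e) / e))"
      unfolding inner_x by (auto simp: indicator_def right_diff_distrib mult_ac)
  qed
  also have "\<dots> = (LINT u|lborel. e * (indicat_real {c<..<t} (c + e * u) *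
      (h (c + e * u) * (frac_kernel p (((c + e * u) - c) / e) / e))))"
    using lborel_integral_real_affine[of e "\<lambda>y. indicat_real {c<..<t} y * (h y * (frac_kernel p ((y - c) / e) / e))" c] e
    by simp
  also have "\<dots> = (LINT u:{0<..}|lborel. indicat_real {0<..<(t-c)/e} u * h (c + e * u) * frac_kernel p u)"
    unfolding set_lebesgue_integral_def using e
    by (intro Bochner_Integration.integral_cong refl) (auto simp: indicator_def field_simps zero_less_mult_iff)
  finally show ?thesis .
qed

section \<open>Inversion of the Marchaud derivative\<close>

text \<open>The real bracket of \<open>weyl_right\<close>, without its Gamma factor and complex
  power.\<close>

definition marchaud :: "real \<Rightarrow> real \<Rightarrow> (real \<Rightarrow> real) \<Rightarrow> real \<Rightarrow> real" where
  "marchaud p t h x = h x / (t - x) powr p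
     + p * (LINT y:{x<..<t}|lborel. (h x - h y) / (y - x) powr (p + 1))"

text \<open>The difference \<open>h x - h y\<close> is already split: integrating \<open>h x\<close>
  beyond the distance \<open>e\<close> gives
  \<open>h x * (e powr (- p) - (t - x) powr (- p)) / p\<close>, and the second power cancels the
  boundary term of \<open>marchaud\<close>. This holds when \<open>x + e < t\<close>; otherwise only
  the local term is left.\<close>

definition marchaud_trunc :: "real \<Rightarrow> real \<Rightarrow> (real \<Rightarrow> real) \<Rightarrow> real \<Rightarrow> real \<Rightarrow> real" where
  "marchaud_trunc p t h e x = e powr (-p) * h x
     - p * (LINT y:{x+e<..<t}|lborel. h y / (y - x) powr (p + 1))"

text \<open>These are the properties of \<open>g - g t\<close> for \<open>g\<close> in
  \<open>W_space\<close>, with \<open>p = 1 - \<alpha>\<close>. The bound \<open>nn_int\<close> does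
  not follow from \<open>holder\<close>, which controls its integrand only by a multiple of
  \<open>1 / (y - u)\<close>.\<close>

locale marchaud_regular =
  fixes p c t C :: real and h :: "real \<Rightarrow> real"
  assumes p: "0 < p" "p < 1" and ct: "c < t"
    and cont: "continuous_on UNIV h" and h_end: "h t = 0"
    and holder: "\<And>u v. c \<le> u \<Longrightarrow> u < v \<Longrightarrow> v \<le> t \<Longrightarrow> \<bar>h v - h u\<bar> \<le> C * (v - u) powr p"
    and nn_int: "\<And>u. c \<le> u \<Longrightarrow> u < t \<Longrightarrow>
      (\<integral>\<^sup>+y\<in>{u<..<t}. ennreal (\<bar>h y - h u\<bar> / (y - u) powr (p + 1)) \<partial>lborel) \<le> ennreal C"
begin

lemma h_measurable [measurable]: "h \<in> borel_measurable borel"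
  using cont by (simp add: borel_measurable_continuous_onI)

lemma C_nonneg: "0 \<le> C"
proof -
  have "0 \<le> C * (t - c) powr p" using holder[of c t] ct by auto
  then show ?thesis using ct by (simp add: zero_le_mult_iff)
qed

lemma difference_integrable:
  assumes "c \<le> x" "x < t"
  shows "set_integrable lborel {x<..<t} (\<lambda>y. (h x - h y) / (y - x) powr (p + 1))"
    and "(LINT y:{x<..<t}|lborel. \<bar>(h x - h y) / (y - x) powr (p + 1)\<bar>) \<le> C"
proof -
  have m: "(\<lambda>y. indicat_real {x<..<t} y *\<^sub>R ((h x - h y) / (y - x) powr (p + 1))) \<in> borel_measurable borel"
    by measurable
  have eq: "(\<integral>\<^sup>+y. ennreal (norm (indicat_real {x<..<t} y *\<^sub>R ((h x - h y) / (y - x) powr (p + 1)))) \<partial>lborel)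
    = (\<integral>\<^sup>+y\<in>{x<..<t}. ennreal (\<bar>h y - h x\<bar> / (y - x) powr (p + 1)) \<partial>lborel)"
    by (intro nn_integral_cong) (auto simp: indicator_def abs_minus_commute)
  have le: "(\<integral>\<^sup>+y. ennreal (norm (indicat_real {x<..<t} y *\<^sub>R ((h x - h y) / (y - x) powr (p + 1)))) \<partial>lborel) \<le> ennreal C"
    unfolding eq using nn_int assms by blast
  show si: "set_integrable lborel {x<..<t} (\<lambda>y. (h x - h y) / (y - x) powr (p + 1))"
    unfolding set_integrable_def
  proof (rule integrableI_bounded)
    show "(\<integral>\<^sup>+y. ennreal (norm (indicat_real {x<..<t} y *\<^sub>R ((h x - h y) / (y - x) powr (p + 1)))) \<partial>lborel) < \<infinity>"
      using le_less_trans[OF le] by simp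
  qed (use m in simp)
  have "ennreal (LINT y|lborel. norm (indicat_real {x<..<t} y *\<^sub>R ((h x - h y) / (y - x) powr (p + 1)))) \<le> ennreal C"
    using le nn_integral_eq_integral[OF integrable_norm[OF si[unfolded set_integrable_def]]] by simp
  then have "(LINT y|lborel. norm (indicat_real {x<..<t} y *\<^sub>R ((h x - h y) / (y - x) powr (p + 1)))) \<le> C"
    using C_nonneg by (simp add: ennreal_le_iff)
  then show "(LINT y:{x<..<t}|lborel. \<bar>(h x - h y) / (y - x) powr (p + 1)\<bar>) \<le> C"
    unfolding set_lebesgue_integral_def by (simp add: abs_mult)
qed

lemma end_bound:
  assumes "c \<le> x" "x < t" shows "\<bar>h x\<bar> \<le> C * (t - x) powr p"
  using holder[of x t] h_end assms by simp

lemma end_bound':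
  assumes "c \<le> x" "x < t" shows "\<bar>h x / (t - x) powr p\<bar> \<le> C"
  using end_bound[OF assms] assms by (simp add: field_simps)

lemma truncated_difference_bound:
  assumes "c \<le> x" "x < t" "0 < e"
  shows "\<bar>LINT y:{x+e<..<t}|lborel. (h x - h y) / (y - x) powr (p + 1)\<bar> \<le> C"
proof -
  have "\<bar>LINT y:{x+e<..<t}|lborel. (h x - h y) / (y - x) powr (p + 1)\<bar>
     \<le> (LINT y|lborel. norm (indicat_real {x+e<..<t} y *\<^sub>R ((h x - h y) / (y - x) powr (p + 1))))"
    unfolding set_lebesgue_integral_def real_norm_def [symmetric] by (rule integral_norm_bound)
  also have "\<dots> \<le> (LINT y|lborel. norm (indicat_real {x<..<t} y *\<^sub>R ((h x - h y) / (y - x) powr (p + 1))))"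
  proof (rule integral_mono)
    show i: "integrable lborel (\<lambda>y. norm (indicat_real {x<..<t} y *\<^sub>R ((h x - h y) / (y - x) powr (p + 1))))"
      using difference_integrable(1)[OF assms(1,2)] unfolding set_integrable_def by (rule integrable_norm)
    have "set_integrable lborel {x+e<..<t} (\<lambda>y. (h x - h y) / (y - x) powr (p + 1))"
      by (rule set_integrable_subset[OF difference_integrable(1)[OF assms(1,2)]]) (use assms in auto)
    then show "integrable lborel (\<lambda>y. norm (indicat_real {x+e<..<t} y *\<^sub>R ((h x - h y) / (y - x) powr (p + 1))))"
      unfolding set_integrable_def by (rule integrable_norm)
  qed (use assms in \<open>auto simp: indicator_def\<close>)
  also have "\<dots> \<le> C"
    using difference_integrable(2)[OF assms(1,2)] unfolding set_lebesgue_integral_def by (simp add: abs_mult)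
  finally show ?thesis .
qed

lemma marchaud_trunc_eq:
  assumes x: "c \<le> x" and e: "0 < e" "x + e < t"
  shows "marchaud_trunc p t h e x = h x / (t - x) powr p
     + p * (LINT y:{x+e<..<t}|lborel. (h x - h y) / (y - x) powr (p + 1))"
proof -
  have k: "set_integrable lborel {x+e<..<t} (\<lambda>y. h x * (1 / (y - x) powr (p + 1)))"
    using set_integral_powr_right'(1)[of p x "x + e" t] p e by (intro set_integrable_mult_right) auto
  have "set_integrable lborel {x+e..t} (\<lambda>y. h y / (y - x) powr (p + 1))"
    unfolding set_integrable_def
    using e by (intro borel_integrable_compact continuous_intros continuous_on_subset[OF cont]) auto
  then have hi: "set_integrable lborel {x+e<..<t} (\<lambda>y. h y / (y - x) powr (p + 1))"
    by (rule set_integrable_subset) auto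
  have "(LINT y:{x+e<..<t}|lborel. (h x - h y) / (y - x) powr (p + 1))
     = (LINT y:{x+e<..<t}|lborel. h x * (1 / (y - x) powr (p + 1)) - h y / (y - x) powr (p + 1))"
    by (simp add: diff_divide_distrib)
  also have "\<dots> = h x * ((e powr (-p) - (t - x) powr (-p)) / p)
     - (LINT y:{x+e<..<t}|lborel. h y / (y - x) powr (p + 1))"
    unfolding set_integral_diff(2)[OF k hi] set_integral_mult_right
    using set_integral_powr_right'(2)[of p x "x + e" t] p e by simp
  finally show ?thesis
    unfolding marchaud_trunc_def using p by (simp add: field_simps powr_minus)
qed

text \<open>One bound for all truncation lengths, as dominated convergence requires. If the cut
  reaches \<open>t\<close>, only the local term remains; then \<open>t - x \<le> e\<close>, and
  because \<open>h\<close> vanishes at \<open>t\<close> the factor \<open>e powr (- p)\<close> is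
  compensated.\<close>

lemma marchaud_trunc_bound:
  assumes x: "c \<le> x" "x < t" and e: "0 < e"
  shows "\<bar>marchaud_trunc p t h e x\<bar> \<le> 2 * C"
proof (cases "x + e < t")
  case True
  have "\<bar>p * (LINT y:{x+e<..<t}|lborel. (h x - h y) / (y - x) powr (p + 1))\<bar> \<le> 1 * C"
    unfolding abs_mult using truncated_difference_bound[OF x e] p by (intro mult_mono) auto
  then show ?thesis
    unfolding marchaud_trunc_eq[OF x(1) e True] using end_bound'[OF x] by linarith
next
  case False
  have "\<bar>h x\<bar> \<le> C * e powr p"
    using end_bound[OF x] powr_mono2[of p "t - x" e] x p False C_nonneg
      mult_left_mono[of "(t - x) powr p" "e powr p" C] by fastforce
  then have "e powr (-p) * \<bar>h x\<bar> \<le> C"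
    using e by (simp add: powr_minus field_simps)
  moreover have "{x+e<..<t} = {}" using False by auto
  ultimately show ?thesis
    using C_nonneg unfolding marchaud_trunc_def by (simp add: abs_mult set_lebesgue_integral_def)
qed

lemma marchaud_bound:
  assumes x: "c \<le> x" "x < t"
  shows "\<bar>marchaud p t h x\<bar> \<le> 2 * C"
proof -
  have "\<bar>LINT y:{x<..<t}|lborel. (h x - h y) / (y - x) powr (p + 1)\<bar> \<le> C"
  proof -
    have "\<bar>LINT y:{x<..<t}|lborel. (h x - h y) / (y - x) powr (p + 1)\<bar>
     \<le> (LINT y|lborel. norm (indicat_real {x<..<t} y *\<^sub>R ((h x - h y) / (y - x) powr (p + 1))))"
      unfolding set_lebesgue_integral_def real_norm_def [symmetric] by (rule integral_norm_bound)
    then show ?thesis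
      using difference_integrable(2)[OF x] unfolding set_lebesgue_integral_def by (simp add: abs_mult)
  qed
  then have "\<bar>p * (LINT y:{x<..<t}|lborel. (h x - h y) / (y - x) powr (p + 1))\<bar> \<le> 1 * C"
    unfolding abs_mult using p by (intro mult_mono) auto
  then show ?thesis
    unfolding marchaud_def using end_bound'[OF x] by linarith
qed

lemma marchaud_trunc_tendsto:
  assumes x: "c \<le> x" "x < t" and e: "\<And>n. 0 < e n" "e \<longlonglongrightarrow> 0"
  shows "(\<lambda>n. marchaud_trunc p t h (e n) x) \<longlonglongrightarrow> marchaud p t h x"
proof -
  have "(\<lambda>n. LINT y:{x + e n<..<t}|lborel. (h x - h y) / (y - x) powr (p + 1))
     \<longlonglongrightarrow> (LINT y:{x<..<t}|lborel. (h x - h y) / (y - x) powr (p + 1))"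
    unfolding set_lebesgue_integral_def
  proof (rule integral_dominated_convergence)
    show "integrable lborel (\<lambda>y. norm (indicat_real {x<..<t} y *\<^sub>R ((h x - h y) / (y - x) powr (p + 1))))"
      using difference_integrable(1)[OF x] unfolding set_integrable_def by (rule integrable_norm)
    show "AE y in lborel. norm (indicat_real {x + e n<..<t} y *\<^sub>R ((h x - h y) / (y - x) powr (p + 1)))
       \<le> norm (indicat_real {x<..<t} y *\<^sub>R ((h x - h y) / (y - x) powr (p + 1)))" for n
      using e(1)[of n] by (intro AE_I2) (auto simp: indicator_def)
    show "AE y in lborel. (\<lambda>n. indicat_real {x + e n<..<t} y *\<^sub>R ((h x - h y) / (y - x) powr (p + 1)))
       \<longlonglongrightarrow> indicat_real {x<..<t} y *\<^sub>R ((h x - h y) / (y - x) powr (p + 1))"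
    proof (intro AE_I2 tendsto_eventually)
      fix y :: real
      show "\<forall>\<^sub>F n in sequentially. indicat_real {x + e n<..<t} y *\<^sub>R ((h x - h y) / (y - x) powr (p + 1))
         = indicat_real {x<..<t} y *\<^sub>R ((h x - h y) / (y - x) powr (p + 1))"
      proof (cases "x < y")
        case True
        then have "\<forall>\<^sub>F n in sequentially. e n < y - x"
          using order_tendstoD(2)[OF e(2), of "y - x"] by simp
        then show ?thesis by eventually_elim (use True in \<open>auto simp: indicator_def\<close>)
      next
        case False
        moreover have "\<not> x + e n < y" for n using e(1)[of n] False by linarith
        ultimately show ?thesis by simp
      qed
    qed
  qed auto
  then have "(\<lambda>n. h x / (t - x) powr p + p * (LINT y:{x + e n<..<t}|lborel. (h x - h y) / (y - x) powr (p + 1)))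
     \<longlonglongrightarrow> marchaud p t h x"
    unfolding marchaud_def by (intro tendsto_intros)
  moreover have "\<forall>\<^sub>F n in sequentially. e n < t - x"
    using order_tendstoD(2)[OF e(2), of "t - x"] x by simp
  then have "\<forall>\<^sub>F n in sequentially. h x / (t - x) powr p
       + p * (LINT y:{x + e n<..<t}|lborel. (h x - h y) / (y - x) powr (p + 1)) = marchaud_trunc p t h (e n) x"
    by eventually_elim (use marchaud_trunc_eq[OF x(1)] e(1) in auto)
  ultimately show ?thesis by (rule Lim_transform_eventually)
qed

text \<open>The domain of the inner integral moves with \<open>x\<close>. As a condition inside the
  integrand it gives a jointly measurable function on the plane, whose parameter integral is
  measurable.\<close>

lemma marchaud_trunc_measurable [measurable]: "marchaud_trunc p t h e \<in> borel_measurable borel"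
proof -
  have "(\<lambda>x. LINT y|lborel. (if x + e < y \<and> y < t then h y / (y - x) powr (p + 1) else 0)) \<in> borel_measurable borel"
    by measurable
  also have "(\<lambda>x. LINT y|lborel. (if x + e < y \<and> y < t then h y / (y - x) powr (p + 1) else 0))
     = (\<lambda>x. LINT y:{x+e<..<t}|lborel. h y / (y - x) powr (p + 1))"
    unfolding set_lebesgue_integral_def
    by (intro ext Bochner_Integration.integral_cong refl) (auto simp: indicator_def)
  finally have [measurable]: "(\<lambda>x. LINT y:{x+e<..<t}|lborel. h y / (y - x) powr (p + 1)) \<in> borel_measurable borel" .
  show ?thesis unfolding marchaud_trunc_def by measurable
qed

lemma marchaud_measurable [measurable]: "marchaud p t h \<in> borel_measurable borel"
proof -
  have "(\<lambda>x. LINT y|lborel. (if x < y \<and> y < t then (h x - h y) / (y - x) powr (p + 1) else 0)) \<in> borel_measurable borel"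
    by measurable
  also have "(\<lambda>x. LINT y|lborel. (if x < y \<and> y < t then (h x - h y) / (y - x) powr (p + 1) else 0))
     = (\<lambda>x. LINT y:{x<..<t}|lborel. (h x - h y) / (y - x) powr (p + 1))"
    unfolding set_lebesgue_integral_def
    by (intro ext Bochner_Integration.integral_cong refl) (auto simp: indicator_def)
  finally have [measurable]: "(\<lambda>x. LINT y:{x<..<t}|lborel. (h x - h y) / (y - x) powr (p + 1)) \<in> borel_measurable borel" .
  show ?thesis unfolding marchaud_def by measurable
qed

text \<open>Two dominated limits of \<open>frac_integral_truncated\<close> as \<open>e\<close> tends
  to 0. On the left \<open>2 * C\<close> bounds all truncated derivatives; on the right
  \<open>h (c + e * u)\<close> tends to \<open>h c\<close> for each \<open>u\<close>, while the
  integrable kernel dominates.\<close>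

theorem frac_integral_marchaud:
  "(LINT x:{c<..<t}|lborel. (x - c) powr (p - 1) * marchaud p t h x) = frac_mass p * h c"
proof -
  define e where "e = (\<lambda>n. 1 / real (Suc n))"
  have e: "\<And>n. 0 < e n" "e \<longlonglongrightarrow> 0"
    using LIMSEQ_inverse_real_of_nat by (simp_all add: e_def inverse_eq_divide)
  obtain M where M: "\<And>y. y \<in> {c..t} \<Longrightarrow> \<bar>h y\<bar> \<le> M"
  proof -
    have "compact (h ` {c..t})"
      using cont by (intro compact_continuous_image) (auto intro: continuous_on_subset)
    then show ?thesis using that unfolding compact_eq_bounded_closed bounded_iff by (metis imageI real_norm_def)
  qed
  have M0: "0 \<le> M" using M[of c] ct by auto
  have "(\<lambda>n. LINT x:{c<..<t}|lborel. (x - c) powr (p - 1) * marchaud_trunc p t h (e n) x)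
     \<longlonglongrightarrow> (LINT x:{c<..<t}|lborel. (x - c) powr (p - 1) * marchaud p t h x)"
    unfolding set_lebesgue_integral_def
  proof (rule integral_dominated_convergence)
    show "integrable lborel (\<lambda>x. indicat_real {c<..<t} x *\<^sub>R ((x - c) powr (p - 1)) * (2 * C))"
      using set_integral_powr_left(1)[of p c t] p ct unfolding set_integrable_def by simp
    show "AE x in lborel. norm (indicat_real {c<..<t} x *\<^sub>R ((x - c) powr (p - 1) * marchaud_trunc p t h (e n) x))
       \<le> indicat_real {c<..<t} x *\<^sub>R ((x - c) powr (p - 1)) * (2 * C)" for n
      using marchaud_trunc_bound[OF _ _ e(1)[of n]] by (intro AE_I2) (auto simp: indicator_def abs_mult intro!: mult_left_mono)
    show "AE x in lborel. (\<lambda>n. indicat_real {c<..<t} x *\<^sub>R ((x - c) powr (p - 1) * marchaud_trunc p t h (e n) x))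
       \<longlonglongrightarrow> indicat_real {c<..<t} x *\<^sub>R ((x - c) powr (p - 1) * marchaud p t h x)"
      using marchaud_trunc_tendsto[OF _ _ e] by (intro AE_I2) (auto simp: indicator_def intro!: tendsto_intros)
  qed auto
  moreover have "(\<lambda>n. LINT x:{c<..<t}|lborel. (x - c) powr (p - 1) * marchaud_trunc p t h (e n) x)
     \<longlonglongrightarrow> frac_mass p * h c"
  proof -
    have "(\<lambda>n. LINT u:{0<..}|lborel. indicat_real {0<..<(t-c) / e n} u * h (c + e n * u) * frac_kernel p u)
       \<longlonglongrightarrow> (LINT u:{0<..}|lborel. frac_kernel p u * h c)"
      unfolding set_lebesgue_integral_def
    proof (rule integral_dominated_convergence)
      show "integrable lborel (\<lambda>u. indicat_real {0<..} u *\<^sub>R frac_kernel p u * M)"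
        using frac_kernel_integrable[OF p] unfolding set_integrable_def by simp
      show "AE u in lborel. norm (indicat_real {0<..} u *\<^sub>R
            (indicat_real {0<..<(t-c) / e n} u * h (c + e n * u) * frac_kernel p u))
          \<le> indicat_real {0<..} u *\<^sub>R frac_kernel p u * M" for n
      proof (intro AE_I2)
        fix u :: real
        have "\<bar>h (c + e n * u)\<bar> * frac_kernel p u \<le> frac_kernel p u * M" if "0 < u" "u < (t - c) / e n"
          using M[of "c + e n * u"] that e(1)[of n] frac_kernel_nonneg[OF p(1) that(1)]
          by (subst mult.commute) (intro mult_left_mono, auto simp: field_simps)
        then show "norm (indicat_real {0<..} u *\<^sub>R
            (indicat_real {0<..<(t-c) / e n} u * h (c + e n * u) * frac_kernel p u))
          \<le> indicat_real {0<..} u *\<^sub>R frac_kernel p u * M"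
          using M0 frac_kernel_nonneg[OF p(1), of u] by (auto simp: indicator_def abs_mult)
      qed
      show "AE u in lborel. (\<lambda>n. indicat_real {0<..} u *\<^sub>R
            (indicat_real {0<..<(t-c) / e n} u * h (c + e n * u) * frac_kernel p u))
          \<longlonglongrightarrow> indicat_real {0<..} u *\<^sub>R (frac_kernel p u * h c)"
      proof (intro AE_I2)
        fix u :: real
        show "(\<lambda>n. indicat_real {0<..} u *\<^sub>R
            (indicat_real {0<..<(t-c) / e n} u * h (c + e n * u) * frac_kernel p u))
          \<longlonglongrightarrow> indicat_real {0<..} u *\<^sub>R (frac_kernel p u * h c)"
        proof (cases "0 < u")
          case True
          have "(\<lambda>n. e n * u) \<longlonglongrightarrow> 0 * u" by (intro tendsto_intros e(2))
          then have l: "(\<lambda>n. e n * u) \<longlonglongrightarrow> 0" by simp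
          then have "(\<lambda>n. c + e n * u) \<longlonglongrightarrow> c + 0" by (intro tendsto_intros)
          then have "(\<lambda>n. h (c + e n * u)) \<longlonglongrightarrow> h c"
            using cont continuous_on_tendsto_compose[OF cont, of "\<lambda>n. c + e n * u" c] by simp
          then have "(\<lambda>n. h (c + e n * u) * frac_kernel p u) \<longlonglongrightarrow> h c * frac_kernel p u"
            by (intro tendsto_intros)
          moreover have "\<forall>\<^sub>F n in sequentially. e n * u < t - c"
            using order_tendstoD(2)[OF l, of "t - c"] ct by simp
          then have "\<forall>\<^sub>F n in sequentially. h (c + e n * u) * frac_kernel p u =
              indicat_real {0<..} u *\<^sub>R (indicat_real {0<..<(t-c) / e n} u * h (c + e n * u) * frac_kernel p u)"
            by eventually_elim (use True e(1) in \<open>auto simp: indicator_def field_simps\<close>)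
          ultimately show ?thesis
            using True by (simp add: mult.commute[of "h c"] Lim_transform_eventually)
        qed simp
      qed
    qed auto
    also have "(LINT u:{0<..}|lborel. frac_kernel p u * h c) = frac_mass p * h c"
      unfolding frac_mass_def by simp
    finally show ?thesis
      unfolding marchaud_trunc_def using frac_integral_truncated[OF p ct e(1) cont] by simp
  qed
  ultimately show ?thesis by (rule LIMSEQ_unique)
qed

end

section \<open>The integral of a step function\<close>

lemma W_space_bounds:
  assumes g: "g \<in> W_space \<alpha> T"
  obtains G where "0 \<le> G"
    "\<And>u v. 0 \<le> u \<Longrightarrow> u < v \<Longrightarrow> v \<le> T \<Longrightarrow> \<bar>g v - g u\<bar> \<le> G * (v - u) powr (1 - \<alpha>)"
    "\<And>u v. 0 \<le> u \<Longrightarrow> u < v \<Longrightarrow> v \<le> T \<Longrightarrow>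
      (\<integral>\<^sup>+y\<in>{u<..<v}. ennreal (\<bar>g y - g u\<bar> / (y - u) powr (2 - \<alpha>)) \<partial>lborel) \<le> ennreal G"
proof -
  define S where "S = (SUP (u, v)\<in>{(u, v). 0 \<le> u \<and> u < v \<and> v \<le> T}.
        ennreal (\<bar>g v - g u\<bar> / (v - u) powr (1 - \<alpha>)) +
        (\<integral>\<^sup>+y\<in>{u<..<v}. ennreal (\<bar>g y - g u\<bar> / (y - u) powr (2 - \<alpha>)) \<partial>lborel))"
  have fin: "S < \<infinity>" using g unfolding W_space_def S_def by simp
  define G where "G = enn2real S"
  have SG: "S = ennreal G" and G: "0 \<le> G"
    unfolding G_def using fin by (simp_all add: less_top)
  have up: "ennreal (\<bar>g v - g u\<bar> / (v - u) powr (1 - \<alpha>)) +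
        (\<integral>\<^sup>+y\<in>{u<..<v}. ennreal (\<bar>g y - g u\<bar> / (y - u) powr (2 - \<alpha>)) \<partial>lborel) \<le> ennreal G"
    if "0 \<le> u" "u < v" "v \<le> T" for u v
    unfolding SG [symmetric] S_def using that
    by (intro SUP_upper2[of "(u, v)"]) auto
  show ?thesis
  proof (rule that[OF G])
    fix u v :: real assume uv: "0 \<le> u" "u < v" "v \<le> T"
    have "ennreal (\<bar>g v - g u\<bar> / (v - u) powr (1 - \<alpha>)) \<le> ennreal G"
      using order_trans[OF _ up[OF uv]] by (simp add: add_increasing2)
    then have "\<bar>g v - g u\<bar> / (v - u) powr (1 - \<alpha>) \<le> G"
      using G by (simp add: ennreal_le_iff)
    then show "\<bar>g v - g u\<bar> \<le> G * (v - u) powr (1 - \<alpha>)"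
      using uv by (simp add: field_simps)
    show "(\<integral>\<^sup>+y\<in>{u<..<v}. ennreal (\<bar>g y - g u\<bar> / (y - u) powr (2 - \<alpha>)) \<partial>lborel) \<le> ennreal G"
      using order_trans[OF _ up[OF uv]] by (simp add: add_increasing)
  qed
qed

lemma holder_continuous_on:
  fixes f :: "real \<Rightarrow> real"
  assumes q: "0 < q"
    and hol: "\<And>u v. a \<le> u \<Longrightarrow> u < v \<Longrightarrow> v \<le> b \<Longrightarrow> \<bar>f v - f u\<bar> \<le> K * (v - u) powr q"
  shows "continuous_on {a..b} f"
  unfolding continuous_on_def
proof
  fix u assume u: "u \<in> {a..b}"
  have "((\<lambda>v. K * \<bar>v - u\<bar> powr q) \<longlongrightarrow> K * \<bar>u - u\<bar> powr q) (at u within {a..b})"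
    using q by (intro tendsto_intros) auto
  then have lim: "((\<lambda>v. K * \<bar>v - u\<bar> powr q) \<longlongrightarrow> 0) (at u within {a..b})" by simp
  have "\<forall>\<^sub>F v in at u within {a..b}. norm (f v - f u) \<le> K * \<bar>v - u\<bar> powr q"
  proof -
    have "norm (f v - f u) \<le> K * \<bar>v - u\<bar> powr q" if "v \<in> {a..b}" "v \<noteq> u" for v
      using hol[of u v] hol[of v u] that u by (cases "u < v") (auto simp: abs_minus_commute)
    then show ?thesis by (auto simp: eventually_at_filter)
  qed
  from Lim_null_comparison[OF this lim]
  show "(f \<longlongrightarrow> f u) (at u within {a..b})" by (simp add: LIM_zero_iff)
qed

text \<open>\<open>W_space\<close> controls \<open>g\<close> on \<open>[0, T]\<close> alone.
  Freezing it at the ends gives the continuity on the whole line that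
  \<open>marchaud_regular\<close> asks for.\<close>

lemma clamp_continuous:
  fixes g :: "real \<Rightarrow> real"
  assumes T: "0 < T" and q: "0 < q"
    and hol: "\<And>u v. 0 \<le> u \<Longrightarrow> u < v \<Longrightarrow> v \<le> T \<Longrightarrow> \<bar>g v - g u\<bar> \<le> G * (v - u) powr q"
  shows "continuous_on UNIV (\<lambda>x. g (max 0 (min T x)))"
proof -
  have "continuous_on {0..T} g" by (rule holder_continuous_on[OF q hol])
  then have "continuous_on UNIV (g \<circ> (\<lambda>x. max 0 (min T x)))"
    using T by (intro continuous_on_compose continuous_intros) (auto elim: continuous_on_subset)
  then show ?thesis by (simp add: o_def)
qed

lemma set_lborel_integral_sum:
  fixes f :: "'i \<Rightarrow> real \<Rightarrow> real"
  assumes "\<And>i. i \<in> I \<Longrightarrow> set_integrable lborel A (f i)"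
  shows "set_integrable lborel A (\<lambda>x. \<Sum>i\<in>I. f i x)"
    and "(LINT x:A|lborel. \<Sum>i\<in>I. f i x) = (\<Sum>i\<in>I. LINT x:A|lborel. f i x)"
  using assms unfolding set_integrable_def set_lebesgue_integral_def
  by (simp_all add: sum_distrib_left)

text \<open>By linearity one unit jump at \<open>s < x\<close> decides. The difference
  \<open>f x - f y\<close> is then 1 for \<open>y < s\<close> and 0 afterwards, so the integral part
  gives \<open>(x - s) powr (- \<alpha>) - x powr (- \<alpha>)\<close>, and its second power cancels
  the boundary term. The jump points themselves are excluded; they form a null set.\<close>

lemma weyl_left_jumps:
  fixes d s :: "nat \<Rightarrow> real"
  assumes \<alpha>: "0 < \<alpha>" "\<alpha> < 1"
    and f: "\<And>y. 0 < y \<Longrightarrow> y < t \<Longrightarrow> f y = (\<Sum>i<N. d i * (if s i \<le> y then 1 else 0))"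
    and s: "\<And>i. i < N \<Longrightarrow> 0 \<le> s i"
    and x: "0 < x" "x < t" "\<And>i. i < N \<Longrightarrow> x \<noteq> s i"
  shows "weyl_left \<alpha> 0 f x
    = (\<Sum>i<N. d i * (if s i < x then (x - s i) powr (- \<alpha>) else 0)) / Gamma (1 - \<alpha>)"
proof -
  define k where "k = (\<lambda>i y. ((if s i \<le> x then 1 else 0) - (if s i \<le> y then 1 else 0)) / (x - y) powr (\<alpha> + 1))"
  have k: "set_integrable lborel {0<..<x} (k i) \<and>
      (LINT y:{0<..<x}|lborel. k i y) = (if s i < x then ((x - s i) powr (- \<alpha>) - x powr (- \<alpha>)) / \<alpha> else 0)"
    if i: "i < N" for i
  proof (cases "s i < x")
    case True
    have eq: "(\<lambda>y. indicat_real {0<..<x} y *\<^sub>R k i y) = (\<lambda>y. indicat_real {0<..<s i} y *\<^sub>R (1 / (x - y) powr (\<alpha> + 1)))"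
      using True by (auto simp: k_def indicator_def fun_eq_iff)
    show ?thesis
      using set_integral_powr_right[of \<alpha> 0 "s i" x] \<alpha> s[OF i] True
      unfolding set_integrable_def set_lebesgue_integral_def eq by simp
  next
    case False
    then have eq: "(\<lambda>y. indicat_real {0<..<x} y *\<^sub>R k i y) = (\<lambda>y. 0)"
      using x(3)[OF i] by (auto simp: k_def indicator_def fun_eq_iff)
    show ?thesis
      using False unfolding set_integrable_def set_lebesgue_integral_def eq by simp
  qed
  have "(LINT y:{0<..<x}|lborel. (f x - f y) / (x - y) powr (\<alpha> + 1)) = (LINT y:{0<..<x}|lborel. \<Sum>i<N. d i * k i y)"
    using x f by (intro set_lebesgue_integral_cong)
      (auto simp: k_def sum_subtractf [symmetric] sum_divide_distrib right_diff_distrib diff_divide_distrib)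
  also have "\<dots> = (\<Sum>i<N. d i * (LINT y:{0<..<x}|lborel. k i y))"
    using k by (subst set_lborel_integral_sum(2)) auto
  also have "\<dots> = (\<Sum>i<N. d i * (if s i < x then ((x - s i) powr (- \<alpha>) - x powr (- \<alpha>)) / \<alpha> else 0))"
    using k by (intro sum.cong) auto
  finally have I: "\<alpha> * (LINT y:{0<..<x}|lborel. (f x - f y) / (x - y) powr (\<alpha> + 1))
     = (\<Sum>i<N. d i * (if s i < x then (x - s i) powr (- \<alpha>) - x powr (- \<alpha>) else 0))"
    using \<alpha> by (simp add: sum_distrib_left if_distrib cong: if_cong sum.cong)
  have "f x = (\<Sum>i<N. d i * (if s i < x then 1 else 0))"
    unfolding f[OF x(1,2)] using x(3) by (intro sum.cong refl) (auto simp: order.order_iff_strict)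
  then have J: "f x / (x - 0) powr \<alpha> = (\<Sum>i<N. d i * (if s i < x then x powr (- \<alpha>) else 0))"
    by (auto simp: sum_distrib_right powr_minus divide_inverse intro!: sum.cong)
  show ?thesis
    unfolding weyl_left_def I J sum.distrib [symmetric] 
    by (simp add: distrib_left [symmetric] if_distrib [of "(+) _"] if_distrib [of "\<lambda>u. u + _"] cong: if_cong)
qed

text \<open>The constant is 1 by the reflection formula, but only its existence matters below.\<close>

definition gls_const :: "real \<Rightarrow> real" where
  "gls_const \<alpha> = frac_mass (1 - \<alpha>) / (Gamma \<alpha> * Gamma (1 - \<alpha>))"

text \<open>By \<open>weyl_left_jumps\<close> a jump at \<open>s i\<close> pairs the weight
  \<open>(x - s i) powr (- \<alpha>)\<close> with the Marchaud derivative of \<open>g - g t\<close>.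
  This is a fractional integral starting at \<open>s i\<close>, which
  \<open>frac_integral_marchaud\<close> evaluates with \<open>c = s i\<close>. A jump at or after
  \<open>t\<close> contributes 0 on both sides.\<close>

lemma gls_integral_jumps:
  fixes d s :: "nat \<Rightarrow> real"
  assumes \<alpha>: "0 < \<alpha>" "\<alpha> < 1" and T: "0 < T" and g: "g \<in> W_space \<alpha> T"
    and t: "0 < t" "t \<le> T"
    and fm: "f \<in> borel_measurable borel"
    and f: "\<And>y. 0 < y \<Longrightarrow> y < t \<Longrightarrow> f y = (\<Sum>i<N. d i * (if s i \<le> y then 1 else 0))"
    and s: "\<And>i. i < N \<Longrightarrow> 0 \<le> s i"
  shows "gls_integral \<alpha> 0 t f g = gls_const \<alpha> * (\<Sum>i<N. d i * (g t - g (min (s i) t)))"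
proof -
  note fm [measurable]
  obtain G where G: "0 \<le> G"
    and hol: "\<And>u v. 0 \<le> u \<Longrightarrow> u < v \<Longrightarrow> v \<le> T \<Longrightarrow> \<bar>g v - g u\<bar> \<le> G * (v - u) powr (1 - \<alpha>)"
    and nn: "\<And>u v. 0 \<le> u \<Longrightarrow> u < v \<Longrightarrow> v \<le> T \<Longrightarrow>
      (\<integral>\<^sup>+y\<in>{u<..<v}. ennreal (\<bar>g y - g u\<bar> / (y - u) powr (2 - \<alpha>)) \<partial>lborel) \<le> ennreal G"
    by (rule W_space_bounds[OF g]) (rule that)
  define h where "h = (\<lambda>x. g (max 0 (min T x)) - g t)"
  have hg: "h x = g x - g t" if "0 \<le> x" "x \<le> t" for x using that t by (simp add: h_def)
  have gc: "continuous_on UNIV (\<lambda>x. g (max 0 (min T x)))"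
    using clamp_continuous[OF T _ hol] \<alpha> by simp
  have reg: "marchaud_regular (1 - \<alpha>) c t G h" if c: "0 \<le> c" "c < t" for c
  proof
    show "continuous_on UNIV h" unfolding h_def by (intro continuous_intros gc)
    show "h t = 0" using t by (simp add: h_def)
    show "\<bar>h v - h u\<bar> \<le> G * (v - u) powr (1 - \<alpha>)" if "c \<le> u" "u < v" "v \<le> t" for u v
      using that c t hol[of u v] by (simp add: hg)
    show "(\<integral>\<^sup>+y\<in>{u<..<t}. ennreal (\<bar>h y - h u\<bar> / (y - u) powr (1 - \<alpha> + 1)) \<partial>lborel) \<le> ennreal G"
      if "c \<le> u" "u < t" for u
    proof -
      have "(\<integral>\<^sup>+y\<in>{u<..<t}. ennreal (\<bar>h y - h u\<bar> / (y - u) powr (1 - \<alpha> + 1)) \<partial>lborel)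
        = (\<integral>\<^sup>+y\<in>{u<..<t}. ennreal (\<bar>g y - g u\<bar> / (y - u) powr (2 - \<alpha>)) \<partial>lborel)"
        using that c by (intro nn_integral_cong) (auto simp: indicator_def hg)
      then show ?thesis using nn[of u t] that c t by simp
    qed
  qed (use \<alpha> c in auto)
  interpret R: marchaud_regular "1 - \<alpha>" 0 t G h by (rule reg) (use t in auto)
  define m where "m = marchaud (1 - \<alpha>) t h"
  have mm [measurable]: "m \<in> borel_measurable borel" unfolding m_def by measurable
  have mb: "\<bar>m x\<bar> \<le> 2 * G" if "0 \<le> x" "x < t" for x
    unfolding m_def by (rule R.marchaud_bound[OF that])
  \<comment> \<open>\<open>left_shift\<close> subtracts a left limit; continuity of \<open>g\<close>
    identifies it with \<open>g t\<close>, so that \<open>h\<close> is the function being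
    differentiated.\<close>
  have "Lim (at_left t) g = g t"
  proof (rule tendsto_Lim)
    have "((\<lambda>x. g (max 0 (min T x))) \<longlongrightarrow> g (max 0 (min T t))) (at_left t)"
      using gc unfolding continuous_on_def by (auto intro: tendsto_within_subset)
    then have "((\<lambda>x. g (max 0 (min T x))) \<longlongrightarrow> g t) (at_left t)" using t by simp
    moreover have "\<forall>\<^sub>F x in at_left t. g (max 0 (min T x)) = g x"
    proof -
      have "\<forall>\<^sub>F x in at_left t. x \<in> {0<..<t}" using eventually_at_left_real[OF t(1)] .
      then show ?thesis by eventually_elim (use t in auto)
    qed
    ultimately show "(g \<longlongrightarrow> g t) (at_left t)" by (rule Lim_transform_eventually)
  qed simp
  then have ls: "left_shift g t x = h x" if "0 \<le> x" "x \<le> t" for x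
    using that by (simp add: left_shift_def hg)
  define z where "z = (- 1) powr complex_of_real (1 - \<alpha>) / complex_of_real (Gamma \<alpha>)"
  have wr: "weyl_right (1 - \<alpha>) t (left_shift g t) x = z * complex_of_real (m x)" if x: "0 < x" "x < t" for x
  proof -
    have "(LINT y:{x<..<t}|lborel. (left_shift g t x - left_shift g t y) / (y - x) powr (1 - \<alpha> + 1))
       = (LINT y:{x<..<t}|lborel. (h x - h y) / (y - x) powr (1 - \<alpha> + 1))"
      using x by (intro set_lebesgue_integral_cong) (auto simp: ls)
    then show ?thesis
      using x unfolding weyl_right_def m_def marchaud_def z_def by (simp add: ls)
  qed
  define A where "A = (\<lambda>x. (\<Sum>i<N. d i * (if s i < x then (x - s i) powr (- \<alpha>) else 0)) / Gamma (1 - \<alpha>))"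
  have Am [measurable]: "A \<in> borel_measurable borel" unfolding A_def by measurable
  \<comment> \<open>Finitely many jump points are discarded; under the integral the explicit
    \<open>A\<close> replaces the derivative.\<close>
  have wl: "AE x in lborel. x \<in> {0<..<t} \<longrightarrow> weyl_left \<alpha> 0 f x = A x"
  proof -
    have "AE x in lborel. x \<notin> s ` {..<N}"
      by (intro AE_not_in finite_imp_null_set_lborel) auto
    then show ?thesis
      by eventually_elim (use weyl_left_jumps[OF \<alpha> f s] in \<open>auto simp: A_def\<close>)
  qed
  have wlm [measurable]: "weyl_left \<alpha> 0 f \<in> borel_measurable borel"
  proof -
    have "(\<lambda>x. LINT y|lborel. (if 0 < y \<and> y < x then (f x - f y) / (x - y) powr (\<alpha> + 1) else 0)) \<in> borel_measurable borel"
      by measurable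
    also have "(\<lambda>x. LINT y|lborel. (if 0 < y \<and> y < x then (f x - f y) / (x - y) powr (\<alpha> + 1) else 0))
       = (\<lambda>x. LINT y:{0<..<x}|lborel. (f x - f y) / (x - y) powr (\<alpha> + 1))"
      unfolding set_lebesgue_integral_def
      by (intro ext Bochner_Integration.integral_cong refl) (auto simp: indicator_def)
    finally have [measurable]: "(\<lambda>x. LINT y:{0<..<x}|lborel. (f x - f y) / (x - y) powr (\<alpha> + 1)) \<in> borel_measurable borel" .
    show ?thesis unfolding weyl_left_def by measurable
  qed
  have pw: "set_integrable lborel {0<..<t} (\<lambda>x. if s i < x then (x - s i) powr (- \<alpha>) else 0)" if i: "i < N" for i
  proof (cases "s i < t")
    case True
    have eq: "(\<lambda>x. indicat_real {0<..<t} x *\<^sub>R (if s i < x then (x - s i) powr (- \<alpha>) else 0))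
       = (\<lambda>x. indicat_real {s i<..<t} x *\<^sub>R (x - s i) powr (- \<alpha>))"
      using s[OF i] by (auto simp: indicator_def fun_eq_iff)
    show ?thesis using set_integral_powr_left(1)[of "1 - \<alpha>" "s i" t] \<alpha> True
      unfolding set_integrable_def eq by simp
  next
    case False
    then have eq: "(\<lambda>x. indicat_real {0<..<t} x *\<^sub>R (if s i < x then (x - s i) powr (- \<alpha>) else 0)) = (\<lambda>x. 0)"
      by (auto simp: indicator_def fun_eq_iff)
    show ?thesis unfolding set_integrable_def eq by simp
  qed
  have Ai: "set_integrable lborel {0<..<t} A"
    unfolding A_def using pw by (intro set_integrable_divide set_lborel_integral_sum(1) set_integrable_mult_right) auto
  have wli: "set_integrable lborel {0<..<t} (weyl_left \<alpha> 0 f)"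
    using Ai unfolding set_integrable_def
    by (subst integrable_cong_AE[where g = "\<lambda>x. indicat_real {0<..<t} x *\<^sub>R A x"])
       (use wl in \<open>auto simp: indicator_def\<close>)
  have "set_borel_measurable lborel {0<..<t} (\<lambda>x. z * complex_of_real (m x))"
    unfolding set_borel_measurable_def by measurable
  moreover have "(\<lambda>x. indicat_real {0<..<t} x *\<^sub>R (z * complex_of_real (m x)))
     = (\<lambda>x. indicat_real {0<..<t} x *\<^sub>R weyl_right (1 - \<alpha>) t (left_shift g t) x)"
    using wr by (auto simp: indicator_def fun_eq_iff)
  ultimately have wrm: "set_borel_measurable lborel {0<..<t} (weyl_right (1 - \<alpha>) t (left_shift g t))"
    unfolding set_borel_measurable_def by simp
  have "norm (weyl_right (1 - \<alpha>) t (left_shift g t) x) \<le> norm z * (2 * G)" if "x \<in> {0<..<t}" for x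
    using wr[of x] mb[of x] that by (auto simp: norm_mult intro!: mult_left_mono)
  then have int: "gls_integrable \<alpha> 0 t f g"
    unfolding gls_integrable_def using wli wrm by blast
  have mi: "(LINT x:{0<..<t}|lborel. (if s i < x then (x - s i) powr (- \<alpha>) else 0) * m x)
      = frac_mass (1 - \<alpha>) * (g (min (s i) t) - g t)" if i: "i < N" for i
  proof (cases "s i < t")
    case True
    have eq: "(\<lambda>x. indicat_real {0<..<t} x *\<^sub>R ((if s i < x then (x - s i) powr (- \<alpha>) else 0) * m x))
       = (\<lambda>x. indicat_real {s i<..<t} x *\<^sub>R ((x - s i) powr (1 - \<alpha> - 1) * m x))"
      using s[OF i] by (auto simp: indicator_def fun_eq_iff)
    show ?thesis
      using marchaud_regular.frac_integral_marchaud[OF reg[OF s[OF i] True]] True s[OF i] t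
      unfolding m_def set_lebesgue_integral_def eq[unfolded m_def] by (simp add: hg)
  next
    case False
    then have eq: "(\<lambda>x. indicat_real {0<..<t} x *\<^sub>R ((if s i < x then (x - s i) powr (- \<alpha>) else 0) * m x)) = (\<lambda>x. 0)"
      by (auto simp: indicator_def fun_eq_iff)
    show ?thesis using False unfolding set_lebesgue_integral_def eq by simp
  qed
  have mii: "set_integrable lborel {0<..<t} (\<lambda>x. (if s i < x then (x - s i) powr (- \<alpha>) else 0) * m x)" if i: "i < N" for i
  proof (rule set_integrable_bound)
    show "set_integrable lborel {0<..<t} (\<lambda>x. (if s i < x then (x - s i) powr (- \<alpha>) else 0) * (2 * G))"
      using pw[OF i] by (rule set_integrable_mult_left)
    show "AE x in lborel. x \<in> {0<..<t} \<longrightarrow> norm ((if s i < x then (x - s i) powr (- \<alpha>) else 0) * m x)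
       \<le> norm ((if s i < x then (x - s i) powr (- \<alpha>) else 0) * (2 * G))"
      using mb G by (intro AE_I2) (auto simp: abs_mult intro!: mult_left_mono)
  qed (auto simp: set_borel_measurable_def)
  have "(LINT x:{0<..<t}|lborel. A x * m x) = (LINT x:{0<..<t}|lborel. (\<Sum>i<N. d i / Gamma (1 - \<alpha>) *
       ((if s i < x then (x - s i) powr (- \<alpha>) else 0) * m x)))"
    by (intro set_lebesgue_integral_cong)
       (auto simp: A_def sum_divide_distrib sum_distrib_right intro!: sum.cong)
  also have "\<dots> = (\<Sum>i<N. d i / Gamma (1 - \<alpha>) * (frac_mass (1 - \<alpha>) * (g (min (s i) t) - g t)))"
    using mii by (subst set_lborel_integral_sum(2)) (auto simp: mi intro!: sum.cong)
  finally have AI: "(LINT x:{0<..<t}|lborel. A x * m x)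
     = - frac_mass (1 - \<alpha>) / Gamma (1 - \<alpha>) * (\<Sum>i<N. d i * (g t - g (min (s i) t)))"
    by (simp add: sum_distrib_left algebra_simps sum_negf [symmetric] sum_subtractf [symmetric] diff_divide_distrib)
  have "(LINT x:{0<..<t}|lborel. complex_of_real (weyl_left \<alpha> 0 f x) * weyl_right (1 - \<alpha>) t (left_shift g t) x)
     = (LINT x|lborel. z * complex_of_real (indicat_real {0<..<t} x *\<^sub>R (weyl_left \<alpha> 0 f x * m x)))"
    unfolding set_lebesgue_integral_def
    by (intro Bochner_Integration.integral_cong refl) (auto simp: indicator_def wr)
  also have "\<dots> = z * complex_of_real (LINT x:{0<..<t}|lborel. weyl_left \<alpha> 0 f x * m x)"
    unfolding set_lebesgue_integral_def by (simp only: integral_mult_right_zero integral_complex_of_real)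
  also have "(LINT x:{0<..<t}|lborel. weyl_left \<alpha> 0 f x * m x) = (LINT x:{0<..<t}|lborel. A x * m x)"
    unfolding set_lebesgue_integral_def
    by (rule integral_cong_AE) (use wl in \<open>auto simp: indicator_def\<close>)
  finally have "gls_integral \<alpha> 0 t f g = Re ((- 1) powr complex_of_real \<alpha> *
      (z * complex_of_real (LINT x:{0<..<t}|lborel. A x * m x)))"
    unfolding gls_integral_def using int by simp
  \<comment> \<open>The two complex powers multiply to -1. This sign cancels the one in
    \<open>AI\<close>, so that increments of \<open>g\<close> up to \<open>t\<close> come out
    positively.\<close>
  also have "(- 1) powr complex_of_real \<alpha> * (z * complex_of_real (LINT x:{0<..<t}|lborel. A x * m x))
     = complex_of_real (- (LINT x:{0<..<t}|lborel. A x * m x) / Gamma \<alpha>)"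
  proof -
    have "(- 1) powr complex_of_real \<alpha> * (- 1) powr complex_of_real (1 - \<alpha>) = (-1::complex)"
      by (subst powr_add [symmetric]) simp
    then show ?thesis unfolding z_def by (simp add: mult.assoc [symmetric])
  qed
  finally show ?thesis unfolding AI gls_const_def by (simp add: mult_ac)
qed

text \<open>Fractional calculus sees the jumps of a step function, the estimates see its values on
  cells; summation by parts translates. The convention for \<open>i = 0\<close> makes the initial
  value a jump at 0. In \<open>gls_integral_step\<close> the boundary term vanishes, because
  stopping at \<open>t\<close> makes the last node value of \<open>g\<close> equal to
  \<open>g t\<close>.\<close>

lemma abel_jumps:
  fixes c \<gamma> :: "nat \<Rightarrow> real"
  shows "(\<Sum>i<Suc N. (c i - (if i = 0 then 0 else c (i - 1))) * (G - \<gamma> i))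
    = (\<Sum>i<Suc N. c i * (\<gamma> (Suc i) - \<gamma> i)) + c N * (G - \<gamma> (Suc N))"
  by (induction N) (auto simp: algebra_simps)

lemma sum_jumps:
  fixes c :: "nat \<Rightarrow> real"
  shows "(\<Sum>i<Suc k. c i - (if i = 0 then 0 else c (i - 1))) = c k"
  by (induction k) auto

theorem gls_integral_step:
  fixes c :: "nat \<Rightarrow> real"
  assumes \<alpha>: "0 < \<alpha>" "\<alpha> < 1" and T: "0 < T" and g: "g \<in> W_space \<alpha> T"
    and t: "0 \<le> t" "t \<le> T" and \<delta>: "0 < \<delta>" "real N * \<delta> = T"
    and fm: "f \<in> borel_measurable borel"
    and f: "\<And>y. 0 \<le> y \<Longrightarrow> y < T \<Longrightarrow> f y = c (nat \<lfloor>y / \<delta>\<rfloor>)"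
  shows "gls_integral \<alpha> 0 t f g
    = gls_const \<alpha> * (\<Sum>i<N. c i * (g (min (real (Suc i) * \<delta>) t) - g (min (real i * \<delta>) t)))"
proof (cases "t = 0")
  case True
  then have "min (real i * \<delta>) t = 0" for i using \<delta> by simp
  then have "(\<Sum>i<N. c i * (g (min (real (Suc i) * \<delta>) t) - g (min (real i * \<delta>) t))) = 0"
    by (intro sum.neutral) (metis diff_self mult_zero_right)
  then show ?thesis using True by (simp add: gls_integral_def set_lebesgue_integral_def)
next
  case False
  define d where "d = (\<lambda>i. c i - (if i = 0 then 0 else c (i - 1)))"
  obtain M where M: "N = Suc M" using \<delta> T by (cases N) auto
  have "f y = (\<Sum>i<N. d i * (if real i * \<delta> \<le> y then 1 else 0))" if y: "0 < y" "y < t" for y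
  proof -
    define k where "k = nat \<lfloor>y / \<delta>\<rfloor>"
    have k: "real i * \<delta> \<le> y \<longleftrightarrow> i < Suc k" for i
    proof -
      have "real i * \<delta> \<le> y \<longleftrightarrow> real i \<le> y / \<delta>" using \<delta> by (simp add: field_simps)
      also have "\<dots> \<longleftrightarrow> int i \<le> \<lfloor>y / \<delta>\<rfloor>" by (simp add: le_floor_iff)
      also have "\<dots> \<longleftrightarrow> i < Suc k" using y \<delta> unfolding k_def by (simp add: le_nat_iff less_Suc_eq_le)
      finally show ?thesis .
    qed
    \<comment> \<open>Index \<open>N\<close> would mean \<open>T \<le> y\<close>, against
      \<open>y < t\<close>; so the cell of \<open>y\<close> is among the \<open>N\<close> cells of
      the sum.\<close>
    have "Suc k \<le> N"
    proof (rule ccontr)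
      assume "\<not> Suc k \<le> N"
      then have "real N * \<delta> \<le> y" using k[of N] by simp
      then show False using \<delta> y t by simp
    qed
    then have "{..<N} \<inter> {i. i < Suc k} = {..<Suc k}" by auto
    then have "(\<Sum>i<N. d i * (if real i * \<delta> \<le> y then 1 else 0)) = (\<Sum>i<Suc k. d i)"
      unfolding k by (simp add: if_distrib sum.If_cases cong: if_cong)
    also have "\<dots> = c k" unfolding d_def by (rule sum_jumps)
    also have "\<dots> = f y" using f[of y] y t by (simp add: k_def)
    finally show ?thesis by simp
  qed
  then have "gls_integral \<alpha> 0 t f g = gls_const \<alpha> * (\<Sum>i<N. d i * (g t - g (min (real i * \<delta>) t)))"
    using \<delta> False t by (intro gls_integral_jumps[OF \<alpha> T g _ _ fm]) auto
  also have "(\<Sum>i<N. d i * (g t - g (min (real i * \<delta>) t)))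
     = (\<Sum>i<N. c i * (g (min (real (Suc i) * \<delta>) t) - g (min (real i * \<delta>) t)))
       + c M * (g t - g (min (real N * \<delta>) t))"
    unfolding M d_def by (rule abel_jumps)
  also have "g (min (real N * \<delta>) t) = g t" using \<delta> t by simp
  finally show ?thesis by simp
qed

section \<open>Dyadic sums\<close>

text \<open>The concave function \<open>u powr q\<close> lies below its tangent at
  \<open>c = L / N\<close>, which is Young's inequality for the weights \<open>q\<close> and
  \<open>1 - q\<close>. Summing the tangent bounds gives the claim.\<close>

lemma sum_powr_le:
  fixes a :: "nat \<Rightarrow> real"
  assumes q: "0 < q" "q < 1" and a: "\<And>i. i < N \<Longrightarrow> 0 \<le> a i" and L: "(\<Sum>i<N. a i) \<le> L"
  shows "(\<Sum>i<N. a i powr q) \<le> real N powr (1 - q) * L powr q"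
proof (cases "N = 0 \<or> L = 0")
  case True
  have "a i powr q = 0" if "i < N" for i
  proof -
    have "a i \<le> (\<Sum>i<N. a i)" using a that by (intro member_le_sum) auto
    then show ?thesis using True L a[OF that] that by auto
  qed
  then show ?thesis by simp
next
  case False
  have "0 \<le> (\<Sum>i<N. a i)" using a by (intro sum_nonneg) auto
  then have Lp: "0 < L" using L False by linarith
  define c where "c = L / real N"
  have c: "0 < c" using Lp False by (simp add: c_def)
  have *: "a i powr q \<le> c powr (q - 1) * (q * a i + (1 - q) * c)" if "i < N" for i
  proof (cases "a i = 0")
    case False
    then have "a i powr q * c powr (1 - q) \<le> q * a i + (1 - q) * c"
      using Youngs_inequality_0[of q "1 - q" "a i" c] q a[OF that] c by simp
    then have le: "a i powr q * c powr (1 - q) * c powr (q - 1) \<le> (q * a i + (1 - q) * c) * c powr (q - 1)"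
      by (rule mult_right_mono) simp
    have "c powr (1 - q) * c powr (q - 1) = 1"
      using c by (simp add: powr_add [symmetric])
    then have "a i powr q = a i powr q * c powr (1 - q) * c powr (q - 1)"
      by (simp only: mult.assoc mult_1_right)
    with le show ?thesis by (simp only: mult.commute)
  qed (use q c in auto)
  have "(\<Sum>i<N. a i powr q) \<le> (\<Sum>i<N. c powr (q - 1) * (q * a i + (1 - q) * c))"
    using * by (intro sum_mono) auto
  also have "\<dots> = c powr (q - 1) * (q * (\<Sum>i<N. a i) + (1 - q) * (real N * c))"
    by (simp add: sum_distrib_left [symmetric] sum.distrib)
  also have "\<dots> \<le> c powr (q - 1) * (q * L + (1 - q) * L)"
    using L q False by (intro mult_left_mono add_mono) (auto simp: c_def)
  also have "\<dots> = c powr (q - 1) * L" by (simp add: algebra_simps)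
  also have "\<dots> = real N powr (1 - q) * L powr q"
    using Lp False unfolding c_def by (simp add: powr_divide powr_diff field_simps)
  finally show ?thesis .
qed

lemma sum_even_odd: "(\<Sum>i<2 * M. f i) = (\<Sum>i<M. f (2 * i) + f (Suc (2 * i)))" for f :: "nat \<Rightarrow> real"
  by (induction M) (auto simp: algebra_simps)

text \<open>Stopping the increments at \<open>t\<close>, rather than the index, keeps the number of
  terms independent of \<open>t\<close> and counts the cell containing \<open>t\<close> with its
  part before \<open>t\<close>.\<close>

definition dyadic_sum :: "real \<Rightarrow> (real \<Rightarrow> real) \<Rightarrow> (real \<Rightarrow> real) \<Rightarrow> nat \<Rightarrow> real \<Rightarrow> real" where
  "dyadic_sum T g F n t = (\<Sum>i<2 ^ n. F (real i * (T / 2 ^ n)) *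
     (g (min (real (Suc i) * (T / 2 ^ n)) t) - g (min (real i * (T / 2 ^ n)) t)))"

text \<open>Halving a cell changes the sum only on its right half, where the sample moves from the
  left end of the cell to its midpoint.\<close>

lemma dyadic_sum_Suc:
  fixes T :: real
  defines "\<delta> k \<equiv> T / 2 ^ k"
  shows "dyadic_sum T g F (Suc k) t - dyadic_sum T g F k t
    = (\<Sum>i<2 ^ k. (F (real (2 * i + 1) * \<delta> (Suc k)) - F (real (2 * i) * \<delta> (Suc k))) *
        (g (min (real (2 * i + 2) * \<delta> (Suc k)) t) - g (min (real (2 * i + 1) * \<delta> (Suc k)) t)))"
proof -
  have d: "\<delta> k = 2 * \<delta> (Suc k)" by (simp add: \<delta>_def)
  have e: "real i * \<delta> k = real (2 * i) * \<delta> (Suc k)" for i by (simp add: d)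
  let ?f = "\<lambda>i. F (real i * \<delta> (Suc k)) * (g (min (real (Suc i) * \<delta> (Suc k)) t) - g (min (real i * \<delta> (Suc k)) t))"
  have 1: "dyadic_sum T g F (Suc k) t = (\<Sum>i<2^k. ?f (2 * i) + ?f (Suc (2 * i)))"
    by (simp only: dyadic_sum_def \<delta>_def power_Suc sum_even_odd)
  have 2: "dyadic_sum T g F k t = (\<Sum>i<2^k. F (real (2 * i) * \<delta> (Suc k)) *
      (g (min (real (2 * Suc i) * \<delta> (Suc k)) t) - g (min (real (2 * i) * \<delta> (Suc k)) t)))"
    by (simp only: dyadic_sum_def \<delta>_def [symmetric] e)
  have n: "2 * Suc i = Suc (Suc (2 * i))" "2 * i + 1 = Suc (2 * i)" "2 * i + 2 = Suc (Suc (2 * i))" for i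
    by simp_all
  show ?thesis
    unfolding 1 2 sum_subtractf [symmetric] n
    by (intro sum.cong refl) (simp add: right_diff_distrib left_diff_distrib del: of_nat_Suc of_nat_mult)
qed

text \<open>The increment over \<open>[s, t]\<close> of a path stopped outside \<open>[a, b]\<close> is the increment over the
  intersection of the two intervals.\<close>

lemma stopped_increment_bound:
  fixes g :: "real \<Rightarrow> real"
  assumes hol: "\<And>u v. 0 \<le> u \<Longrightarrow> u < v \<Longrightarrow> v \<le> T \<Longrightarrow> \<bar>g v - g u\<bar> \<le> G * (v - u) powr q"
    and "0 \<le> G" "0 \<le> a" "a \<le> b" "0 \<le> s" "s \<le> t" "t \<le> T"
  shows "\<bar>(g (min b t) - g (min a t)) - (g (min b s) - g (min a s))\<bar>
    \<le> G * (max 0 (min b t - max a s)) powr q"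
proof (cases "max a s < min b t")
  case True
  then have "min a t = a" "min b s = s" by auto
  then have eq: "(g (min b t) - g (min a t)) - (g (min b s) - g (min a s)) = g (min b t) - g (max a s)"
    by (cases "a \<le> s") auto
  show ?thesis unfolding eq using hol[of "max a s" "min b t"] True assms by auto
next
  case False
  then consider "t \<le> a" | "b \<le> s" | "t = s" | "a = b"
    using assms by linarith
  then have "(g (min b t) - g (min a t)) - (g (min b s) - g (min a s)) = 0"
    by cases (use assms in auto)
  then show ?thesis using assms(2) by simp
qed

section \<open>Young-type estimates uniform in the dyadic level\<close>

locale young_integrator =
  fixes T q \<gamma> G :: real and g :: "real \<Rightarrow> real"
  assumes T: "0 < T" and q: "0 < q" "q < 1" and \<gamma>: "1 - q < \<gamma>" "\<gamma> \<le> 1" and G: "0 \<le> G"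
    and g_holder: "\<And>u v. 0 \<le> u \<Longrightarrow> u < v \<Longrightarrow> v \<le> T \<Longrightarrow> \<bar>g v - g u\<bar> \<le> G * (v - u) powr q"
begin

text \<open>The factor gained per level: halving the mesh gives \<open>2 powr (- \<gamma>)\<close>
  through the integrand, and doubling the number of cells costs \<open>2 powr (1 - q)\<close>
  through \<open>sum_powr_le\<close>. It is below 1 exactly under Young's condition
  \<open>\<gamma> + q > 1\<close>.\<close>

definition rate :: real where "rate = 2 powr (1 - q - \<gamma>)"

lemma rate: "0 < rate" "rate < 1"
  using \<gamma> powr_less_mono[of "1 - q - \<gamma>" 0 2] unfolding rate_def by auto

lemma g_increment: "0 \<le> s \<Longrightarrow> s \<le> t \<Longrightarrow> t \<le> T \<Longrightarrow> \<bar>g t - g s\<bar> \<le> G * (t - s) powr q"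
  using g_holder[of s t] by (cases "s = t") auto

lemma dyadic_refinement:
  assumes \<tau>: "\<tau> \<le> T" and H: "0 \<le> H"
    and F: "\<And>u v. 0 \<le> u \<Longrightarrow> u \<le> v \<Longrightarrow> v \<le> \<tau> \<Longrightarrow> \<bar>F v - F u\<bar> \<le> H * (v - u) powr \<gamma>"
    and st: "0 \<le> s" "s \<le> t" "t \<le> \<tau>"
  shows "\<bar>(dyadic_sum T g F (Suc k) t - dyadic_sum T g F k t)
      - (dyadic_sum T g F (Suc k) s - dyadic_sum T g F k s)\<bar>
    \<le> H * G * T powr \<gamma> * rate ^ k * (t - s) powr q"
proof -
  define \<delta> where "\<delta> = T / 2 ^ Suc k"
  have \<delta>: "0 < \<delta>" using T by (simp add: \<delta>_def)
  define L where "L = (\<lambda>i. real (2 * i) * \<delta>)"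
  define A where "A = (\<lambda>i. real (2 * i + 1) * \<delta>)"
  define B where "B = (\<lambda>i. real (2 * i + 2) * \<delta>)"
  have LAB: "0 \<le> L i" "L i \<le> A i" "A i \<le> B i" "A i - L i = \<delta>" "B i = L (Suc i)" for i
    using \<delta> by (auto simp: L_def A_def B_def algebra_simps)
  \<comment> \<open>The length of the right half-cell \<open>[A i, B i]\<close> inside
    \<open>[s, t]\<close>. It is at most that of the whole cell inside \<open>[s, t]\<close>, and
    those lengths telescope to \<open>t - s\<close>.\<close>
  define a where "a = (\<lambda>i. max 0 (min (B i) t - max (A i) s))"
  have "(\<Sum>i<2^k. a i) \<le> (\<Sum>i<2^k. (min (L (Suc i)) t - min (L (Suc i)) s) - (min (L i) t - min (L i) s))"
  proof (rule sum_mono)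
    fix i
    show "a i \<le> (min (L (Suc i)) t - min (L (Suc i)) s) - (min (L i) t - min (L i) s)"
      using LAB[of i] st unfolding a_def by (auto simp: min_def max_def)
  qed
  also have "\<dots> = (min (L (2^k)) t - min (L (2^k)) s) - (min (L 0) t - min (L 0) s)"
    by (rule sum_lessThan_telescope)
  also have "\<dots> = t - s"
    using st \<tau> by (simp add: L_def \<delta>_def)
  finally have suma: "(\<Sum>i<2^k. a i) \<le> t - s" .
  have summand: "\<bar>(F (A i) - F (L i)) * ((g (min (B i) t) - g (min (A i) t)) - (g (min (B i) s) - g (min (A i) s)))\<bar>
      \<le> H * \<delta> powr \<gamma> * (G * a i powr q)" for i
  proof (cases "A i \<le> t")
    case True
    have "\<bar>F (A i) - F (L i)\<bar> \<le> H * \<delta> powr \<gamma>"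
      using F[of "L i" "A i"] LAB[of i] True st by simp
    moreover have "\<bar>(g (min (B i) t) - g (min (A i) t)) - (g (min (B i) s) - g (min (A i) s))\<bar> \<le> G * a i powr q"
      unfolding a_def using LAB[of i] st \<tau> G by (intro stopped_increment_bound[OF g_holder]) auto
    ultimately show ?thesis
      unfolding abs_mult using H by (intro mult_mono) auto
  next
    \<comment> \<open>Here \<open>A i\<close> may exceed \<open>\<tau>\<close>, where
      \<open>F\<close> is not controlled, but the stopped increments of \<open>g\<close>
      vanish.\<close>
    case False
    then have "(g (min (B i) t) - g (min (A i) t)) - (g (min (B i) s) - g (min (A i) s)) = 0"
      using LAB[of i] st by (simp add: min_def)
    then show ?thesis using H G by simp
  qed
  have "(dyadic_sum T g F (Suc k) t - dyadic_sum T g F k t) - (dyadic_sum T g F (Suc k) s - dyadic_sum T g F k s)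
    = (\<Sum>i<2^k. (F (A i) - F (L i)) * ((g (min (B i) t) - g (min (A i) t)) - (g (min (B i) s) - g (min (A i) s))))"
    unfolding dyadic_sum_Suc A_def B_def L_def \<delta>_def
    by (simp only: sum_subtractf [symmetric] right_diff_distrib)
  also have "\<bar>\<dots>\<bar> \<le> (\<Sum>i<2^k. H * \<delta> powr \<gamma> * (G * a i powr q))"
    by (rule order_trans[OF sum_abs sum_mono]) (rule summand)
  also have "\<dots> = H * G * \<delta> powr \<gamma> * (\<Sum>i<2^k. a i powr q)"
    by (simp add: sum_distrib_left mult_ac)
  also have "\<dots> \<le> H * G * \<delta> powr \<gamma> * (real (2^k) powr (1 - q) * (t - s) powr q)"
    using H G by (intro mult_left_mono sum_powr_le q suma) (auto simp: a_def)
  also have "\<dots> = H * G * (\<delta> powr \<gamma> * real (2^k) powr (1 - q)) * (t - s) powr q"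
    by (simp add: mult_ac)
  also have "\<dots> \<le> H * G * (T powr \<gamma> * rate ^ k) * (t - s) powr q"
  proof (intro mult_right_mono mult_left_mono)
    have "\<delta> powr \<gamma> \<le> (T / 2 ^ k) powr \<gamma>"
      using \<gamma> q T by (intro powr_mono2) (auto simp: \<delta>_def field_simps)
    also have "\<dots> = T powr \<gamma> * (2 ^ k) powr (- \<gamma>)"
      using T by (simp add: powr_divide powr_minus field_simps)
    finally have "\<delta> powr \<gamma> * real (2^k) powr (1 - q) \<le> T powr \<gamma> * (2 ^ k) powr (- \<gamma>) * (2^k) powr (1 - q)"
      by (simp add: mult_right_mono)
    also have "\<dots> = T powr \<gamma> * (2 ^ k) powr (1 - q - \<gamma>)"
      by (simp add: powr_add [symmetric] mult.assoc algebra_simps)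
    also have "(2 ^ k) powr (1 - q - \<gamma>) = rate ^ k"
      unfolding rate_def by (simp add: powr_powr powr_realpow [symmetric] mult.commute)
    finally show "\<delta> powr \<gamma> * real (2^k) powr (1 - q) \<le> T powr \<gamma> * rate ^ k" .
  qed (use H G in auto)
  finally show ?thesis by (simp add: mult_ac)
qed

lemma dyadic_sum_0: "0 \<le> t \<Longrightarrow> t \<le> T \<Longrightarrow> dyadic_sum T g F 0 t = F 0 * (g t - g 0)"
  by (simp add: dyadic_sum_def)

lemma dyadic_sum_at_0: "dyadic_sum T g f n 0 = 0"
proof -
  have "min (real i * (T / 2 ^ n)) 0 = 0" for i using T by simp
  then show ?thesis unfolding dyadic_sum_def by (intro sum.neutral) (metis diff_self mult_zero_right)
qed

lemma dyadic_tail: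
  assumes \<tau>: "\<tau> \<le> T" and H: "0 \<le> H"
    and F: "\<And>u v. 0 \<le> u \<Longrightarrow> u \<le> v \<Longrightarrow> v \<le> \<tau> \<Longrightarrow> \<bar>F v - F u\<bar> \<le> H * (v - u) powr \<gamma>"
    and st: "0 \<le> s" "s \<le> t" "t \<le> \<tau>" and mn: "m \<le> n"
  shows "\<bar>(dyadic_sum T g F n t - dyadic_sum T g F m t)
      - (dyadic_sum T g F n s - dyadic_sum T g F m s)\<bar>
    \<le> H * G * T powr \<gamma> / (1 - rate) * rate ^ m * (t - s) powr q"
proof -
  define K where "K = H * G * T powr \<gamma> * (t - s) powr q"
  have K: "0 \<le> K" using H G by (simp add: K_def)
  \<comment> \<open>The bound is the exact partial geometric sum; in this form the induction over
    the level closes.\<close>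
  have "\<bar>(dyadic_sum T g F n t - dyadic_sum T g F m t)
      - (dyadic_sum T g F n s - dyadic_sum T g F m s)\<bar> \<le> K * (rate ^ m - rate ^ n) / (1 - rate)"
    using mn
  proof (induction n rule: dec_induct)
    case (step n)
    have "\<bar>(dyadic_sum T g F (Suc n) t - dyadic_sum T g F n t)
      - (dyadic_sum T g F (Suc n) s - dyadic_sum T g F n s)\<bar> \<le> K * rate ^ n"
      using dyadic_refinement[OF \<tau> H F st, of n] by (simp add: K_def mult_ac)
    with step.IH have "\<bar>(dyadic_sum T g F (Suc n) t - dyadic_sum T g F m t)
      - (dyadic_sum T g F (Suc n) s - dyadic_sum T g F m s)\<bar> \<le> K * (rate ^ m - rate ^ n) / (1 - rate) + K * rate ^ n"
      by linarith
    also have "\<dots> = K * (rate ^ m - rate ^ Suc n) / (1 - rate)"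
      using rate by (simp add: field_simps)
    finally show ?case .
  qed simp
  also have "\<dots> \<le> K * rate ^ m / (1 - rate)"
    using rate K by (intro divide_right_mono mult_left_mono) auto
  finally show ?thesis by (simp add: K_def mult_ac)
qed

text \<open>The tail estimate from level 0, where the sum is a single increment weighted by
  \<open>F 0\<close>. The constant therefore depends on the integrand only through
  \<open>F 0\<close> and \<open>H\<close>.\<close>

lemma dyadic_sum_holder:
  assumes \<tau>: "\<tau> \<le> T" and H: "0 \<le> H"
    and F: "\<And>u v. 0 \<le> u \<Longrightarrow> u \<le> v \<Longrightarrow> v \<le> \<tau> \<Longrightarrow> \<bar>F v - F u\<bar> \<le> H * (v - u) powr \<gamma>"
    and st: "0 \<le> s" "s \<le> t" "t \<le> \<tau>"
  shows "\<bar>dyadic_sum T g F n t - dyadic_sum T g F n s\<bar>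
    \<le> (\<bar>F 0\<bar> * G + H * G * T powr \<gamma> / (1 - rate)) * (t - s) powr q"
proof -
  have "dyadic_sum T g F 0 t - dyadic_sum T g F 0 s = F 0 * (g t - g s)"
    using st \<tau> by (simp add: dyadic_sum_0 algebra_simps)
  then have "\<bar>dyadic_sum T g F 0 t - dyadic_sum T g F 0 s\<bar> \<le> \<bar>F 0\<bar> * (G * (t - s) powr q)"
    using g_increment[of s t] st \<tau> by (simp add: abs_mult mult_left_mono)
  with dyadic_tail[OF \<tau> H F st, of 0 n] show ?thesis
    by (simp add: algebra_simps)
qed

text \<open>A crude count of the \<open>2 ^ m\<close> cells. The constant grows with the level, so
  the estimate serves on one fixed coarse level.\<close>

lemma dyadic_sum_diff:
  assumes \<tau>: "\<tau> \<le> T" and t: "0 \<le> t" "t \<le> \<tau>"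
    and d: "\<And>u. 0 \<le> u \<Longrightarrow> u \<le> \<tau> \<Longrightarrow> \<bar>F u - F' u\<bar> \<le> d"
  shows "\<bar>dyadic_sum T g F m t - dyadic_sum T g F' m t\<bar> \<le> 2 ^ m * G * T powr q * d"
proof -
  define u where "u = (\<lambda>i. real i * (T / 2 ^ m))"
  have u: "0 \<le> u i" "u i \<le> u (Suc i)" for i using T by (auto simp: u_def divide_right_mono)
  have d0: "0 \<le> d" using d[of 0] t by fastforce
  have "dyadic_sum T g F m t - dyadic_sum T g F' m t
     = (\<Sum>i<2^m. (F (u i) - F' (u i)) * (g (min (u (Suc i)) t) - g (min (u i) t)))"
    unfolding dyadic_sum_def u_def by (simp add: sum_subtractf [symmetric] left_diff_distrib)
  also have "\<bar>\<dots>\<bar> \<le> (\<Sum>i<(2::nat)^m. d * (G * T powr q))"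
  proof (rule order_trans[OF sum_abs sum_mono])
    fix i
    show "\<bar>(F (u i) - F' (u i)) * (g (min (u (Suc i)) t) - g (min (u i) t))\<bar> \<le> d * (G * T powr q)"
    proof (cases "u i \<le> t")
      case True
      have "\<bar>g (min (u (Suc i)) t) - g (min (u i) t)\<bar> \<le> G * (min (u (Suc i)) t - min (u i) t) powr q"
        using u[of i] t \<tau> by (intro g_increment) auto
      also have "\<dots> \<le> G * T powr q"
        using u[of i] t \<tau> G q by (intro mult_left_mono powr_mono2) (auto simp: min_def)
      finally show ?thesis
        unfolding abs_mult using d[of "u i"] u[of i] True t d0 by (intro mult_mono) auto
    next
      case False
      then have "min (u (Suc i)) t = t" "min (u i) t = t" using u[of i] by auto
      then show ?thesis using d0 G by simp
    qed
  qed
  also have "\<dots> = 2 ^ m * G * T powr q * d" by simp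
  finally show ?thesis .
qed

text \<open>Compare all sums with those of a fixed coarse level: the distance is small uniformly in the
  level, and on the coarse level uniform convergence of the integrands suffices.\<close>

lemma dyadic_sums_uniformly_Cauchy:
  assumes \<tau>: "0 \<le> \<tau>" "\<tau> \<le> T" and H: "0 \<le> H"
    and F: "\<And>n u v. 0 \<le> u \<Longrightarrow> u \<le> v \<Longrightarrow> v \<le> \<tau> \<Longrightarrow> \<bar>F n v - F n u\<bar> \<le> H * (v - u) powr \<gamma>"
    and C: "uniformly_Cauchy_on {0..\<tau>} F"
  shows "uniformly_Cauchy_on {0..\<tau>} (\<lambda>n t. dyadic_sum T g (F n) n t)"
  unfolding uniformly_Cauchy_on_def
proof (intro allI impI)
  fix e :: real assume e: "0 < e"
  define K where "K = H * G * T powr \<gamma> / (1 - rate) * T powr q"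
  have K: "0 \<le> K" using H G rate by (simp add: K_def)
  have "(\<lambda>m. K * rate ^ m) \<longlonglongrightarrow> K * 0"
    using rate by (intro tendsto_intros LIMSEQ_realpow_zero) auto
  then have "\<forall>\<^sub>F m in sequentially. K * rate ^ m < e / 4"
    using e by (intro order_tendstoD(2)[where y = "K * 0"]) auto
  then obtain m where m: "K * rate ^ m < e / 4" by (auto simp: eventually_sequentially)
  \<comment> \<open>The added 1 keeps the divisor positive when \<open>G = 0\<close>.\<close>
  define D where "D = 2 ^ m * G * T powr q + 1"
  have D: "0 < D" using G by (simp add: D_def add_nonneg_pos)
  obtain M where M: "\<And>u n n'. u \<in> {0..\<tau>} \<Longrightarrow> n \<ge> M \<Longrightarrow> n' \<ge> M \<Longrightarrow> dist (F n u) (F n' u) < e / (2 * D)"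
    using C e D unfolding uniformly_Cauchy_on_def by (metis divide_pos_pos mult_pos_pos zero_less_numeral)
  have tail: "\<bar>dyadic_sum T g (F n) n t - dyadic_sum T g (F n) m t\<bar> < e / 4"
    if "m \<le> n" "t \<in> {0..\<tau>}" for n t
  proof -
    have "\<bar>dyadic_sum T g (F n) n t - dyadic_sum T g (F n) m t\<bar>
       \<le> H * G * T powr \<gamma> / (1 - rate) * rate ^ m * (t - 0) powr q"
      using dyadic_tail[OF \<tau>(2) H F[of _ _ n], of 0 t m n] that by (simp add: dyadic_sum_at_0)
    also have "\<dots> \<le> H * G * T powr \<gamma> / (1 - rate) * rate ^ m * T powr q"
      using that \<tau> H G rate q by (intro mult_left_mono powr_mono2) auto
    also have "\<dots> = K * rate ^ m" by (simp add: K_def)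
    finally show ?thesis using m by linarith
  qed
  show "\<exists>M. \<forall>t\<in>{0..\<tau>}. \<forall>n\<ge>M. \<forall>n'\<ge>M. dist (dyadic_sum T g (F n) n t) (dyadic_sum T g (F n') n' t) < e"
  proof (intro exI[of _ "max m M"] ballI allI impI)
    fix t n n' assume t: "t \<in> {0..\<tau>}" and n: "max m M \<le> n" "max m M \<le> n'"
    \<comment> \<open>The distance splits into two tails, each below \<open>e / 4\<close>, and this
      difference on level \<open>m\<close>, at most \<open>e / 2\<close>.\<close>
    have "\<bar>dyadic_sum T g (F n) m t - dyadic_sum T g (F n') m t\<bar> \<le> 2 ^ m * G * T powr q * (e / (2 * D))"
    proof (rule dyadic_sum_diff[OF \<tau>(2)])
      show "\<bar>F n u - F n' u\<bar> \<le> e / (2 * D)" if "0 \<le> u" "u \<le> \<tau>" for u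
        using M[of u n n'] n that unfolding dist_real_def by auto
    qed (use t in auto)
    also have "\<dots> \<le> D * (e / (2 * D))"
      using e D by (intro mult_right_mono) (auto simp: D_def)
    also have "\<dots> = e / 2" using D by simp
    finally show "dist (dyadic_sum T g (F n) n t) (dyadic_sum T g (F n') n' t) < e"
      using tail[of n t] tail[of n' t] n t unfolding dist_real_def by linarith
  qed
qed

end

section \<open>Gronwall, reflection and path spaces\<close>

lemma powr_le_powr_mult:
  fixes u T :: real
  assumes "0 \<le> u" "u \<le> T" "p \<le> q"
  shows "u powr q \<le> T powr (q - p) * u powr p"
proof (cases "u = 0")
  case False
  then have "u powr q = u powr (q - p) * u powr p" by (simp add: powr_add [symmetric])
  also have "\<dots> \<le> T powr (q - p) * u powr p"
    using assms by (intro mult_right_mono powr_mono2) auto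
  finally show ?thesis .
qed simp

text \<open>A contraction in the norm weighted by \<open>exp (- l * t)\<close>: a bound
  \<open>E\<close> improves to \<open>A + E / 2\<close>, whose fixed point is \<open>2 * A\<close>.
  The bound \<open>K\<close> starts the iteration; its contribution is halved each time and
  disappears in the limit.\<close>

lemma gronwall_exp:
  fixes D :: "real \<Rightarrow> real"
  assumes A: "0 \<le> A" and l: "0 \<le> l" and S: "\<And>t. t \<in> S \<Longrightarrow> 0 \<le> t"
    and bdd: "\<And>t. t \<in> S \<Longrightarrow> D t \<le> K"
    and step: "\<And>E t. 0 \<le> E \<Longrightarrow> (\<And>s. s \<in> S \<Longrightarrow> D s \<le> E * exp (l * s)) \<Longrightarrow> t \<in> S \<Longrightarrow>
      D t \<le> A + E / 2 * exp (l * t)"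
    and t: "t \<in> S"
  shows "D t \<le> 2 * A * exp (l * t)"
proof -
  define K' where "K' = max K 0"
  have *: "D t \<le> (2 * A + K' / 2 ^ k) * exp (l * t)" if "t \<in> S" for k t
    using that
  proof (induction k arbitrary: t)
    case 0
    have "D t \<le> K' * 1" using bdd[OF 0] by (simp add: K'_def)
    also have "\<dots> \<le> (2 * A + K') * exp (l * t)"
      using A l S[OF 0] by (intro mult_mono) (auto simp: K'_def)
    finally show ?case by simp
  next
    case (Suc k)
    have nn: "0 \<le> 2 * A + K' / 2 ^ k"
      using A by (intro add_nonneg_nonneg divide_nonneg_nonneg) (auto simp: K'_def)
    have "D t \<le> A * 1 + (2 * A + K' / 2 ^ k) / 2 * exp (l * t)"
      using step[of "2 * A + K' / 2 ^ k" t] Suc nn by simp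
    also have "\<dots> \<le> A * exp (l * t) + (2 * A + K' / 2 ^ k) / 2 * exp (l * t)"
      using A l S[OF Suc.prems] by (intro add_right_mono mult_left_mono) auto
    finally show ?case by (simp add: algebra_simps add_divide_distrib)
  qed
  have "(\<lambda>k. (2 * A + K' * (1 / 2) ^ k) * exp (l * t)) \<longlonglongrightarrow> (2 * A + K' * 0) * exp (l * t)"
    by (intro tendsto_intros LIMSEQ_realpow_zero) auto
  from LIMSEQ_le_const[OF this] * [OF t] show ?thesis by (auto simp: power_divide)
qed

section \<open>The regulator of the one-sided Skorokhod problem at 0\<close>

definition reflection :: "(real \<Rightarrow> real) \<Rightarrow> real \<Rightarrow> real" where
  "reflection z t = (SUP s\<in>{0..t}. max (- z s) 0)"

lemma reflection_bdd:
  fixes z :: "real \<Rightarrow> real"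
  assumes "continuous_on {0..t} z"
  shows "bdd_above ((\<lambda>s. max (- z s) 0) ` {0..t})"
proof -
  have "compact ((\<lambda>s. max (- z s) 0) ` {0..t})"
    using assms by (intro compact_continuous_image continuous_on_max continuous_on_minus) auto
  then show ?thesis by (simp add: bounded_imp_bdd_above compact_imp_bounded)
qed

text \<open>Each time \<open>s\<close> is matched with some \<open>s'\<close> at which
  \<open>z'\<close> is close to \<open>z s\<close>. Different matchings give the Lipschitz bound
  between two paths, the increment bound for one path, and monotonicity in time (with
  \<open>e = 0\<close>).\<close>

lemma reflection_le_add:
  assumes z: "continuous_on {0..t} z'" and t: "0 \<le> t" "0 \<le> t'"
    and le: "\<And>s. s \<in> {0..t'} \<Longrightarrow> \<exists>s'\<in>{0..t}. \<bar>z s - z' s'\<bar> \<le> e"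
  shows "reflection z t' \<le> reflection z' t + e"
  unfolding reflection_def
proof (rule cSUP_least)
  fix s assume s: "s \<in> {0..t'}"
  obtain s' where s': "s' \<in> {0..t}" "\<bar>z s - z' s'\<bar> \<le> e" using le[OF s] by blast
  have "max (- z s) 0 \<le> max (- z' s') 0 + e" using s' by (auto simp: max_def)
  also have "max (- z' s') 0 \<le> (SUP s\<in>{0..t}. max (- z' s) 0)"
    by (rule cSUP_upper[OF s'(1) reflection_bdd[OF z]])
  finally show "max (- z s) 0 \<le> (SUP s\<in>{0..t}. max (- z' s) 0) + e" by simp
qed (use t in simp)

lemma reflection_diff:
  assumes "continuous_on {0..t} z" "continuous_on {0..t} z'" "0 \<le> t"
    and "\<And>s. s \<in> {0..t} \<Longrightarrow> \<bar>z s - z' s\<bar> \<le> e"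
  shows "\<bar>reflection z t - reflection z' t\<bar> \<le> e"
proof -
  have "reflection z t \<le> reflection z' t + e" "reflection z' t \<le> reflection z t + e"
    using assms by (intro reflection_le_add; force simp: abs_minus_commute)+
  then show ?thesis by linarith
qed

lemma reflection_bound:
  assumes "continuous_on {0..t} z" "0 \<le> t" "\<And>s. s \<in> {0..t} \<Longrightarrow> \<bar>z s\<bar> \<le> e"
  shows "\<bar>reflection z t\<bar> \<le> e"
proof -
  have "reflection (\<lambda>_. 0) t = 0" using assms(2) by (simp add: reflection_def)
  then show ?thesis using reflection_diff[of t z "\<lambda>_. 0" e] assms by simp
qed

lemma reflection_increment:
  assumes z: "continuous_on {0..t} z" and st: "0 \<le> s" "s \<le> t"
    and le: "\<And>u. s \<le> u \<Longrightarrow> u \<le> t \<Longrightarrow> \<bar>z u - z s\<bar> \<le> e"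
  shows "\<bar>reflection z t - reflection z s\<bar> \<le> e"
proof -
  have e: "0 \<le> e" using le[of s] st by simp
  have zs: "continuous_on {0..s} z" using z by (rule continuous_on_subset) (use st in auto)
  have "reflection z t \<le> reflection z s + e"
  proof (rule reflection_le_add[OF zs])
    \<comment> \<open>A time up to \<open>s\<close> is matched with itself, a later one with
      \<open>s\<close>.\<close>
    fix u assume "u \<in> {0..t}"
    then show "\<exists>s'\<in>{0..s}. \<bar>z u - z s'\<bar> \<le> e"
      using le[of u] st e by (cases "u \<le> s") (auto intro: bexI[of _ u] bexI[of _ s])
  qed (use st in auto)
  moreover have "reflection z s \<le> reflection z t + 0"
    by (rule reflection_le_add[OF z]) (use st in force)+
  ultimately show ?thesis using e by linarith
qed

lemma reflection_continuous:
  assumes z: "continuous_on {0..T} z"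
  shows "continuous_on {0..T} (reflection z)"
proof -
  have uc: "uniformly_continuous_on {0..T} z"
    using z by (intro compact_uniformly_continuous) auto
  have "uniformly_continuous_on {0..T} (reflection z)"
    unfolding uniformly_continuous_on_def
  proof (intro allI impI)
    fix e :: real assume e: "0 < e"
    then obtain d where d: "0 < d" "\<And>u v. u \<in> {0..T} \<Longrightarrow> v \<in> {0..T} \<Longrightarrow> dist v u < d \<Longrightarrow> dist (z v) (z u) < e / 2"
      using uc unfolding uniformly_continuous_on_def by (metis half_gt_zero)
    have *: "\<bar>reflection z t - reflection z s\<bar> < e" if "0 \<le> s" "s \<le> t" "t \<le> T" "t - s < d" for s t
    proof -
      have "\<bar>reflection z t - reflection z s\<bar> \<le> e / 2"
      proof (rule reflection_increment)
        show "continuous_on {0..t} z" using z by (rule continuous_on_subset) (use that in auto)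
        show "\<bar>z u - z s\<bar> \<le> e / 2" if "s \<le> u" "u \<le> t" for u
          using d(2)[of s u] that \<open>0 \<le> s\<close> \<open>t \<le> T\<close> \<open>t - s < d\<close> by (auto simp: dist_real_def)
      qed (use that in auto)
      then show ?thesis using e by linarith
    qed
    show "\<exists>d>0. \<forall>s\<in>{0..T}. \<forall>t\<in>{0..T}. dist t s < d \<longrightarrow> dist (reflection z t) (reflection z s) < e"
    proof (intro exI[of _ d] conjI ballI impI d(1))
      fix s t assume st: "s \<in> {0..T}" "t \<in> {0..T}" "dist t s < d"
      show "dist (reflection z t) (reflection z s) < e"
        using *[of s t] *[of t s] st unfolding dist_real_def
        by (cases "s \<le> t") (auto simp: abs_minus_commute)
    qed
  qed
  then show ?thesis by (rule uniformly_continuous_imp_continuous)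
qed

section \<open>Estimates for the drift integral\<close>

lemma set_integrable_bounded_Icc:
  fixes f :: "real \<Rightarrow> real"
  assumes m: "f \<in> borel_measurable borel" and b: "\<And>s. s \<in> {a..t} \<Longrightarrow> \<bar>f s\<bar> \<le> K"
  shows "set_integrable lborel {a..t} f"
proof (rule set_integrable_bound)
  show "set_integrable lborel {a..t} (\<lambda>_. K)"
    by (simp add: set_integrable_def emeasure_lborel_Icc_eq)
  show "set_borel_measurable lborel {a..t} f"
    using m by (simp add: set_borel_measurable_def)
  show "AE x in lborel. x \<in> {a..t} \<longrightarrow> norm (f x) \<le> norm K"
    using b by (intro AE_I2) fastforce
qed

lemma set_integral_increment_bound:
  fixes f :: "real \<Rightarrow> real"
  assumes f: "set_integrable lborel {0..t} f" and st: "0 \<le> s" "s \<le> t"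
    and b: "\<And>u. u \<in> {0..t} \<Longrightarrow> \<bar>f u\<bar> \<le> K"
  shows "\<bar>(LINT u:{0..t}|lborel. f u) - (LINT u:{0..s}|lborel. f u)\<bar> \<le> K * (t - s)"
proof -
  have i: "set_integrable lborel {0..s} f" "set_integrable lborel {s<..t} f"
    by (rule set_integrable_subset[OF f]; use st in force)+
  have u: "{0..t} = {0..s} \<union> {s<..t}" using st by auto
  have "(LINT u:{0..t}|lborel. f u) = (LINT u:{0..s}|lborel. f u) + (LINT u:{s<..t}|lborel. f u)"
    unfolding u by (rule set_integral_Un[OF _ i]) auto
  then have "\<bar>(LINT u:{0..t}|lborel. f u) - (LINT u:{0..s}|lborel. f u)\<bar> = \<bar>LINT u:{s<..t}|lborel. f u\<bar>"
    by simp
  also have "\<dots> \<le> (LINT u:{s<..t}|lborel. \<bar>f u\<bar>)"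
    using set_integral_norm_bound[OF i(2)] by simp
  also have "\<dots> \<le> (LINT u:{s<..t}|lborel. K)"
    using i(2) b st by (intro set_integral_mono set_integrable_abs)
      (auto simp: set_integrable_def emeasure_lborel_Ioc)
  also have "\<dots> = K * (t - s)"
    using st by (simp add: set_lebesgue_integral_def)
  finally show ?thesis .
qed

text \<open>Integrating the exponential gains the factor \<open>1 / l\<close>. A large
  \<open>l\<close> makes it small, which supplies the contraction for
  \<open>gronwall_exp\<close>.\<close>

lemma set_integral_exp_bound:
  fixes f :: "real \<Rightarrow> real"
  assumes f: "set_integrable lborel {0..t} f" and t: "0 \<le> t" and l: "0 < l" and C: "0 \<le> C"
    and b: "\<And>u. u \<in> {0..t} \<Longrightarrow> \<bar>f u\<bar> \<le> K + C * exp (l * u)"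
  shows "\<bar>LINT u:{0..t}|lborel. f u\<bar> \<le> K * t + C / l * exp (l * t)"
proof -
  define F where "F = (\<lambda>u. K * u + C / l * exp (l * u))"
  have d: "(F has_real_derivative K + C * exp (l * u)) (at u)" for u
    unfolding F_def using l by (auto intro!: derivative_eq_intros)
  have c: "continuous_on {0..t} (\<lambda>u. K + C * exp (l * u))" by (intro continuous_intros)
  have si: "set_integrable lborel {0..t} (\<lambda>u. K + C * exp (l * u))"
    using borel_integrable_atLeastAtMost'[OF c] .
  have "\<bar>LINT u:{0..t}|lborel. f u\<bar> \<le> (LINT u:{0..t}|lborel. \<bar>f u\<bar>)"
    using set_integral_norm_bound[OF f] by simp
  also have "\<dots> \<le> (LINT u:{0..t}|lborel. K + C * exp (l * u))"
    using f b si by (intro set_integral_mono set_integrable_abs) auto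
  also have "\<dots> = F t - F 0"
    unfolding set_lebesgue_integral_def
    by (rule integral_FTC_atLeastAtMost[OF t _ c])
       (use d in \<open>auto simp: has_real_derivative_iff_has_vector_derivative intro: has_vector_derivative_at_within\<close>)
  also have "\<dots> \<le> K * t + C / l * exp (l * t)"
    using C l by (simp add: F_def)
  finally show ?thesis .
qed

section \<open>Path spaces and their norm\<close>

lemma mspace_C_space:
  "mspace (C_space a b) = {f. f \<in> extensional {a..b} \<and> continuous_on {a..b} f}"
  unfolding C_space_def
  by (subst compactin_mspace_cfunspace)
     (auto simp: compactin_subtopology)

lemma C_norm_le:
  assumes "0 \<le> r" "\<And>s. s \<in> {- r..0} \<Longrightarrow> \<bar>\<phi> s\<bar> \<le> e"
  shows "C_norm r \<phi> \<le> e"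
  unfolding C_norm_def using assms by (intro cSUP_least) auto

text \<open>The supremum in \<open>C_norm\<close> is a conditional one; continuity on a compact
  interval supplies the bound that makes it an upper bound of the values.\<close>

lemma C_norm_nonneg:
  assumes "0 \<le> r" "continuous_on {- r..0} \<phi>"
  shows "0 \<le> C_norm r \<phi>"
proof -
  have "compact ((\<lambda>s. \<bar>\<phi> s\<bar>) ` {- r..0})"
    using assms by (intro compact_continuous_image continuous_intros) auto
  then have "bdd_above ((\<lambda>s. \<bar>\<phi> s\<bar>) ` {- r..0})"
    by (simp add: bounded_imp_bdd_above compact_imp_bounded)
  then have "\<bar>\<phi> 0\<bar> \<le> C_norm r \<phi>"
    unfolding C_norm_def using assms by (intro cSUP_upper) auto
  then show ?thesis by linarith
qed

lemma segment_in_C_space: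
  assumes "continuous_on {- r..T} x" "t \<in> {0..T}"
  shows "segment r x t \<in> mspace (C_space (- r) 0)"
proof -
  have "continuous_on {- r..0} (x \<circ> (\<lambda>s. t + s))"
    using assms by (intro continuous_on_compose continuous_intros) (auto elim!: continuous_on_subset)
  then show ?thesis
    unfolding mspace_C_space segment_def by (auto cong: continuous_on_cong_simp)
qed

lemma uniformly_Cauchy_imp_MCauchy:
  fixes x :: "nat \<Rightarrow> real \<Rightarrow> real"
  assumes c: "\<And>n. continuous_on {a..b} (x n)" and u: "uniformly_Cauchy_on {a..b} x"
  shows "Metric_space.MCauchy (mspace (C_space a b)) (mdist (C_space a b)) (\<lambda>n. \<lambda>t\<in>{a..b}. x n t)"
proof -
  interpret M: Metric_space "mspace (C_space a b)" "mdist (C_space a b)"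
    by (rule Metric_space_mspace_mdist)
  have "range (\<lambda>n. \<lambda>t\<in>{a..b}. x n t) \<subseteq> mspace (C_space a b)"
    using c by (auto simp: mspace_C_space cong: continuous_on_cong_simp)
  moreover have "\<exists>N. \<forall>n n'. N \<le> n \<longrightarrow> N \<le> n' \<longrightarrow>
      mdist (C_space a b) (\<lambda>t\<in>{a..b}. x n t) (\<lambda>t\<in>{a..b}. x n' t) < e" if e: "0 < e" for e
  proof -
    obtain N where N: "\<And>t n n'. t \<in> {a..b} \<Longrightarrow> N \<le> n \<Longrightarrow> N \<le> n' \<Longrightarrow> dist (x n t) (x n' t) < e / 2"
      using u e unfolding uniformly_Cauchy_on_def by (metis half_gt_zero)
    have "mdist (C_space a b) (\<lambda>t\<in>{a..b}. x n t) (\<lambda>t\<in>{a..b}. x n' t) \<le> e / 2" if "N \<le> n" "N \<le> n'" for n n'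
      unfolding C_space_def using e N that by (intro mdist_cfunspace_le) (auto intro: less_imp_le)
    moreover have "e / 2 < e" using e by simp
    ultimately show ?thesis by (meson le_less_trans)
  qed
  ultimately show ?thesis unfolding M.MCauchy_def by blast
qed

section \<open>The reflected Euler scheme\<close>

lemma grid_point_bounds:
  assumes "0 < T" "0 \<le> s"
  shows "0 \<le> grid_point T n s" "grid_point T n s \<le> s" "s - T / 2 ^ n \<le> grid_point T n s"
proof -
  define d where "d = T / 2 ^ n"
  have d: "0 < d" using assms by (simp add: d_def)
  have "0 \<le> real_of_int \<lfloor>s / d\<rfloor> * d" using assms d by simp
  moreover have "real_of_int \<lfloor>s / d\<rfloor> * d \<le> s / d * d"
    using d by (intro mult_right_mono) auto
  moreover have "s / d * d \<le> (real_of_int \<lfloor>s / d\<rfloor> + 1) * d"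
    using d by (intro mult_right_mono) linarith+
  ultimately show "0 \<le> grid_point T n s" "grid_point T n s \<le> s" "s - T / 2 ^ n \<le> grid_point T n s"
    using d unfolding grid_point_def d_def [symmetric] by (simp_all add: distrib_right)
qed

text \<open>The function factors through the integer-valued floor, and on the integers every
  function is measurable; so an arbitrary \<open>h\<close> may be sampled.\<close>

lemma grid_point_measurable: "(\<lambda>s. h (grid_point T n s)) \<in> borel_measurable borel" for h :: "real \<Rightarrow> real"
proof -
  have "(\<lambda>i::int. h (of_int i * (T / 2 ^ n))) \<circ> (\<lambda>s. \<lfloor>s / (T / 2 ^ n)\<rfloor>) \<in> borel_measurable borel"
    by (intro measurable_comp[where N = "count_space UNIV"]) measurable
  then show ?thesis by (simp add: grid_point_def o_def)
qed

lemma grid_point_finite: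
  assumes "0 < T"
  shows "finite (grid_point T n ` {0..T})"
proof (rule finite_subset)
  \<comment> \<open>The top index \<open>2 ^ n\<close> occurs at \<open>s = T\<close>.\<close>
  show "grid_point T n ` {0..T} \<subseteq> (\<lambda>i::int. of_int i * (T / 2 ^ n)) ` {0..2 ^ n}"
  proof (rule image_subsetI)
    fix s assume s: "s \<in> {0..T}"
    have "s / (T / 2 ^ n) \<le> T / (T / 2 ^ n)"
      using s assms by (intro divide_right_mono) auto
    then have "s / (T / 2 ^ n) \<le> 2 ^ n" using assms by simp
    then have "\<lfloor>s / (T / 2 ^ n)\<rfloor> \<le> 2 ^ n" by (simp add: floor_le_iff)
    moreover have "0 \<le> \<lfloor>s / (T / 2 ^ n)\<rfloor>" using s assms by simp
    ultimately show "grid_point T n s \<in> (\<lambda>i::int. of_int i * (T / 2 ^ n)) ` {0..2 ^ n}"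
      unfolding grid_point_def by (intro imageI) simp
  qed
qed simp

text \<open>The scheme with \<open>dyadic_sum\<close> in place of the generalized integral, where
  \<open>\<kappa>\<close> stands for \<open>gls_const \<alpha>\<close>; fractional derivatives no
  longer occur. One constant \<open>L\<close> serves both coefficients, and one exponent
  \<open>\<gamma>\<close> serves the initial path, the integrands and the solutions.\<close>

locale reflected_euler = young_integrator T q \<gamma> G g for T q \<gamma> G and g :: "real \<Rightarrow> real" +
  fixes r \<kappa> \<beta> L H\<eta> :: real and \<eta> :: "real \<Rightarrow> real" and b :: "real \<Rightarrow> (real \<Rightarrow> real) \<Rightarrow> real"
    and \<sigma> :: "real \<Rightarrow> real \<Rightarrow> real" and x z :: "nat \<Rightarrow> real \<Rightarrow> real"
  assumes r: "0 < r" and \<beta>: "0 < \<beta>" "\<gamma> \<le> \<beta>" and \<gamma>_q: "\<gamma> \<le> q" and L: "0 \<le> L" and H\<eta>: "0 \<le> H\<eta>"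
    and \<eta>_0: "0 \<le> \<eta> 0"
    and \<eta>_holder: "\<And>u v. - r \<le> u \<Longrightarrow> u \<le> v \<Longrightarrow> v \<le> 0 \<Longrightarrow> \<bar>\<eta> v - \<eta> u\<bar> \<le> H\<eta> * (v - u) powr \<gamma>"
    and b_growth: "\<And>t \<phi>. t \<in> {0..T} \<Longrightarrow> \<phi> \<in> mspace (C_space (- r) 0) \<Longrightarrow>
      \<bar>b t \<phi>\<bar> \<le> L * (1 + C_norm r \<phi>)"
    and b_lipschitz: "\<And>t \<phi> \<psi>. t \<in> {0..T} \<Longrightarrow> \<phi> \<in> mspace (C_space (- r) 0) \<Longrightarrow>
      \<psi> \<in> mspace (C_space (- r) 0) \<Longrightarrow> \<bar>b t \<phi> - b t \<psi>\<bar> \<le> L * C_norm r (\<lambda>s. \<phi> s - \<psi> s)"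
    and b_holder: "\<And>s t \<phi>. s \<in> {0..T} \<Longrightarrow> t \<in> {0..T} \<Longrightarrow> \<phi> \<in> mspace (C_space (- r) 0) \<Longrightarrow>
      \<bar>b t \<phi> - b s \<phi>\<bar> \<le> L * \<bar>t - s\<bar> powr \<beta>"
    and \<sigma>_growth: "\<And>t v. t \<in> {0..T} \<Longrightarrow> \<bar>\<sigma> t v\<bar> \<le> L * (1 + \<bar>v\<bar>)"
    and \<sigma>_lipschitz: "\<And>t v w. t \<in> {0..T} \<Longrightarrow> \<bar>\<sigma> t v - \<sigma> t w\<bar> \<le> L * \<bar>v - w\<bar>"
    and \<sigma>_holder: "\<And>s t v. s \<in> {0..T} \<Longrightarrow> t \<in> {0..T} \<Longrightarrow>
      \<bar>\<sigma> t v - \<sigma> s v\<bar> \<le> L * \<bar>t - s\<bar> powr \<beta> * (1 + \<bar>v\<bar>)"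
    and x_reflected: "\<And>n t. t \<in> {0..T} \<Longrightarrow> x n t = z n t + reflection (z n) t"
    and x_initial: "\<And>n t. t \<in> {- r..0} \<Longrightarrow> x n t = \<eta> t"
    and z_scheme: "\<And>n t. t \<in> {0..T} \<Longrightarrow> z n t = \<eta> 0
      + (LINT s:{0..t}|lborel. b (grid_point T n s) (segment r (x n) (grid_point T n s)))
      + \<kappa> * dyadic_sum T g (\<lambda>s. \<sigma> s (x n (s - r))) n t"
begin

definition B :: "nat \<Rightarrow> real \<Rightarrow> real" where
  "B n s = b (grid_point T n s) (segment r (x n) (grid_point T n s))"

text \<open>Defined at all times, although level \<open>n\<close> samples it on its own grid only:
  \<open>dyadic_tail\<close> compares sums of different levels of the same integrand.\<close>

definition F :: "nat \<Rightarrow> real \<Rightarrow> real" where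
  "F n s = \<sigma> s (x n (s - r))"

lemma z_eq: "t \<in> {0..T} \<Longrightarrow> z n t = \<eta> 0 + (LINT s:{0..t}|lborel. B n s) + \<kappa> * dyadic_sum T g (F n) n t"
  using z_scheme unfolding B_def F_def .

lemma grid_in: "s \<in> {0..T} \<Longrightarrow> grid_point T n s \<in> {0..T}"
  using grid_point_bounds[OF T, of s n] by auto

lemma B_measurable: "B n \<in> borel_measurable borel"
  unfolding B_def by (rule grid_point_measurable)

text \<open>On a fixed level the drift takes finitely many values. The growth bound on
  \<open>b\<close> cannot be used yet: it needs continuous segments, and continuity of
  \<open>x n\<close> is derived from this lemma.\<close>

lemma B_bounded: obtains K where "\<And>s. s \<in> {0..T} \<Longrightarrow> \<bar>B n s\<bar> \<le> K"
proof -
  have "finite ((\<lambda>u. \<bar>b u (segment r (x n) u)\<bar>) ` grid_point T n ` {0..T})"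
    using grid_point_finite[OF T] by (rule finite_imageI)
  then have "\<bar>B n s\<bar> \<le> Max ((\<lambda>u. \<bar>b u (segment r (x n) u)\<bar>) ` grid_point T n ` {0..T})" if "s \<in> {0..T}" for s
    using that unfolding B_def by (intro Max_ge) auto
  then show ?thesis by (rule that)
qed

lemma B_integrable:
  assumes "t \<le> T" shows "set_integrable lborel {0..t} (B n)"
proof -
  obtain K where "\<And>s. s \<in> {0..T} \<Longrightarrow> \<bar>B n s\<bar> \<le> K" by (rule B_bounded[of n]) (rule that)
  then show ?thesis using assms by (intro set_integrable_bounded_Icc[OF B_measurable, where K = K]) auto
qed

lemma drift_increment:
  assumes "0 \<le> s" "s \<le> t" "t \<le> T" and "\<And>u. u \<in> {0..t} \<Longrightarrow> \<bar>B n u\<bar> \<le> K"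
  shows "\<bar>(LINT u:{0..t}|lborel. B n u) - (LINT u:{0..s}|lborel. B n u)\<bar> \<le> K * (t - s)"
  using assms B_integrable by (intro set_integral_increment_bound) auto

text \<open>There is no circularity: the right-hand side of the scheme is continuous in
  \<open>t\<close> whatever \<open>x n\<close> is, being built from an integral of a bounded
  function and finitely many stopped increments of \<open>g\<close>.\<close>

lemma z_continuous: "continuous_on {0..T} (z n)"
proof -
  have gc: "continuous_on {0..T} g"
    using q g_holder by (intro holder_continuous_on[of q]) auto
  obtain K where K: "\<And>s. s \<in> {0..T} \<Longrightarrow> \<bar>B n s\<bar> \<le> K" by (rule B_bounded[of n]) (rule that)
  have "continuous_on {0..T} (\<lambda>t. LINT s:{0..t}|lborel. B n s)"
    using K drift_increment[of _ _ n K] by (intro holder_continuous_on[of 1 _ _ _ K]) auto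
  moreover have "continuous_on {0..T} (\<lambda>t. g (min c t))" if "0 \<le> c" for c
  proof -
    have "continuous_on {0..T} (g \<circ> min c)"
      by (intro continuous_on_compose continuous_on_subset[OF gc] continuous_on_min continuous_on_const continuous_on_id)
        (use that in auto)
    then show ?thesis by (simp add: o_def)
  qed
  then have "continuous_on {0..T} (dyadic_sum T g (F n) n)"
    unfolding dyadic_sum_def using T by (intro continuous_intros) auto
  ultimately have "continuous_on {0..T} (\<lambda>t. \<eta> 0 + (LINT s:{0..t}|lborel. B n s) + \<kappa> * dyadic_sum T g (F n) n t)"
    by (intro continuous_intros)
  then show ?thesis using z_eq by (simp cong: continuous_on_cong_simp)
qed

lemma z_continuous_sub: "t \<le> T \<Longrightarrow> continuous_on {0..t} (z n)"
  using z_continuous by (rule continuous_on_subset) auto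

lemma x_continuous: "continuous_on {- r..T} (x n)"
proof -
  have "continuous_on {0..T} (\<lambda>t. z n t + reflection (z n) t)"
    by (intro continuous_intros z_continuous reflection_continuous)
  then have "continuous_on {0..T} (x n)" using x_reflected by (simp cong: continuous_on_cong_simp)
  moreover have "continuous_on {- r..0} \<eta>"
    using \<gamma> q \<eta>_holder by (intro holder_continuous_on[of \<gamma> _ _ _ H\<eta>]) auto
  then have "continuous_on {- r..0} (x n)" using x_initial by (simp cong: continuous_on_cong_simp)
  ultimately have "continuous_on ({- r..0} \<union> {0..T}) (x n)"
    by (intro continuous_on_closed_Un) auto
  moreover have "{- r..0} \<union> {0..T} = {- r..T}" using r T by auto
  ultimately show ?thesis by simp
qed

lemma segment_mspace: "t \<in> {0..T} \<Longrightarrow> segment r (x n) t \<in> mspace (C_space (- r) 0)"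
  by (rule segment_in_C_space[OF x_continuous])

lemma segment_norm_le:
  assumes "t \<in> {0..T}" "\<And>u. - r \<le> u \<Longrightarrow> u \<le> t \<Longrightarrow> \<bar>x n u\<bar> \<le> e"
  shows "C_norm r (segment r (x n) t) \<le> e"
  using assms r by (intro C_norm_le) (auto simp: segment_def)

lemma B_le:
  assumes "s \<in> {0..T}" "\<And>u. - r \<le> u \<Longrightarrow> u \<le> s \<Longrightarrow> \<bar>x n u\<bar> \<le> e"
  shows "\<bar>B n s\<bar> \<le> L * (1 + e)"
proof -
  have "\<bar>B n s\<bar> \<le> L * (1 + C_norm r (segment r (x n) (grid_point T n s)))"
    unfolding B_def using assms(1) by (intro b_growth grid_in segment_mspace) auto
  also have "\<dots> \<le> L * (1 + e)"
    using assms L grid_in[OF assms(1)] grid_point_bounds(2)[OF T, of s n]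
    by (intro mult_left_mono add_left_mono segment_norm_le) auto
  finally show ?thesis .
qed

lemma reflected_increment:
  assumes st: "0 \<le> s" "s \<le> t" "t \<le> T"
    and le: "\<And>u. s \<le> u \<Longrightarrow> u \<le> t \<Longrightarrow> \<bar>z n u - z n s\<bar> \<le> e"
  shows "\<bar>x n t - x n s\<bar> \<le> 2 * e"
  using reflection_increment[OF z_continuous_sub[OF st(3)] st(1,2) le] le[of t] st
    x_reflected[of t n] x_reflected[of s n] by force

section \<open>Sup and Hoelder bounds uniform in the level\<close>

definition regular_upto :: "real \<Rightarrow> real \<Rightarrow> real \<Rightarrow> bool" where
  "regular_upto \<tau> M H \<longleftrightarrow> 0 \<le> M \<and> 0 \<le> H \<and> (\<forall>n u. - r \<le> u \<longrightarrow> u \<le> \<tau> \<longrightarrow> \<bar>x n u\<bar> \<le> M) \<and>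
     (\<forall>n u v. - r \<le> u \<longrightarrow> u \<le> v \<longrightarrow> v \<le> \<tau> \<longrightarrow> \<bar>x n v - x n u\<bar> \<le> H * (v - u) powr \<gamma>)"

lemma regular_sup: "regular_upto \<tau> M H \<Longrightarrow> - r \<le> u \<Longrightarrow> u \<le> \<tau> \<Longrightarrow> \<bar>x n u\<bar> \<le> M"
  by (simp add: regular_upto_def)

lemma regular_holder:
  "regular_upto \<tau> M H \<Longrightarrow> - r \<le> u \<Longrightarrow> u \<le> v \<Longrightarrow> v \<le> \<tau> \<Longrightarrow> \<bar>x n v - x n u\<bar> \<le> H * (v - u) powr \<gamma>"
  by (simp add: regular_upto_def)

lemma F_regular:
  assumes reg: "regular_upto \<tau> M H" and uv: "0 \<le> u" "u \<le> v" "v \<le> min (\<tau> + r) T"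
  shows "\<bar>F n v - F n u\<bar> \<le> L * (T powr (\<beta> - \<gamma>) * (1 + M) + H) * (v - u) powr \<gamma>"
proof -
  have "\<bar>\<sigma> v (x n (v - r)) - \<sigma> u (x n (v - r))\<bar> \<le> L * \<bar>v - u\<bar> powr \<beta> * (1 + \<bar>x n (v - r)\<bar>)"
    using uv by (intro \<sigma>_holder) auto
  also have "\<dots> \<le> L * (T powr (\<beta> - \<gamma>) * (v - u) powr \<gamma>) * (1 + M)"
  proof (intro mult_mono mult_left_mono)
    show "\<bar>v - u\<bar> powr \<beta> \<le> T powr (\<beta> - \<gamma>) * (v - u) powr \<gamma>"
      using powr_le_powr_mult[of "v - u" T \<gamma> \<beta>] uv \<beta> by simp
    show "1 + \<bar>x n (v - r)\<bar> \<le> 1 + M"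
      using reg uv unfolding regular_upto_def by auto
  qed (use L in auto)
  finally have 1: "\<bar>\<sigma> v (x n (v - r)) - \<sigma> u (x n (v - r))\<bar> \<le> L * (T powr (\<beta> - \<gamma>) * (v - u) powr \<gamma>) * (1 + M)" .
  have "\<bar>\<sigma> u (x n (v - r)) - \<sigma> u (x n (u - r))\<bar> \<le> L * \<bar>x n (v - r) - x n (u - r)\<bar>"
    using uv by (intro \<sigma>_lipschitz) auto
  also have "\<dots> \<le> L * (H * ((v - r) - (u - r)) powr \<gamma>)"
    using regular_holder[OF reg, of "u - r" "v - r" n] uv L by (intro mult_left_mono) auto
  finally have 2: "\<bar>\<sigma> u (x n (v - r)) - \<sigma> u (x n (u - r))\<bar> \<le> L * (H * (v - u) powr \<gamma>)" by simp
  from 1 2 have "\<bar>F n v - F n u\<bar> \<le> L * (T powr (\<beta> - \<gamma>) * (v - u) powr \<gamma>) * (1 + M) + L * (H * (v - u) powr \<gamma>)"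
    unfolding F_def by linarith
  then show ?thesis by (simp add: algebra_simps)
qed

lemma rough_term_holder:
  assumes reg: "regular_upto \<tau> M H" and \<tau>: "0 \<le> \<tau>"
  obtains C where "0 \<le> C" "\<And>n s t. 0 \<le> s \<Longrightarrow> s \<le> t \<Longrightarrow> t \<le> min (\<tau> + r) T \<Longrightarrow>
    \<bar>dyadic_sum T g (F n) n t - dyadic_sum T g (F n) n s\<bar> \<le> C * (t - s) powr q"
proof -
  define H' where "H' = L * (T powr (\<beta> - \<gamma>) * (1 + M) + H)"
  have MH: "0 \<le> M" "0 \<le> H" using reg by (auto simp: regular_upto_def)
  have H': "0 \<le> H'" using MH L by (simp add: H'_def)
  define C where "C = L * (1 + M) * G + H' * G * T powr \<gamma> / (1 - rate)"
  show ?thesis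
  proof (rule that[of C])
    show "0 \<le> C" using MH L H' G rate by (simp add: C_def)
    fix n s t assume st: "0 \<le> s" "s \<le> t" "t \<le> min (\<tau> + r) T"
    have "\<bar>F n 0\<bar> \<le> L * (1 + \<bar>x n (- r)\<bar>)" using \<sigma>_growth[of 0 "x n (- r)"] T by (simp add: F_def)
    also have "\<dots> \<le> L * (1 + M)"
      using reg L r \<tau> unfolding regular_upto_def by (intro mult_left_mono) auto
    finally have F0: "\<bar>F n 0\<bar> \<le> L * (1 + M)" .
    have "\<bar>dyadic_sum T g (F n) n t - dyadic_sum T g (F n) n s\<bar>
       \<le> (\<bar>F n 0\<bar> * G + H' * G * T powr \<gamma> / (1 - rate)) * (t - s) powr q"
      using F_regular[OF reg] H' st unfolding H'_def
      by (intro dyadic_sum_holder[where \<tau> = "min (\<tau> + r) T"]) auto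
    also have "\<dots> \<le> C * (t - s) powr q"
      using F0 G by (intro mult_right_mono) (auto simp: C_def mult_right_mono)
    finally show "\<bar>dyadic_sum T g (F n) n t - dyadic_sum T g (F n) n s\<bar> \<le> C * (t - s) powr q" .
  qed
qed

text \<open>The bound depends on \<open>n\<close>. In \<open>sup_bound_step\<close> it starts
  Gronwall's argument, whose conclusion does not contain it.\<close>

lemma x_bounded: obtains K where "\<And>u. - r \<le> u \<Longrightarrow> u \<le> T \<Longrightarrow> \<bar>x n u\<bar> \<le> K"
proof -
  have "compact (x n ` {- r..T})"
    by (intro compact_continuous_image x_continuous) simp
  then show ?thesis using that unfolding compact_eq_bounded_closed bounded_iff
    by (metis atLeastAtMost_iff imageI real_norm_def)
qed

lemma sup_bound_step:
  assumes reg: "regular_upto \<tau> M H" and \<tau>: "0 \<le> \<tau>" "\<tau> \<le> T"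
  obtains M' where "\<And>n u. - r \<le> u \<Longrightarrow> u \<le> min (\<tau> + r) T \<Longrightarrow> \<bar>x n u\<bar> \<le> M'"
proof -
  define \<tau>' where "\<tau>' = min (\<tau> + r) T"
  have \<tau>': "0 \<le> \<tau>'" "\<tau>' \<le> T" using \<tau> r T by (auto simp: \<tau>'_def)
  have M: "0 \<le> M" using reg by (auto simp: regular_upto_def)
  have xM: "\<bar>x n u\<bar> \<le> M" if "- r \<le> u" "u \<le> 0" for n u using reg that \<tau> by (auto simp: regular_upto_def)
  obtain C where C: "0 \<le> C" "\<And>n s t. 0 \<le> s \<Longrightarrow> s \<le> t \<Longrightarrow> t \<le> \<tau>' \<Longrightarrow>
    \<bar>dyadic_sum T g (F n) n t - dyadic_sum T g (F n) n s\<bar> \<le> C * (t - s) powr q"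
    by (rule rough_term_holder[OF reg \<tau>(1), folded \<tau>'_def]) (rule that)
  \<comment> \<open>The parts of \<open>z\<close> that do not grow with the current path: the
    initial value, the drift due to the constant 1 and the initial segment, and the rough
    term.\<close>
  define A where "A = \<eta> 0 + L * (1 + M) * T + \<bar>\<kappa>\<bar> * (C * T powr q)"
  have A: "0 \<le> A" using \<eta>_0 L M T C by (simp add: A_def)
  \<comment> \<open>The reflection doubles the bound on \<open>z\<close>, so halving requires
    \<open>2 * (L / l) \<le> 1 / 2\<close>; the added 1 keeps \<open>l\<close> positive.\<close>
  define l where "l = 4 * L + 1"
  have l: "0 < l" "2 * (L / l) \<le> 1 / 2" using L by (auto simp: l_def field_simps)
  have main: "\<bar>x n t\<bar> \<le> 2 * (2 * A) * exp (l * t)" if t: "t \<in> {0..\<tau>'}" for n t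
  proof -
    obtain K where K: "\<And>u. - r \<le> u \<Longrightarrow> u \<le> T \<Longrightarrow> \<bar>x n u\<bar> \<le> K"
      by (rule x_bounded[of n]) (rule that)
    show ?thesis
    proof (rule gronwall_exp[where S = "{0..\<tau>'}" and D = "\<lambda>t. \<bar>x n t\<bar>" and K = K])
      show "\<bar>x n t\<bar> \<le> K" if "t \<in> {0..\<tau>'}" for t using K[of t] that \<tau>' r by auto
      fix E t assume E: "0 \<le> E" and le: "\<And>s. s \<in> {0..\<tau>'} \<Longrightarrow> \<bar>x n s\<bar> \<le> E * exp (l * s)" and t: "t \<in> {0..\<tau>'}"
      have Bb: "\<bar>B n s\<bar> \<le> L * (1 + M) + L * E * exp (l * s)" if s: "s \<in> {0..\<tau>'}" for s
      proof -
        \<comment> \<open>The segment may reach below 0, where \<open>M\<close> is the bound, while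
          \<open>E\<close> controls the rest; the sum covers both.\<close>
        have "\<bar>x n u\<bar> \<le> M + E * exp (l * s)" if u: "- r \<le> u" "u \<le> s" for u
        proof (cases "u \<le> 0")
          case True
          then show ?thesis using xM[of u n] u E by (simp add: add_increasing2)
        next
          case False
          then have "\<bar>x n u\<bar> \<le> E * exp (l * u)" using le u s by auto
          also have "\<dots> \<le> E * exp (l * s)" using u E l by (intro mult_left_mono) auto
          finally show ?thesis using M by linarith
        qed
        then have "\<bar>B n s\<bar> \<le> L * (1 + (M + E * exp (l * s)))"
          using s \<tau>' by (intro B_le) auto
        then show ?thesis by (simp add: algebra_simps)
      qed
      have zb: "\<bar>z n s\<bar> \<le> A + L / l * E * exp (l * t)" if s: "s \<in> {0..t}" for s
      proof -
        have st: "s \<in> {0..\<tau>'}" "s \<in> {0..T}" using s t \<tau>' by auto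
        have "\<bar>LINT u:{0..s}|lborel. B n u\<bar> \<le> L * (1 + M) * s + L * E / l * exp (l * s)"
          using Bb st L E l B_integrable by (intro set_integral_exp_bound) auto
        also have "\<dots> \<le> L * (1 + M) * T + L * E / l * exp (l * t)"
          using s st L E l M by (intro add_mono mult_left_mono) auto
        finally have 1: "\<bar>LINT u:{0..s}|lborel. B n u\<bar> \<le> L * (1 + M) * T + L * E / l * exp (l * t)" .
        have "\<bar>dyadic_sum T g (F n) n s\<bar> \<le> C * s powr q"
          using C(2)[of 0 s n] st by (simp add: dyadic_sum_at_0)
        also have "\<dots> \<le> C * T powr q"
          using C(1) st q by (intro mult_left_mono powr_mono2) auto
        finally have 2: "\<bar>\<kappa> * dyadic_sum T g (F n) n s\<bar> \<le> \<bar>\<kappa>\<bar> * (C * T powr q)"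
          unfolding abs_mult by (rule mult_left_mono) simp
        show ?thesis
          using 1 2 \<eta>_0 unfolding z_eq[OF st(2)] A_def by (simp add: algebra_simps) 
      qed
      have tT: "t \<in> {0..T}" "t \<le> T" using t \<tau>' by auto
      have "\<bar>x n t\<bar> \<le> 2 * (A + L / l * E * exp (l * t))"
        using reflection_bound[OF z_continuous_sub[OF tT(2)] _ zb] zb[of t] t
        unfolding x_reflected[OF tT(1)] by force
      also have "\<dots> = 2 * A + (2 * (L / l)) * (E * exp (l * t))" by (simp add: algebra_simps)
      also have "\<dots> \<le> 2 * A + 1 / 2 * (E * exp (l * t))"
        using l E by (intro add_left_mono mult_right_mono) auto
      finally show "\<bar>x n t\<bar> \<le> 2 * A + E / 2 * exp (l * t)" by simp
    qed (use A l t in auto)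
  qed
  have *: "\<bar>x n t\<bar> \<le> 4 * A * exp (l * T)" if "t \<in> {0..\<tau>'}" for n t
  proof -
    have "\<bar>x n t\<bar> \<le> 4 * A * exp (l * t)"
      using main[OF that] by simp
    also have "\<dots> \<le> 4 * A * exp (l * T)"
      using that \<tau>' A l by (intro mult_left_mono) auto
    finally show ?thesis .
  qed
  show ?thesis
  proof (rule that[of "M + 4 * A * exp (l * T)"])
    fix n u assume u: "- r \<le> u" "u \<le> min (\<tau> + r) T"
    show "\<bar>x n u\<bar> \<le> M + 4 * A * exp (l * T)"
    proof (cases "u \<le> 0")
      case True
      have "0 \<le> 4 * A * exp (l * T)" using A by simp
      with xM[OF u(1) True, of n] show ?thesis by linarith
    next
      case False
      then show ?thesis using *[of u n] u M by (simp add: \<tau>'_def)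
    qed
  qed
qed

lemma regular_step:
  assumes reg: "regular_upto \<tau> M H" and \<tau>: "0 \<le> \<tau>" "\<tau> \<le> T"
  shows "\<exists>M' H'. regular_upto (min (\<tau> + r) T) M' H'"
proof -
  define \<tau>' where "\<tau>' = min (\<tau> + r) T"
  have \<tau>': "0 \<le> \<tau>'" "\<tau>' \<le> T" using \<tau> r T by (auto simp: \<tau>'_def)
  obtain M' where M': "\<And>n u. - r \<le> u \<Longrightarrow> u \<le> \<tau>' \<Longrightarrow> \<bar>x n u\<bar> \<le> M'"
    by (rule sup_bound_step[OF reg \<tau>, folded \<tau>'_def]) (rule that)
  have M'0: "0 \<le> M'" using M'[of 0 0] r \<tau>' by auto
  obtain C where C: "0 \<le> C" "\<And>n s t. 0 \<le> s \<Longrightarrow> s \<le> t \<Longrightarrow> t \<le> \<tau>' \<Longrightarrow>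
    \<bar>dyadic_sum T g (F n) n t - dyadic_sum T g (F n) n s\<bar> \<le> C * (t - s) powr q"
    by (rule rough_term_holder[OF reg \<tau>(1), folded \<tau>'_def]) (rule that)
  \<comment> \<open>The drift has exponent 1 and the rough term exponent \<open>q\<close>; the
    powers of \<open>T\<close> are the price of lowering both to \<open>\<gamma>\<close>.\<close>
  define Z where "Z = L * (1 + M') * T powr (1 - \<gamma>) + \<bar>\<kappa>\<bar> * (C * T powr (q - \<gamma>))"
  have Z: "0 \<le> Z" using L M'0 C by (simp add: Z_def)
  have zZ: "\<bar>z n t - z n s\<bar> \<le> Z * (t - s) powr \<gamma>" if st: "0 \<le> s" "s \<le> t" "t \<le> \<tau>'" for n s t
  proof -
    have "\<bar>(LINT u:{0..t}|lborel. B n u) - (LINT u:{0..s}|lborel. B n u)\<bar> \<le> L * (1 + M') * (t - s)"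
    proof (rule drift_increment)
      show "\<bar>B n u\<bar> \<le> L * (1 + M')" if "u \<in> {0..t}" for u
        using that st \<tau>' M' by (intro B_le) auto
    qed (use st \<tau>' in auto)
    also have "t - s \<le> T powr (1 - \<gamma>) * (t - s) powr \<gamma>"
      using powr_le_powr_mult[of "t - s" T \<gamma> 1] st \<tau>' \<gamma> by simp
    finally have 1: "\<bar>(LINT u:{0..t}|lborel. B n u) - (LINT u:{0..s}|lborel. B n u)\<bar>
        \<le> L * (1 + M') * (T powr (1 - \<gamma>) * (t - s) powr \<gamma>)"
      using L M'0 by (simp add: mult_left_mono)
    have "\<bar>dyadic_sum T g (F n) n t - dyadic_sum T g (F n) n s\<bar> \<le> C * (t - s) powr q"
      by (rule C(2)[OF st])
    also have "\<dots> \<le> C * (T powr (q - \<gamma>) * (t - s) powr \<gamma>)"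
      using powr_le_powr_mult[of "t - s" T \<gamma> q] st \<tau>' \<gamma>_q C(1) by (intro mult_left_mono) auto
    finally have "\<bar>\<kappa>\<bar> * \<bar>dyadic_sum T g (F n) n t - dyadic_sum T g (F n) n s\<bar>
        \<le> \<bar>\<kappa>\<bar> * (C * (T powr (q - \<gamma>) * (t - s) powr \<gamma>))"
      by (rule mult_left_mono) simp
    then have 2: "\<bar>\<kappa> * dyadic_sum T g (F n) n t - \<kappa> * dyadic_sum T g (F n) n s\<bar>
        \<le> \<bar>\<kappa>\<bar> * (C * (T powr (q - \<gamma>) * (t - s) powr \<gamma>))"
      by (simp add: abs_mult [symmetric] right_diff_distrib)
    have "Z * (t - s) powr \<gamma> = L * (1 + M') * (T powr (1 - \<gamma>) * (t - s) powr \<gamma>)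
       + \<bar>\<kappa>\<bar> * (C * (T powr (q - \<gamma>) * (t - s) powr \<gamma>))"
      by (simp add: Z_def algebra_simps)
    moreover have "t \<in> {0..T}" "s \<in> {0..T}" using st \<tau>' by auto
    ultimately show ?thesis using 1 2 by (simp add: z_eq)
  qed
  have x1: "\<bar>x n t - x n s\<bar> \<le> 2 * Z * (t - s) powr \<gamma>" if st: "0 \<le> s" "s \<le> t" "t \<le> \<tau>'" for n s t
  proof -
    have "\<bar>x n t - x n s\<bar> \<le> 2 * (Z * (t - s) powr \<gamma>)"
    proof (rule reflected_increment)
      fix u assume u: "s \<le> u" "u \<le> t"
      have "\<bar>z n u - z n s\<bar> \<le> Z * (u - s) powr \<gamma>" using zZ[of s u n] u st by auto
      also have "\<dots> \<le> Z * (t - s) powr \<gamma>" using u Z \<gamma> q by (intro mult_left_mono powr_mono2) auto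
      finally show "\<bar>z n u - z n s\<bar> \<le> Z * (t - s) powr \<gamma>" .
    qed (use st \<tau>' in auto)
    then show ?thesis by simp
  qed
  have x0: "\<bar>x n t - x n s\<bar> \<le> H\<eta> * (t - s) powr \<gamma>" if st: "- r \<le> s" "s \<le> t" "t \<le> 0" for n s t
    using \<eta>_holder[OF st] st by (simp add: x_initial)
  have xx: "\<bar>x n t - x n s\<bar> \<le> (H\<eta> + 2 * Z) * (t - s) powr \<gamma>" if st: "- r \<le> s" "s \<le> t" "t \<le> \<tau>'" for n s t
  proof -
    consider "t \<le> 0" | "0 \<le> s" | "s \<le> 0" "0 \<le> t" by linarith
    then show ?thesis
    proof cases
      case 1
      have "0 \<le> 2 * Z * (t - s) powr \<gamma>" using Z by simp
      with x0[OF st(1,2) 1, of n] show ?thesis by (simp add: distrib_right)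
    next
      case 2
      have "0 \<le> H\<eta> * (t - s) powr \<gamma>" using H\<eta> by simp
      with x1[OF 2 st(2,3), of n] show ?thesis by (simp add: distrib_right)
    next
      \<comment> \<open>An interval across 0 is split there, which is why the two constants are
        added.\<close>
      case 3
      have "\<bar>x n 0 - x n s\<bar> \<le> H\<eta> * (0 - s) powr \<gamma>" using x0[of s 0 n] 3 st by simp
      also have "\<dots> \<le> H\<eta> * (t - s) powr \<gamma>" using 3 H\<eta> \<gamma> q by (intro mult_left_mono powr_mono2) auto
      finally have a: "\<bar>x n 0 - x n s\<bar> \<le> H\<eta> * (t - s) powr \<gamma>" .
      have "\<bar>x n t - x n 0\<bar> \<le> 2 * Z * (t - 0) powr \<gamma>" using x1[of 0 t n] 3 st by simp
      also have "\<dots> \<le> 2 * Z * (t - s) powr \<gamma>" using 3 Z \<gamma> q by (intro mult_left_mono powr_mono2) auto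
      finally show ?thesis using a by (simp add: distrib_right)
    qed
  qed
  have "regular_upto \<tau>' M' (H\<eta> + 2 * Z)"
    unfolding regular_upto_def using M' M'0 xx H\<eta> Z by auto
  then show ?thesis unfolding \<tau>'_def by blast
qed

lemma regular_start: "\<exists>M H. regular_upto 0 M H"
proof -
  \<comment> \<open>All levels agree with \<open>\<eta>\<close> on \<open>[- r, 0]\<close>, so level
    0 bounds them all there.\<close>
  obtain M where M: "\<And>u. - r \<le> u \<Longrightarrow> u \<le> T \<Longrightarrow> \<bar>x 0 u\<bar> \<le> M"
    by (rule x_bounded[of 0]) (rule that)
  have "\<bar>x n u\<bar> \<le> M" if "- r \<le> u" "u \<le> 0" for n u
    using M[of u] that T by (simp add: x_initial)
  moreover have "0 \<le> M" using M[of 0] r T by auto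
  ultimately have "regular_upto 0 M H\<eta>"
    unfolding regular_upto_def using H\<eta> \<eta>_holder by (auto simp: x_initial)
  then show ?thesis by blast
qed

lemma delay_induct:
  assumes start: "P 0" and step: "\<And>\<tau>. 0 \<le> \<tau> \<Longrightarrow> \<tau> \<le> T \<Longrightarrow> P \<tau> \<Longrightarrow> P (min (\<tau> + r) T)"
  shows "P T"
proof -
  have *: "P (min (real k * r) T)" for k
  proof (induction k)
    case 0 then show ?case using start T by simp
  next
    case (Suc k)
    have "min (min (real k * r) T + r) T = min (real (Suc k) * r) T"
      using r T by (auto simp: min_def algebra_simps)
    then show ?case using step[OF _ _ Suc.IH] r T by simp
  qed
  obtain k where "T < real k * r" using reals_Archimedean3[OF r] by blast
  then show ?thesis using *[of k] by simp
qed

lemma regular: "\<exists>M H. regular_upto T M H"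
  by (rule delay_induct) (use regular_start regular_step in blast)+

section \<open>Comparison of two levels\<close>

lemma B_diff:
  assumes reg: "regular_upto T M H" and s: "s \<in> {0..T}" and n: "N \<le> n" "N \<le> n'"
    and e: "0 \<le> e" "\<And>u. 0 \<le> u \<Longrightarrow> u \<le> s \<Longrightarrow> \<bar>x n u - x n' u\<bar> \<le> e"
  shows "\<bar>B n s - B n' s\<bar> \<le> L * ((T / 2 ^ N) powr \<beta> + H * (T / 2 ^ N) powr \<gamma>) + L * e"
proof -
  define v where "v = grid_point T n s"
  define v' where "v' = grid_point T n' s"
  define d where "d = T / 2 ^ N"
  have vT: "v \<in> {0..T}" "v' \<in> {0..T}" unfolding v_def v'_def using grid_in[OF s] by auto
  have vs: "v \<le> s" "v' \<le> s" unfolding v_def v'_def using grid_point_bounds(2)[OF T] s by auto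
  have H: "0 \<le> H" using reg by (simp add: regular_upto_def)
  \<comment> \<open>Both grid points lie in \<open>[s - d, s]\<close>, because the meshes of levels
    \<open>n\<close> and \<open>n'\<close> are at most \<open>d\<close>.\<close>
  have vv: "\<bar>v - v'\<bar> \<le> d"
  proof -
    have "T / 2 ^ k \<le> d" if "N \<le> k" for k
      unfolding d_def using T that by (intro divide_left_mono power_increasing) auto
    from this[OF n(1)] this[OF n(2)] show ?thesis
      using grid_point_bounds(2,3)[OF T, of s n] grid_point_bounds(2,3)[OF T, of s n'] s
      unfolding v_def v'_def by auto
  qed
  \<comment> \<open>Moving the time argument uses the time regularity of \<open>b\<close> at a fixed
    path.\<close>
  have 1: "\<bar>b v (segment r (x n) v) - b v' (segment r (x n) v)\<bar> \<le> L * d powr \<beta>"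
  proof -
    have "\<bar>b v (segment r (x n) v) - b v' (segment r (x n) v)\<bar> \<le> L * \<bar>v - v'\<bar> powr \<beta>"
      using vT by (intro b_holder segment_mspace) auto
    also have "\<dots> \<le> L * d powr \<beta>" using vv L \<beta> by (intro mult_left_mono powr_mono2) auto
    finally show ?thesis .
  qed
  \<comment> \<open>Shifting the segment of one path costs its Hoelder bound; changing the level at
    the same time costs \<open>e\<close>, and nothing before 0, where the paths agree.\<close>
  have 2: "\<bar>b v' (segment r (x n) v) - b v' (segment r (x n') v')\<bar> \<le> L * (H * d powr \<gamma> + e)"
  proof -
    have "\<bar>b v' (segment r (x n) v) - b v' (segment r (x n') v')\<bar>
        \<le> L * C_norm r (\<lambda>s. segment r (x n) v s - segment r (x n') v' s)"
      using vT by (intro b_lipschitz segment_mspace) auto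
    also have "C_norm r (\<lambda>s. segment r (x n) v s - segment r (x n') v' s) \<le> H * d powr \<gamma> + e"
    proof (rule C_norm_le)
      fix u assume u: "u \<in> {- r..0}"
      have "\<bar>x n (v + u) - x n (v' + u)\<bar> \<le> H * \<bar>v - v'\<bar> powr \<gamma>"
        using regular_holder[OF reg, of "v + u" "v' + u" n] regular_holder[OF reg, of "v' + u" "v + u" n]
          u vT by (cases "v \<le> v'") (auto simp: abs_minus_commute)
      also have "\<dots> \<le> H * d powr \<gamma>" using vv H \<gamma> q by (intro mult_left_mono powr_mono2) auto
      finally have "\<bar>x n (v + u) - x n (v' + u)\<bar> \<le> H * d powr \<gamma>" .
      moreover have "\<bar>x n (v' + u) - x n' (v' + u)\<bar> \<le> e"
      proof (cases "v' + u \<le> 0")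
        case True
        then show ?thesis using u vT e by (simp add: x_initial)
      next
        case False
        then show ?thesis using u vs by (intro e) auto
      qed
      ultimately show "\<bar>segment r (x n) v u - segment r (x n') v' u\<bar> \<le> H * d powr \<gamma> + e"
        using u by (simp add: segment_def)
    qed (use r in simp)
    finally show ?thesis using L by (simp add: mult_left_mono)
  qed
  have "\<bar>B n s - B n' s\<bar> \<le> L * d powr \<beta> + L * (H * d powr \<gamma> + e)"
    using 1 2 unfolding B_def v_def [symmetric] v'_def [symmetric] by linarith
  then show ?thesis unfolding d_def by (simp add: distrib_left)
qed

lemma F_uniformly_Cauchy:
  assumes C: "uniformly_Cauchy_on {- r..\<tau>} x"
  shows "uniformly_Cauchy_on {0..min (\<tau> + r) T} F"
  unfolding uniformly_Cauchy_on_def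
proof (intro allI impI)
  fix e :: real assume e: "0 < e"
  define e' where "e' = e / (L + 1)"
  have e': "0 < e'" using e L by (simp add: e'_def)
  then obtain N where N: "\<And>u n n'. u \<in> {- r..\<tau>} \<Longrightarrow> N \<le> n \<Longrightarrow> N \<le> n' \<Longrightarrow> dist (x n u) (x n' u) < e'"
    using C unfolding uniformly_Cauchy_on_def by metis
  show "\<exists>M. \<forall>u\<in>{0..min (\<tau> + r) T}. \<forall>n\<ge>M. \<forall>n'\<ge>M. dist (F n u) (F n' u) < e"
  proof (intro exI[of _ N] ballI allI impI)
    fix u n n' assume u: "u \<in> {0..min (\<tau> + r) T}" and n: "N \<le> n" "N \<le> n'"
    have "\<bar>F n u - F n' u\<bar> \<le> L * \<bar>x n (u - r) - x n' (u - r)\<bar>"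
      unfolding F_def using u by (intro \<sigma>_lipschitz) auto
    also have "\<dots> \<le> L * e'"
      using N[of "u - r" n n'] u n L by (intro mult_left_mono) (auto simp: dist_real_def)
    also have "\<dots> < (L + 1) * e'" using e' by simp
    also have "\<dots> = e" using L by (simp add: e'_def)
    finally show "dist (F n u) (F n' u) < e" by (simp add: dist_real_def)
  qed
qed

text \<open>Gronwall's argument of \<open>sup_bound_step\<close> applied to a difference. The number
  \<open>w\<close> gathers the errors that do not involve the current distance of the paths, namely
  mesh and rough term. The initial values cancel, and \<open>2 * M\<close> is the a priori
  bound.\<close>

lemma difference_bound:
  assumes reg: "regular_upto T M H" and \<tau>': "0 \<le> \<tau>'" "\<tau>' \<le> T" and n: "N \<le> n" "N \<le> n'" and w: "0 \<le> w"
    and rough: "\<And>s. s \<in> {0..\<tau>'} \<Longrightarrow> \<bar>dyadic_sum T g (F n) n s - dyadic_sum T g (F n') n' s\<bar> \<le> w"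
    and mesh: "L * ((T / 2 ^ N) powr \<beta> + H * (T / 2 ^ N) powr \<gamma>) \<le> w"
    and t: "t \<in> {0..\<tau>'}"
  shows "\<bar>x n t - x n' t\<bar> \<le> 4 * ((T + \<bar>\<kappa>\<bar>) * w) * exp ((4 * L + 1) * T)"
proof -
  define A where "A = (T + \<bar>\<kappa>\<bar>) * w"
  have A: "0 \<le> A" using T w by (simp add: A_def)
  define l where "l = 4 * L + 1"
  have l: "0 < l" "2 * (L / l) \<le> 1 / 2" using L by (auto simp: l_def field_simps)
  have "\<bar>x n t - x n' t\<bar> \<le> 2 * (2 * A) * exp (l * t)"
  proof (rule gronwall_exp[where S = "{0..\<tau>'}" and D = "\<lambda>t. \<bar>x n t - x n' t\<bar>" and K = "2 * M"])
    show "\<bar>x n t - x n' t\<bar> \<le> 2 * M" if "t \<in> {0..\<tau>'}" for t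
      using regular_sup[OF reg, of t n] regular_sup[OF reg, of t n'] that \<tau>' r by auto
    fix E t assume E: "0 \<le> E" and le: "\<And>s. s \<in> {0..\<tau>'} \<Longrightarrow> \<bar>x n s - x n' s\<bar> \<le> E * exp (l * s)"
      and t: "t \<in> {0..\<tau>'}"
    have Bb: "\<bar>B n s - B n' s\<bar> \<le> w + L * E * exp (l * s)" if s: "s \<in> {0..\<tau>'}" for s
    proof -
      have "\<bar>B n s - B n' s\<bar> \<le> L * ((T / 2 ^ N) powr \<beta> + H * (T / 2 ^ N) powr \<gamma>) + L * (E * exp (l * s))"
      proof (rule B_diff[OF reg _ n])
        show "\<bar>x n u - x n' u\<bar> \<le> E * exp (l * s)" if "0 \<le> u" "u \<le> s" for u
        proof -
          have "\<bar>x n u - x n' u\<bar> \<le> E * exp (l * u)" using le that s by auto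
          also have "\<dots> \<le> E * exp (l * s)" using that E l by (intro mult_left_mono) auto
          finally show ?thesis .
        qed
      qed (use s \<tau>' E in auto)
      then show ?thesis using mesh by (simp add: mult.assoc)
    qed
    have zb: "\<bar>z n s - z n' s\<bar> \<le> A + L / l * E * exp (l * t)" if s: "s \<in> {0..t}" for s
    proof -
      have st: "s \<in> {0..\<tau>'}" "s \<in> {0..T}" using s t \<tau>' by auto
      have i: "set_integrable lborel {0..s} (B n)" "set_integrable lborel {0..s} (B n')"
        using st B_integrable by auto
      have "\<bar>LINT u:{0..s}|lborel. B n u - B n' u\<bar> \<le> w * s + L * E / l * exp (l * s)"
        using Bb st L E l i by (intro set_integral_exp_bound set_integral_diff(1)) auto
      also have "\<dots> \<le> w * T + L * E / l * exp (l * t)"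
        using s st L E l w by (intro add_mono mult_left_mono) auto
      finally have 1: "\<bar>(LINT u:{0..s}|lborel. B n u) - (LINT u:{0..s}|lborel. B n' u)\<bar>
          \<le> w * T + L * E / l * exp (l * t)"
        using set_integral_diff(2)[OF i] by simp
      have 2: "\<bar>\<kappa> * dyadic_sum T g (F n) n s - \<kappa> * dyadic_sum T g (F n') n' s\<bar> \<le> \<bar>\<kappa>\<bar> * w"
        unfolding right_diff_distrib [symmetric] abs_mult using rough[OF st(1)] by (rule mult_left_mono) simp
      show ?thesis
        using 1 2 unfolding z_eq[OF st(2)] A_def by (simp add: algebra_simps)
    qed
    have tT: "t \<in> {0..T}" "t \<le> T" using t \<tau>' by auto
    have "\<bar>x n t - x n' t\<bar> \<le> 2 * (A + L / l * E * exp (l * t))"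
      using reflection_diff[OF z_continuous_sub[OF tT(2)] z_continuous_sub[OF tT(2)] _ zb] zb[of t] t
      unfolding x_reflected[OF tT(1)] by force
    also have "\<dots> = 2 * A + (2 * (L / l)) * (E * exp (l * t))" by (simp add: algebra_simps)
    also have "\<dots> \<le> 2 * A + 1 / 2 * (E * exp (l * t))"
      using l E by (intro add_left_mono mult_right_mono) auto
    finally show "\<bar>x n t - x n' t\<bar> \<le> 2 * A + E / 2 * exp (l * t)" by simp
  qed (use A l t in auto)
  also have "\<dots> \<le> 2 * (2 * A) * exp (l * T)"
    using t \<tau>' A l by (intro mult_left_mono) auto
  finally show ?thesis by (simp add: A_def l_def)
qed

lemma uniformly_Cauchy_step:
  assumes reg: "regular_upto T M H" and \<tau>: "0 \<le> \<tau>" "\<tau> \<le> T"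
    and C: "uniformly_Cauchy_on {- r..\<tau>} x"
  shows "uniformly_Cauchy_on {- r..min (\<tau> + r) T} x"
  unfolding uniformly_Cauchy_on_def
proof (intro allI impI)
  fix e :: real assume e: "0 < e"
  define \<tau>' where "\<tau>' = min (\<tau> + r) T"
  have \<tau>': "0 \<le> \<tau>'" "\<tau>' \<le> T" using \<tau> r T by (auto simp: \<tau>'_def)
  have MH: "0 \<le> M" "0 \<le> H" using reg by (auto simp: regular_upto_def)
  have reg': "regular_upto \<tau> M H" using reg \<tau> by (auto simp: regular_upto_def)
  have "uniformly_Cauchy_on {0..\<tau>'} (\<lambda>n t. dyadic_sum T g (F n) n t)"
  proof (rule dyadic_sums_uniformly_Cauchy[OF \<tau>'])
    show "0 \<le> L * (T powr (\<beta> - \<gamma>) * (1 + M) + H)" using L MH by simp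
    show "uniformly_Cauchy_on {0..\<tau>'} F" unfolding \<tau>'_def by (rule F_uniformly_Cauchy[OF C])
  qed (use F_regular[OF reg'] in \<open>simp add: \<tau>'_def\<close>)
  \<comment> \<open>Chosen so that the bound of \<open>difference_bound\<close> equals
    \<open>e / 2\<close>.\<close>
  define w where "w = e / (8 * (T + \<bar>\<kappa>\<bar>) * exp ((4 * L + 1) * T))"
  have Tk: "0 < T + \<bar>\<kappa>\<bar>" using T by simp
  have w: "0 < w" using e Tk by (simp add: w_def)
  obtain N1 where N1: "\<And>t n n'. t \<in> {0..\<tau>'} \<Longrightarrow> N1 \<le> n \<Longrightarrow> N1 \<le> n' \<Longrightarrow>
      dist (dyadic_sum T g (F n) n t) (dyadic_sum T g (F n') n' t) < w"
    using \<open>uniformly_Cauchy_on {0..\<tau>'} _\<close> w unfolding uniformly_Cauchy_on_def by metis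
  have d: "(\<lambda>N. T / 2 ^ N) \<longlonglongrightarrow> 0"
  proof -
    have "(\<lambda>N. T * (1 / 2) ^ N) \<longlonglongrightarrow> T * 0"
      by (intro tendsto_intros LIMSEQ_realpow_zero) auto
    then show ?thesis by (simp add: power_divide)
  qed
  have "(\<lambda>N. L * ((T / 2 ^ N) powr \<beta> + H * (T / 2 ^ N) powr \<gamma>)) \<longlonglongrightarrow> L * (0 powr \<beta> + H * 0 powr \<gamma>)"
    using d T \<beta> \<gamma> q by (intro tendsto_intros tendsto_powr2) (auto intro!: always_eventually)
  then have "\<forall>\<^sub>F N in sequentially. L * ((T / 2 ^ N) powr \<beta> + H * (T / 2 ^ N) powr \<gamma>) < w"
    using w by (intro order_tendstoD(2)) auto
  then obtain N2 where N2: "\<And>N. N2 \<le> N \<Longrightarrow> L * ((T / 2 ^ N) powr \<beta> + H * (T / 2 ^ N) powr \<gamma>) < w"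
    by (auto simp: eventually_sequentially)
  define N where "N = max N1 N2"
  have "dist (x n t) (x n' t) < e" if n: "N \<le> n" "N \<le> n'" and t: "t \<in> {- r..\<tau>'}" for n n' t
  proof (cases "t \<le> 0")
    case True
    then show ?thesis using t e by (simp add: x_initial)
  next
    case False
    have "\<bar>x n t - x n' t\<bar> \<le> 4 * ((T + \<bar>\<kappa>\<bar>) * w) * exp ((4 * L + 1) * T)"
    proof (rule difference_bound[OF reg \<tau>' n])
      show "\<bar>dyadic_sum T g (F n) n s - dyadic_sum T g (F n') n' s\<bar> \<le> w" if "s \<in> {0..\<tau>'}" for s
        using N1[OF that, of n n'] n by (simp add: N_def dist_real_def)
      show "L * ((T / 2 ^ N) powr \<beta> + H * (T / 2 ^ N) powr \<gamma>) \<le> w"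
        using N2[of N] by (simp add: N_def)
    qed (use w t False in auto)
    also have "\<dots> = e / 2"
    proof -
      have *: "4 * (k * (e / (8 * k * E))) * E = e / 2" if "0 < k" "0 < E" for k E :: real
        using that by (simp add: field_simps)
      show ?thesis unfolding w_def by (rule * [OF Tk exp_gt_zero])
    qed
    finally show ?thesis using e by (simp add: dist_real_def)
  qed
  then show "\<exists>N. \<forall>t\<in>{- r..min (\<tau> + r) T}. \<forall>n\<ge>N. \<forall>n'\<ge>N. dist (x n t) (x n' t) < e"
    unfolding \<tau>'_def by blast
qed

theorem uniformly_Cauchy: "uniformly_Cauchy_on {- r..T} x"
proof -
  obtain M H where reg: "regular_upto T M H" using regular by blast
  show ?thesis
  proof (rule delay_induct)
    show "uniformly_Cauchy_on {- r..0} x"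
      by (simp add: uniformly_Cauchy_on_def x_initial)
  qed (rule uniformly_Cauchy_step[OF reg])
qed

end

section \<open>From the coefficient assumptions to the abstract scheme\<close>

lemma diffusion_coefficient_pointwise:
  assumes r: "0 < r" and \<sigma>: "diffusion_coefficient r T \<beta> (\<lambda>t \<phi>. \<sigma> t (\<phi> (- r)))"
  obtains L where "0 \<le> L" "\<And>t v. t \<in> {0..T} \<Longrightarrow> \<bar>\<sigma> t v\<bar> \<le> L * (1 + \<bar>v\<bar>)"
    "\<And>t v w. t \<in> {0..T} \<Longrightarrow> \<bar>\<sigma> t v - \<sigma> t w\<bar> \<le> L * \<bar>v - w\<bar>"
    "\<And>s t v. s \<in> {0..T} \<Longrightarrow> t \<in> {0..T} \<Longrightarrow> \<bar>\<sigma> t v - \<sigma> s v\<bar> \<le> L * \<bar>t - s\<bar> powr \<beta> * (1 + \<bar>v\<bar>)"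
proof -
  \<comment> \<open>Constant paths carry the bounds from the functional to \<open>\<sigma>\<close>:
    their norm is \<open>\<bar>v\<bar>\<close>, and that of a difference is
    \<open>\<bar>v - w\<bar>\<close>.\<close>
  define c where "c = (\<lambda>v::real. \<lambda>s\<in>{- r..0}. v)"
  have c: "c v \<in> mspace (C_space (- r) 0)" "c v (- r) = v" "C_norm r (c v) = \<bar>v\<bar>"
    "C_norm r (\<lambda>s. c v s - c w s) = \<bar>v - w\<bar>" for v w
    using r by (auto simp: c_def mspace_C_space C_norm_def cong: continuous_on_cong_simp)
  obtain L1 L2 L3 where L:
    "\<And>t \<phi>. t \<in> {0..T} \<Longrightarrow> \<phi> \<in> mspace (C_space (- r) 0) \<Longrightarrow> \<bar>\<sigma> t (\<phi> (- r))\<bar> \<le> L1 * (1 + C_norm r \<phi>)"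
    "\<And>t \<phi> \<psi>. t \<in> {0..T} \<Longrightarrow> \<phi> \<in> mspace (C_space (- r) 0) \<Longrightarrow> \<psi> \<in> mspace (C_space (- r) 0) \<Longrightarrow>
      \<bar>\<sigma> t (\<phi> (- r)) - \<sigma> t (\<psi> (- r))\<bar> \<le> L2 * C_norm r (\<lambda>s. \<phi> s - \<psi> s)"
    "\<And>s t \<phi>. s \<in> {0..T} \<Longrightarrow> t \<in> {0..T} \<Longrightarrow> \<phi> \<in> mspace (C_space (- r) 0) \<Longrightarrow>
      \<bar>\<sigma> t (\<phi> (- r)) - \<sigma> s (\<phi> (- r))\<bar> \<le> L3 * \<bar>t - s\<bar> powr \<beta> * (1 + C_norm r \<phi>)"
    using \<sigma> unfolding diffusion_coefficient_def by blast
  define L where "L = max 0 (max L1 (max L2 L3))"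
  have le: "0 \<le> L" "L1 \<le> L" "L2 \<le> L" "L3 \<le> L" by (auto simp: L_def)
  show ?thesis
  proof (rule that[of L])
    show "\<bar>\<sigma> t v\<bar> \<le> L * (1 + \<bar>v\<bar>)" if "t \<in> {0..T}" for t v
      using L(1)[OF that c(1)[of v]] mult_right_mono[OF le(2), of "1 + \<bar>v\<bar>"] by (simp add: c)
    show "\<bar>\<sigma> t v - \<sigma> t w\<bar> \<le> L * \<bar>v - w\<bar>" if "t \<in> {0..T}" for t v w
      using L(2)[OF that c(1)[of v] c(1)[of w]] mult_right_mono[OF le(3), of "\<bar>v - w\<bar>"] by (simp add: c)
    show "\<bar>\<sigma> t v - \<sigma> s v\<bar> \<le> L * \<bar>t - s\<bar> powr \<beta> * (1 + \<bar>v\<bar>)" if "s \<in> {0..T}" "t \<in> {0..T}" for s t v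
      using L(3)[OF that c(1)[of v]] mult_right_mono[OF le(4), of "\<bar>t - s\<bar> powr \<beta> * (1 + \<bar>v\<bar>)"]
      by (simp add: c mult.assoc)
  qed (rule le)
qed

lemma drift_coefficient_bounds:
  assumes r: "0 < r" and b: "drift_coefficient r T b"
    and bt: "\<exists>L. \<forall>s\<in>{0..T}. \<forall>t\<in>{0..T}. \<forall>\<phi>\<in>mspace (C_space (- r) 0). \<bar>b t \<phi> - b s \<phi>\<bar> \<le> L * \<bar>t - s\<bar> powr \<beta>"
  obtains L where "0 \<le> L"
    "\<And>t \<phi>. t \<in> {0..T} \<Longrightarrow> \<phi> \<in> mspace (C_space (- r) 0) \<Longrightarrow> \<bar>b t \<phi>\<bar> \<le> L * (1 + C_norm r \<phi>)"
    "\<And>t \<phi> \<psi>. t \<in> {0..T} \<Longrightarrow> \<phi> \<in> mspace (C_space (- r) 0) \<Longrightarrow> \<psi> \<in> mspace (C_space (- r) 0) \<Longrightarrow>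
      \<bar>b t \<phi> - b t \<psi>\<bar> \<le> L * C_norm r (\<lambda>s. \<phi> s - \<psi> s)"
    "\<And>s t \<phi>. s \<in> {0..T} \<Longrightarrow> t \<in> {0..T} \<Longrightarrow> \<phi> \<in> mspace (C_space (- r) 0) \<Longrightarrow>
      \<bar>b t \<phi> - b s \<phi>\<bar> \<le> L * \<bar>t - s\<bar> powr \<beta>"
proof -
  obtain L1 L2 L3 where L:
    "\<And>t \<phi>. t \<in> {0..T} \<Longrightarrow> \<phi> \<in> mspace (C_space (- r) 0) \<Longrightarrow> \<bar>b t \<phi>\<bar> \<le> L1 * (1 + C_norm r \<phi>)"
    "\<And>t \<phi> \<psi>. t \<in> {0..T} \<Longrightarrow> \<phi> \<in> mspace (C_space (- r) 0) \<Longrightarrow> \<psi> \<in> mspace (C_space (- r) 0) \<Longrightarrow>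
      \<bar>b t \<phi> - b t \<psi>\<bar> \<le> L2 * C_norm r (\<lambda>s. \<phi> s - \<psi> s)"
    "\<And>s t \<phi>. s \<in> {0..T} \<Longrightarrow> t \<in> {0..T} \<Longrightarrow> \<phi> \<in> mspace (C_space (- r) 0) \<Longrightarrow>
      \<bar>b t \<phi> - b s \<phi>\<bar> \<le> L3 * \<bar>t - s\<bar> powr \<beta>"
    using b bt unfolding drift_coefficient_def by blast
  define L where "L = max 0 (max L1 (max L2 L3))"
  have le: "0 \<le> L" "L1 \<le> L" "L2 \<le> L" "L3 \<le> L" by (auto simp: L_def)
  \<comment> \<open>A constant may be enlarged only in front of a nonnegative factor.\<close>
  have nn: "0 \<le> C_norm r \<phi>" "0 \<le> C_norm r (\<lambda>s. \<phi> s - \<psi> s)"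
    if "\<phi> \<in> mspace (C_space (- r) 0)" "\<psi> \<in> mspace (C_space (- r) 0)" for \<phi> \<psi>
    using that r by (auto simp: mspace_C_space intro!: C_norm_nonneg continuous_on_diff)
  show ?thesis
  proof (rule that[of L])
    show "\<bar>b t \<phi>\<bar> \<le> L * (1 + C_norm r \<phi>)" if "t \<in> {0..T}" "\<phi> \<in> mspace (C_space (- r) 0)" for t \<phi>
      using nn(1)[OF that(2,2)] by (intro order_trans[OF L(1)[OF that] mult_right_mono[OF le(2)]]) simp
    show "\<bar>b t \<phi> - b t \<psi>\<bar> \<le> L * C_norm r (\<lambda>s. \<phi> s - \<psi> s)"
      if "t \<in> {0..T}" "\<phi> \<in> mspace (C_space (- r) 0)" "\<psi> \<in> mspace (C_space (- r) 0)" for t \<phi> \<psi>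
      using L(2)[OF that] mult_right_mono[OF le(3) nn(2)[OF that(2,3)]] by simp
    show "\<bar>b t \<phi> - b s \<phi>\<bar> \<le> L * \<bar>t - s\<bar> powr \<beta>"
      if "s \<in> {0..T}" "t \<in> {0..T}" "\<phi> \<in> mspace (C_space (- r) 0)" for s t \<phi>
      using L(3)[OF that] mult_right_mono[OF le(4), of "\<bar>t - s\<bar> powr \<beta>"] by simp
  qed (rule le)
qed

lemma gls_integral_grid:
  assumes \<alpha>: "0 < \<alpha>" "\<alpha> < 1" and T: "0 < T" and g: "g \<in> W_space \<alpha> T" and t: "t \<in> {0..T}"
  shows "gls_integral \<alpha> 0 t (\<lambda>s. f (grid_point T n s)) g = gls_const \<alpha> * dyadic_sum T g f n t"
proof -
  have "gls_integral \<alpha> 0 t (\<lambda>s. f (grid_point T n s)) g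
    = gls_const \<alpha> * (\<Sum>i<2 ^ n. f (real i * (T / 2 ^ n)) *
        (g (min (real (Suc i) * (T / 2 ^ n)) t) - g (min (real i * (T / 2 ^ n)) t)))"
  proof (rule gls_integral_step[OF \<alpha> T g])
    show "f (grid_point T n y) = f (real (nat \<lfloor>y / (T / 2 ^ n)\<rfloor>) * (T / 2 ^ n))" if "0 \<le> y" for y
    proof -
      have "0 \<le> \<lfloor>y / (T / 2 ^ n)\<rfloor>" using that T by simp
      then show ?thesis by (simp add: grid_point_def)
    qed
  qed (use T t grid_point_measurable in auto)
  then show ?thesis by (simp add: dyadic_sum_def)
qed

theorem proposition5p1:
  fixes T r \<theta> \<beta> \<alpha> :: real
    and \<eta> :: "real \<Rightarrow> real"
    and b :: "real \<Rightarrow> (real \<Rightarrow> real) \<Rightarrow> real"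
    and \<sigma> :: "real \<Rightarrow> real \<Rightarrow> real"
    and g :: "real \<Rightarrow> real"
    and x z :: "nat \<Rightarrow> real \<Rightarrow> real"
  assumes "0 < T" and "0 < r"
    and "0 < \<theta>" and "\<theta> \<le> 1"
    and "\<And>s. s \<in> {- r..0} \<Longrightarrow> 0 \<le> \<eta> s"
    and "holder_on \<theta> {- r..0} \<eta>"
    and "drift_coefficient r T b"
    and "0 < \<beta>" and "\<beta> < 1"
    and "diffusion_coefficient r T \<beta> (\<lambda>t \<phi>. \<sigma> t (\<phi> (- r)))"
    and "\<exists>L. \<forall>s\<in>{0..T}. \<forall>t\<in>{0..T}. \<forall>\<phi>\<in>mspace (C_space (- r) 0).
           \<bar>b t \<phi> - b s \<phi>\<bar> \<le> L * \<bar>t - s\<bar> powr \<beta>"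
    and "0 < \<alpha>" and "\<alpha> < min (1 / 2) (min \<theta> \<beta>)"
    and "g \<in> W_space \<alpha> T"
    and "\<And>n. euler_scheme \<alpha> r T \<eta> b \<sigma> g n (x n) (z n)"
  shows "Metric_space.MCauchy (mspace (C_space (- r) T)) (mdist (C_space (- r) T))
           (\<lambda>n. \<lambda>t\<in>{- r..T}. x n t)"
proof -
  note T = assms(1) and r = assms(2) and \<alpha> = assms(12,13)
  \<comment> \<open>The initial path, the time dependence of the coefficients and the rough term
    each limit the regularity of the integrands. Since \<open>\<alpha> < 1 / 2\<close> gives
    \<open>1 - \<alpha> > \<alpha>\<close>, all three exponents exceed \<open>\<alpha>\<close>, and
    Young's condition holds with \<open>q = 1 - \<alpha>\<close>.\<close>
  define \<gamma> where "\<gamma> = min \<theta> (min \<beta> (1 - \<alpha>))"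
  obtain G where G: "0 \<le> G"
    and hol: "\<And>u v. 0 \<le> u \<Longrightarrow> u < v \<Longrightarrow> v \<le> T \<Longrightarrow> \<bar>g v - g u\<bar> \<le> G * (v - u) powr (1 - \<alpha>)"
    by (rule W_space_bounds[OF assms(14)]) (rule that)
  obtain C where C: "\<And>s t. s \<in> {- r..0} \<Longrightarrow> t \<in> {- r..0} \<Longrightarrow> \<bar>\<eta> t - \<eta> s\<bar> \<le> C * \<bar>t - s\<bar> powr \<theta>"
    using assms(6) unfolding holder_on_def by blast
  obtain L1 where L1: "0 \<le> L1"
    "\<And>t \<phi>. t \<in> {0..T} \<Longrightarrow> \<phi> \<in> mspace (C_space (- r) 0) \<Longrightarrow> \<bar>b t \<phi>\<bar> \<le> L1 * (1 + C_norm r \<phi>)"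
    "\<And>t \<phi> \<psi>. t \<in> {0..T} \<Longrightarrow> \<phi> \<in> mspace (C_space (- r) 0) \<Longrightarrow> \<psi> \<in> mspace (C_space (- r) 0) \<Longrightarrow>
      \<bar>b t \<phi> - b t \<psi>\<bar> \<le> L1 * C_norm r (\<lambda>s. \<phi> s - \<psi> s)"
    "\<And>s t \<phi>. s \<in> {0..T} \<Longrightarrow> t \<in> {0..T} \<Longrightarrow> \<phi> \<in> mspace (C_space (- r) 0) \<Longrightarrow>
      \<bar>b t \<phi> - b s \<phi>\<bar> \<le> L1 * \<bar>t - s\<bar> powr \<beta>"
    by (rule drift_coefficient_bounds[OF r assms(7,11)]) (rule that)
  obtain L2 where L2: "0 \<le> L2" "\<And>t v. t \<in> {0..T} \<Longrightarrow> \<bar>\<sigma> t v\<bar> \<le> L2 * (1 + \<bar>v\<bar>)"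
    "\<And>t v w. t \<in> {0..T} \<Longrightarrow> \<bar>\<sigma> t v - \<sigma> t w\<bar> \<le> L2 * \<bar>v - w\<bar>"
    "\<And>s t v. s \<in> {0..T} \<Longrightarrow> t \<in> {0..T} \<Longrightarrow> \<bar>\<sigma> t v - \<sigma> s v\<bar> \<le> L2 * \<bar>t - s\<bar> powr \<beta> * (1 + \<bar>v\<bar>)"
    by (rule diffusion_coefficient_pointwise[OF r assms(10)]) (rule that)
  define L where "L = L1 + L2"
  have up: "a \<le> L1 * c \<Longrightarrow> 0 \<le> c \<Longrightarrow> a \<le> L * c" "a \<le> L2 * c \<Longrightarrow> 0 \<le> c \<Longrightarrow> a \<le> L * c" for a c
    using L1(1) L2(1) by (auto simp: L_def distrib_right intro: add_increasing add_increasing2)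
  have nn: "0 \<le> C_norm r \<phi>" "0 \<le> C_norm r (\<lambda>s. \<phi> s - \<psi> s)"
    if "\<phi> \<in> mspace (C_space (- r) 0)" "\<psi> \<in> mspace (C_space (- r) 0)" for \<phi> \<psi>
    using that r by (auto simp: mspace_C_space intro!: C_norm_nonneg continuous_on_diff)
  note scheme = assms(15)[unfolded euler_scheme_def]
  \<comment> \<open>The constant of \<open>\<eta>\<close> pays for lowering the exponent
    \<open>\<theta>\<close> to \<open>\<gamma>\<close> on an interval of length \<open>r\<close>.
    The absolute value is taken because \<open>holder_on\<close> gives \<open>C\<close> without a
    sign.\<close>
  interpret reflected_euler T "1 - \<alpha>" \<gamma> G g r "gls_const \<alpha>" \<beta> L "\<bar>C\<bar> * r powr (\<theta> - \<gamma>)" \<eta> b \<sigma> x z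
  proof
    show "\<bar>\<eta> v - \<eta> u\<bar> \<le> \<bar>C\<bar> * r powr (\<theta> - \<gamma>) * (v - u) powr \<gamma>"
      if "- r \<le> u" "u \<le> v" "v \<le> 0" for u v
    proof -
      have "\<bar>\<eta> v - \<eta> u\<bar> \<le> C * \<bar>v - u\<bar> powr \<theta>" using that by (intro C) auto
      also have "\<dots> \<le> \<bar>C\<bar> * \<bar>v - u\<bar> powr \<theta>" by (intro mult_right_mono) auto
      also have "\<dots> \<le> \<bar>C\<bar> * (r powr (\<theta> - \<gamma>) * (v - u) powr \<gamma>)"
        using powr_le_powr_mult[of "v - u" r \<gamma> \<theta>] that by (intro mult_left_mono) (auto simp: \<gamma>_def)
      finally show ?thesis by (simp add: mult.assoc)
    qed
    show "\<bar>b t \<phi>\<bar> \<le> L * (1 + C_norm r \<phi>)" if "t \<in> {0..T}" "\<phi> \<in> mspace (C_space (- r) 0)" for t \<phi>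
      using up(1)[OF L1(2)[OF that]] nn(1)[OF that(2,2)] by simp
    show "\<bar>b t \<phi> - b t \<psi>\<bar> \<le> L * C_norm r (\<lambda>s. \<phi> s - \<psi> s)"
      if "t \<in> {0..T}" "\<phi> \<in> mspace (C_space (- r) 0)" "\<psi> \<in> mspace (C_space (- r) 0)" for t \<phi> \<psi>
      by (rule up(1)[OF L1(3)[OF that] nn(2)[OF that(2,3)]])
    show "\<bar>b t \<phi> - b s \<phi>\<bar> \<le> L * \<bar>t - s\<bar> powr \<beta>"
      if "s \<in> {0..T}" "t \<in> {0..T}" "\<phi> \<in> mspace (C_space (- r) 0)" for s t \<phi>
      by (rule up(1)[OF L1(4)[OF that]]) simp
    show "\<bar>\<sigma> t v\<bar> \<le> L * (1 + \<bar>v\<bar>)" if "t \<in> {0..T}" for t v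
      by (rule up(2)[OF L2(2)[OF that]]) simp
    show "\<bar>\<sigma> t v - \<sigma> t w\<bar> \<le> L * \<bar>v - w\<bar>" if "t \<in> {0..T}" for t v w
      by (rule up(2)[OF L2(3)[OF that]]) simp
    show "\<bar>\<sigma> t v - \<sigma> s v\<bar> \<le> L * \<bar>t - s\<bar> powr \<beta> * (1 + \<bar>v\<bar>)" if "s \<in> {0..T}" "t \<in> {0..T}" for s t v
      using up(2)[of _ "\<bar>t - s\<bar> powr \<beta> * (1 + \<bar>v\<bar>)"] L2(4)[OF that, of v] by (simp add: mult.assoc)
    show "x n t = z n t + reflection (z n) t" if "t \<in> {0..T}" for n t
      using scheme that by (simp add: reflection_def)
    show "x n t = \<eta> t" if "t \<in> {- r..0}" for n t using scheme that by blast
    show "z n t = \<eta> 0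
      + (LINT s:{0..t}|lborel. b (grid_point T n s) (segment r (x n) (grid_point T n s)))
      + gls_const \<alpha> * dyadic_sum T g (\<lambda>s. \<sigma> s (x n (s - r))) n t" if "t \<in> {0..T}" for n t
      using scheme that gls_integral_grid[of \<alpha> T g t "\<lambda>s. \<sigma> s (x n (s - r))" n] \<alpha> T assms(14) by simp
  qed (use T r \<alpha> G hol L1(1) L2(1) assms(4,5,8) in \<open>auto simp: \<gamma>_def L_def\<close>)
  show ?thesis
    by (rule uniformly_Cauchy_imp_MCauchy[OF x_continuous uniformly_Cauchy])
qed

end
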